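(* Let $B$ be a Blaschke product with exactly $n\ge 1$ singularities on the unit circle $\mathbb{T}$, and let $\mathcal{G}$ be its group of continuous invariants. Let $k$ be the number of intervals of type $2$ among the $n$ open arcs comprising $\mathbb{T}\setminus\sigma(B)$, and let $d$ be the number of cyclic permutations of these $n$ arcs (the identity included) that map each arc onto an arc of the same type. Then $0\le k\le n$, $1\le d\le n$, $d\mid n$, and $\mathcal{G}$ is isomorphic to a semidirect product $$\mathcal{G}\cong \mathbb{Z}^k\rtimes\mathbb{Z}_d ,$$ where $\mathbb{Z}_d$ denotes the cyclic group of order $d$.
   Context: $\mathbb{D}$ is the open unit disc and $\mathbb{T}$ the unit circle. A Blaschke product is $B(z)=\lambda z^p\prod_{j}\frac{|a_j|}{a_j}\frac{a_j-z}{1-\overline{a_j}z}$ with $|\lambda|=1$, $p$ a non-negative integer, $a_j\in\mathbb{D}\setminus\{0\}$ finitely or infinitely many, $\sum_j(1-|a_j|)<\infty$. The spectrum $\sigma(B)\subset\mathbb{T}$ is the complement in $\mathbb{T}$ of the set of points having a neighbourhood into which $B$ extends analytically. Points of $\sigma(B)$ are the singularities (singular points) of $B$; the other points of $\mathbb{T}$ are regular points. $\mathcal{G}$ is the group, under composition, of continuous maps $x:\mathbb{T}\to\mathbb{T}$ that map singular points to singular points and regular points to regular points and satisfy $B(x(z))=B(z)$ for every regular point $z\in\mathbb{T}$. The intervals are the components $I_1,\dots,I_n$ of $\mathbb{T}\setminus\sigma(B)$, numbered in cyclic counterclockwise order (if $n=1$ the only interval is the circle minus the singularity, both of whose endpoints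 are that singularity). A cyclic permutation of the intervals is a map $I_j\mapsto I_{j+r}$ (indices mod $n$) for some fixed $r\in\mathbb{Z}/n\mathbb{Z}$. Traversing an interval counterclockwise from its initial endpoint $e^{i\theta_0}$ to its terminal endpoint $e^{i\theta_1}$, the interval is: of type $0$ if $B(\xi)=1$ has only finitely many solutions $\xi$ in it; of type $1_a$ if it has infinitely many solutions, accumulating precisely at the initial endpoint; of type $1_b$ if it has infinitely many solutions, accumulating precisely at the terminal endpoint; of type $2$ if the solutions accumulate precisely at both ends. At an end of an interval where the solutions do not accumulate, $B$ has a one-sided limit (along the interval). Here two intervals are of the same type if: both are of type $2$; or both are of type $1_a$ and $B$ has the same one-sided limit $L$ at their terminal endpoints; or both are of type $1_b$ and $B$ has the same one-sided limit $L$ at their initial endpoints; or both are of type $0$ and their images under $B$ are identical including multiplicities (every $\lambda\in\mathbb{T}$ is attained by $B$ the same number of times on the two intervals). *)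

theory Defs
  imports
    "HOL-Complex_Analysis.Complex_Analysis"
    "HOL-Algebra.Bij"
    "HOL-Algebra.Elementary_Groups"
    "HOL-Algebra.Product_Groups"
begin

abbreviation unit_disc :: "complex set" where "unit_disc \<equiv> ball 0 1"
abbreviation unit_circle :: "complex set" where "unit_circle \<equiv> sphere 0 1"

definition blaschke_factor :: "complex \<Rightarrow> complex \<Rightarrow> complex" where
  "blaschke_factor a z = (of_real (norm a) / a) * ((a - z) / (1 - cnj a * z))"

text \<open>
  The index set \<open>J\<close> is finite or infinite, so that finite and infinite products (and the empty
  one) are covered. Only the values of \<open>B\<close> on the open disc are constrained.
\<close>
definition blaschke_product :: "(complex \<Rightarrow> complex) \<Rightarrow> bool" where
  "blaschke_product B \<longleftrightarrow>
     (\<exists>c (p::nat) (J::nat set) (a :: nat \<Rightarrow> complex).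
        norm c = 1 \<and>
        (\<forall>j\<in>J. a j \<in> unit_disc - {0}) \<and>
        (\<lambda>j. 1 - norm (a j)) summable_on J \<and>
        (\<forall>z\<in>unit_disc.
           B z = c * z ^ p * prodinf (\<lambda>j. if j \<in> J then blaschke_factor (a j) z else 1)))"

definition analytic_extension ::
    "(complex \<Rightarrow> complex) \<Rightarrow> complex \<Rightarrow> complex set \<Rightarrow> (complex \<Rightarrow> complex) \<Rightarrow> bool" where
  "analytic_extension B \<zeta> U g \<longleftrightarrow>
     open U \<and> \<zeta> \<in> U \<and> g holomorphic_on U \<and> (\<forall>z\<in>U \<inter> unit_disc. g z = B z)"

definition spectrum :: "(complex \<Rightarrow> complex) \<Rightarrow> complex set" where
  "spectrum B = {\<zeta> \<in> unit_circle. \<not> (\<exists>U g. analytic_extension B \<zeta> U g)}"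

text \<open>
  The value of \<open>B\<close> at a regular point of the circle is that of its analytic extension. It does not
  depend on the extension, since the point is a limit point of the disc.
\<close>
definition bdry :: "(complex \<Rightarrow> complex) \<Rightarrow> complex \<Rightarrow> complex" where
  "bdry B \<zeta> = (THE w. \<exists>U g. analytic_extension B \<zeta> U g \<and> g \<zeta> = w)"

lemma bdry_eq:
  assumes "\<zeta> \<in> unit_circle" "analytic_extension B \<zeta> U g"
  shows "bdry B \<zeta> = g \<zeta>"
proof -
  have lim: "(B \<longlongrightarrow> h \<zeta>) (at \<zeta> within unit_disc)" if "analytic_extension B \<zeta> V h" for V h
  proof -
    have V: "open V" "\<zeta> \<in> V" "h holomorphic_on V" "\<forall>z\<in>V \<inter> unit_disc. h z = B z"
      using that by (auto simp: analytic_extension_def)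
    have "isCont h \<zeta>"
      using holomorphic_on_imp_continuous_on[OF V(3)] V(1,2) by (simp add: continuous_on_eq_continuous_at)
    then have "(h \<longlongrightarrow> h \<zeta>) (at \<zeta> within unit_disc)"
      by (metis continuous_at_imp_continuous_within continuous_within)
    moreover have "eventually (\<lambda>z. h z = B z) (at \<zeta> within unit_disc)"
      unfolding eventually_at_topological using V by (intro exI[of _ V]) auto
    ultimately show ?thesis
      by (rule Lim_transform_eventually)
  qed
  have "\<zeta> islimpt unit_disc"
    using assms(1) islimpt_ball[of \<zeta> "0::complex" 1] by simp
  then have "at \<zeta> within unit_disc \<noteq> bot"
    by (simp add: trivial_limit_within)
  then have uniq: "w = g \<zeta>" if "analytic_extension B \<zeta> V h" "h \<zeta> = w" for V h w
    using tendsto_unique[OF _ lim[OF that(1)] lim[OF assms(2)]] that(2) by simp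
  show ?thesis
    unfolding bdry_def by (rule the_equality) (use assms(2) uniq in blast)+
qed

text \<open>Self-maps of the circle are represented by functions that are \<open>undefined\<close> off the circle.\<close>
definition invariant_group :: "(complex \<Rightarrow> complex) \<Rightarrow> (complex \<Rightarrow> complex) monoid" where
  "invariant_group B =
     \<lparr>carrier = {x \<in> unit_circle \<rightarrow>\<^sub>E unit_circle.
         continuous_on unit_circle x \<and>
         (\<forall>z\<in>spectrum B. x z \<in> spectrum B) \<and>
         (\<forall>z\<in>unit_circle - spectrum B. x z \<in> unit_circle - spectrum B) \<and>
         (\<forall>z\<in>unit_circle - spectrum B. bdry B (x z) = bdry B z)},
      monoid.mult = compose unit_circle,
      one = (\<lambda>z\<in>unit_circle. z)\<rparr>"

definition semidirect_product ::
    "('a, 'm) monoid_scheme \<Rightarrow> ('b, 'l) monoid_scheme \<Rightarrow> ('b \<Rightarrow> 'a \<Rightarrow> 'a) \<Rightarrow> ('a \<times> 'b) monoid" where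
  "semidirect_product N H \<phi> =
     \<lparr>carrier = carrier N \<times> carrier H,
      monoid.mult = (\<lambda>(n, h) (n', h'). (n \<otimes>\<^bsub>N\<^esub> \<phi> h n', h \<otimes>\<^bsub>H\<^esub> h')),
      one = (\<one>\<^bsub>N\<^esub>, \<one>\<^bsub>H\<^esub>)\<rparr>"

abbreviation integer_power_group :: "nat \<Rightarrow> (nat \<Rightarrow> int) monoid" where
  "integer_power_group k \<equiv> product_group {..<k} (\<lambda>_. integer_group)"

text \<open>The open arc traversed counterclockwise from \<open>cis \<alpha>\<close> to \<open>cis \<beta>\<close>, where
  \<open>\<alpha> < \<beta> \<le> \<alpha> + 2 * pi\<close>.\<close>
definition arc_between :: "real \<Rightarrow> real \<Rightarrow> complex set" where
  "arc_between \<alpha> \<beta> = cis ` {\<alpha><..<\<beta>}"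

text \<open>
  The \<open>j\<close>-th interval is the arc from \<open>cis (t j)\<close> to \<open>cis (t (Suc j))\<close>. Since \<open>t\<close> gains a full turn
  every \<open>n\<close> steps, interval \<open>j + n\<close> is interval \<open>j\<close> again, so indices are automatically taken
  modulo \<open>n\<close>.
\<close>
definition ccw_numbering :: "complex set \<Rightarrow> nat \<Rightarrow> (nat \<Rightarrow> real) \<Rightarrow> bool" where
  "ccw_numbering S n t \<longleftrightarrow>
     strict_mono t \<and> (\<forall>j. t (j + n) = t j + 2 * pi) \<and>
     bij_betw (\<lambda>j. arc_between (t j) (t (Suc j))) {..<n} (components (unit_circle - S))"

lemma cis_eq_imp_eq:
  assumes "cis s = cis s'" "\<bar>s - s'\<bar> < 2 * pi"
  shows "s = s'"
proof -
  have "cis (s - s') = 1"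
    using assms(1) by (simp add: cis_divide[symmetric])
  then have "cos (s - s') = 1"
    by (metis cis.sel(1) one_complex.sel(1))
  then obtain m :: int where m: "s - s' = m * 2 * pi"
    using cos_one_2pi_int by auto
  then have "\<bar>real_of_int m\<bar> * (2 * pi) < 1 * (2 * pi)"
    using assms(2) by (simp add: abs_mult)
  then have "\<bar>real_of_int m\<bar> < 1"
    by (subst (asm) mult_less_cancel_right) auto
  then have "m = 0"
    by linarith
  then show ?thesis
    using m by simp
qed

lemma unit_circle_cis_obtain:
  fixes a :: real
  assumes "z \<in> unit_circle"
  obtains s where "a \<le> s" "s < a + 2 * pi" "z = cis s"
proof -
  have z: "z = cis (Arg z)"
    using assms cis_Arg[of z] by (cases "z = 0") (auto simp: sgn_eq)
  define m where "m = \<lfloor>(Arg z - a) / (2 * pi)\<rfloor>"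
  define s where "s = Arg z - of_int m * (2 * pi)"
  have "of_int m \<le> (Arg z - a) / (2 * pi)" "(Arg z - a) / (2 * pi) < of_int m + 1"
    unfolding m_def by linarith+
  then have "a \<le> s" "s < a + 2 * pi"
    unfolding s_def by (simp_all add: field_simps)
  moreover have "cis s = cis (Arg z)"
    using cis_multiple_2pi[of "of_int m"] unfolding s_def
    by (simp add: cis_divide[symmetric] mult.commute mult.left_commute)
  ultimately show ?thesis
    using that z by metis
qed

lemma connected_arc_between: "connected (arc_between \<alpha> \<beta>)"
  unfolding arc_between_def
  by (intro connected_continuous_image continuous_intros) auto

lemma arc_between_compl:
  assumes "\<alpha> < \<beta>" "\<beta> \<le> \<alpha> + 2 * pi"
  shows "arc_between \<alpha> \<beta> = unit_circle - cis ` {\<beta>..\<alpha> + 2 * pi}"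
proof -
  have "z \<notin> cis ` {\<beta>..\<alpha> + 2 * pi}" if z: "z \<in> arc_between \<alpha> \<beta>" for z
  proof
    assume "z \<in> cis ` {\<beta>..\<alpha> + 2 * pi}"
    then obtain s s' where s: "z = cis s" "\<alpha> < s" "s < \<beta>" "z = cis s'" "\<beta> \<le> s'" "s' \<le> \<alpha> + 2 * pi"
      using z by (auto simp: arc_between_def)
    then have "s = s'"
      using assms by (intro cis_eq_imp_eq) auto
    then show False
      using s by simp
  qed
  moreover have "z \<in> arc_between \<alpha> \<beta>" if z: "z \<in> unit_circle" "z \<notin> cis ` {\<beta>..\<alpha> + 2 * pi}" for z
  proof -
    obtain s where s: "\<alpha> \<le> s" "s < \<alpha> + 2 * pi" "z = cis s"
      using unit_circle_cis_obtain z(1) by blast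
    have "cis (\<alpha> + 2 * pi) = cis \<alpha>"
      by (simp add: cis_mult[symmetric])
    then have "s \<noteq> \<alpha>"
      using z(2) s(3) assms(2) by (metis atLeastAtMost_iff imageI order_refl)
    moreover have "s < \<beta>"
      using z(2) s by (metis atLeastAtMost_iff imageI less_eq_real_def not_le)
    ultimately show ?thesis
      using s by (auto simp: arc_between_def)
  qed
  ultimately show ?thesis
    by (auto simp: arc_between_def)
qed

lemma components_of_open_partition:
  assumes "\<And>i. i \<in> I \<Longrightarrow> connected (A i)" "\<And>i. i \<in> I \<Longrightarrow> A i \<noteq> {}"
    and opn: "\<And>i. i \<in> I \<Longrightarrow> openin (top_of_set X) (A i)"
    and disj: "disjoint_family_on A I" and X: "(\<Union>i\<in>I. A i) = X"
  shows "bij_betw A I (components X)"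
proof -
  have comp: "A i = connected_component_set X x" if i: "i \<in> I" and x: "x \<in> A i" for i x
  proof -
    let ?C = "connected_component_set X x"
    have sub: "A i \<subseteq> ?C"
      using assms(1)[OF i] x X i by (intro connected_component_maximal) auto
    have eq: "?C - A i = ?C \<inter> (\<Union>j\<in>I - {i}. A j)"
    proof -
      have "A i \<inter> (\<Union>j\<in>I - {i}. A j) = {}"
        using disj i unfolding disjoint_family_on_def by blast
      moreover have "?C \<subseteq> A i \<union> (\<Union>j\<in>I - {i}. A j)"
        using X connected_component_subset[of X x] by blast
      ultimately show ?thesis
        by blast
    qed
    have "openin (top_of_set X) (\<Union>j\<in>I - {i}. A j)"
      using opn by blast
    then obtain V where V: "open V" "(\<Union>j\<in>I - {i}. A j) = X \<inter> V"
      by (auto simp: openin_open)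
    have "?C - A i = ?C \<inter> V"
      unfolding eq V(2) using connected_component_subset[of X x] by auto
    then have "openin (top_of_set ?C) (?C - A i)"
      using V(1) by (simp add: openin_open_Int)
    then have "closedin (top_of_set ?C) (A i)"
      using sub by (simp add: closedin_def)
    moreover have "openin (top_of_set ?C) (A i)"
      by (rule openin_subset_trans[OF opn[OF i] sub connected_component_subset])
    ultimately show ?thesis
      using connected_connected_component[of X x] x unfolding connected_clopen by (metis empty_iff)
  qed
  have "inj_on A I"
    using disj assms(2) unfolding inj_on_def disjoint_family_on_def by (metis Int_absorb)
  moreover have "A ` I = components X"
  proof
    show "A ` I \<subseteq> components X"
    proof
      fix C assume "C \<in> A ` I"
      then obtain i x where i: "i \<in> I" "C = A i" "x \<in> A i"
        using assms(2) by blast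
      then have "x \<in> X"
        using X by blast
      then show "C \<in> components X"
        using comp[OF i(1,3)] i(2) by (simp add: componentsI)
    qed
    show "components X \<subseteq> A ` I"
    proof
      fix C assume "C \<in> components X"
      then obtain x where x: "x \<in> X" "C = connected_component_set X x"
        by (auto simp: components_def)
      then obtain i where i: "i \<in> I" "x \<in> A i"
        using X by blast
      then show "C \<in> A ` I"
        using comp[OF i] x(2) i(1) by (metis image_eqI)
    qed
  qed
  ultimately show ?thesis
    by (simp add: bij_betw_def)
qed

lemma ccw_numbering_partition:
  fixes t :: "nat \<Rightarrow> real"
  assumes t: "strict_mono t" "\<And>j. t (j + n) = t j + 2 * pi"
  defines "A \<equiv> \<lambda>j. arc_between (t j) (t (Suc j))"
  shows "bij_betw A {..<n} (components (unit_circle - cis ` t ` {..<n}))"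
    and "(\<Union>j<n. A j) = unit_circle - cis ` t ` {..<n}"
proof -
  have n: "n > 0"
    using t(2)[of 0] by (cases n) auto
  have mono: "t i < t j \<longleftrightarrow> i < j" "t i \<le> t j \<longleftrightarrow> i \<le> j" for i j
    using t(1) by (simp_all add: strict_mono_less strict_mono_less_eq)
  have tn: "t n = t 0 + 2 * pi"
    using t(2)[of 0] by simp
  have rng: "t 0 \<le> s \<and> s < t 0 + 2 * pi" if "j < n" "t j \<le> s" "s < t (Suc j)" for j s
    using that mono(2)[of 0 j] mono(2)[of "Suc j" n] tn by auto
  have disj: "j = j' \<and> s = s'"
    if "j < n" "t j \<le> s" "s < t (Suc j)" "j' < n" "t j' \<le> s'" "s' < t (Suc j')" "cis s = cis s'"
    for j j' s s'
  proof -
    have s: "s = s'"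
      using rng[OF that(1-3)] rng[OF that(4-6)] that(7) by (intro cis_eq_imp_eq) auto
    have "t j < t (Suc j')" "t j' < t (Suc j)"
      using that s by linarith+
    then show ?thesis
      using s by (simp add: mono)
  qed
  show un: "(\<Union>j<n. A j) = unit_circle - cis ` t ` {..<n}"
  proof (intro equalityI subsetI)
    fix z assume "z \<in> (\<Union>j<n. A j)"
    then obtain j s where js: "j < n" "t j < s" "s < t (Suc j)" "z = cis s"
      by (auto simp: A_def arc_between_def)
    have "z \<noteq> cis (t i)" if "i < n" for i
      using disj[of j s i "t i"] js that mono(1)[of i "Suc i"] by auto
    then show "z \<in> unit_circle - cis ` t ` {..<n}"
      using js by auto
  next
    fix z assume z: "z \<in> unit_circle - cis ` t ` {..<n}"
    obtain s where s: "t 0 \<le> s" "s < t 0 + 2 * pi" "z = cis s"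
      using unit_circle_cis_obtain z by (metis DiffD1)
    define j where "j = (LEAST i. s < t (Suc i))"
    have ex: "s < t (Suc (n - 1))"
      using s tn n by simp
    have j: "s < t (Suc j)" "j \<le> n - 1"
      using LeastI[of "\<lambda>i. s < t (Suc i)", OF ex] Least_le[of "\<lambda>i. s < t (Suc i)", OF ex]
      by (simp_all add: j_def)
    have "t j \<le> s"
    proof (cases j)
      case (Suc i)
      then show ?thesis
        using not_less_Least[of i "\<lambda>i. s < t (Suc i)"] unfolding j_def by auto
    qed (use s in simp)
    moreover have "t j \<noteq> s"
      using z s j n by auto
    ultimately show "z \<in> (\<Union>j<n. A j)"
      using j s n by (auto simp: A_def arc_between_def intro!: bexI[of _ j])
  qed
  show "bij_betw A {..<n} (components (unit_circle - cis ` t ` {..<n}))"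
  proof (rule components_of_open_partition[OF _ _ _ _ un])
    fix j assume j: "j \<in> {..<n}"
    show "connected (A j)"
      by (simp add: A_def connected_arc_between)
    have lt: "t j < t (Suc j)"
      by (simp add: mono)
    then show "A j \<noteq> {}"
      by (simp add: A_def arc_between_def)
    have "t (Suc j) \<le> t j + 2 * pi"
      using t(2)[of j] mono(2)[of "Suc j" "j + n"] n by simp
    then have "A j = unit_circle - cis ` {t (Suc j)..t j + 2 * pi}"
      using lt by (simp add: A_def arc_between_compl)
    moreover have "A j \<subseteq> unit_circle - cis ` t ` {..<n}"
      using un j by blast
    ultimately have "A j = (unit_circle - cis ` t ` {..<n}) \<inter> - cis ` {t (Suc j)..t j + 2 * pi}"
      by blast
    moreover have "closed (cis ` {t (Suc j)..t j + 2 * pi})"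
      by (intro compact_imp_closed compact_continuous_image continuous_intros) auto
    ultimately show "openin (top_of_set (unit_circle - cis ` t ` {..<n})) (A j)"
      by (metis openin_open_Int open_Compl)
  next
    show "disjoint_family_on A {..<n}"
    proof (unfold disjoint_family_on_def, intro ballI impI)
      fix i j assume ij: "i \<in> {..<n}" "j \<in> {..<n}" "i \<noteq> j"
      show "A i \<inter> A j = {}"
      proof (rule equals0I)
        fix z assume "z \<in> A i \<inter> A j"
        then obtain s s' where "t i < s" "s < t (Suc i)" "t j < s'" "s' < t (Suc j)" "cis s = cis s'"
          unfolding A_def arc_between_def by auto
        then show False
          using disj[of i s j s'] ij by simp
      qed
    qed
  qed
qed

lemma ccw_numbering_iff:
  assumes "S \<subseteq> unit_circle"
  shows "ccw_numbering S n t \<longleftrightarrow>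
           strict_mono t \<and> (\<forall>j. t (j + n) = t j + 2 * pi) \<and> S = cis ` t ` {..<n}"
proof -
  have "S = cis ` t ` {..<n}" if c: "ccw_numbering S n t"
  proof -
    have "(\<Union>j<n. arc_between (t j) (t (Suc j))) = \<Union> (components (unit_circle - S))"
      using c unfolding ccw_numbering_def bij_betw_def by metis
    then have "unit_circle - S = unit_circle - cis ` t ` {..<n}"
      using c ccw_numbering_partition(2)[of t n] by (simp add: ccw_numbering_def)
    moreover have "cis ` t ` {..<n} \<subseteq> unit_circle"
      by auto
    ultimately show ?thesis
      using assms by blast
  qed
  then show ?thesis
    using ccw_numbering_partition(1)[of t n] unfolding ccw_numbering_def by blast
qed

lemma ccw_numbering_exists:
  assumes "S \<subseteq> unit_circle" "finite S" "S \<noteq> {}"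
  shows "\<exists>t. ccw_numbering S (card S) t"
proof -
  define R where "R = {s. 0 \<le> s \<and> s < 2 * pi \<and> cis s \<in> S}"
  have inj: "inj_on cis R"
    by (intro inj_onI cis_eq_imp_eq) (auto simp: R_def)
  have img: "cis ` R = S"
  proof -
    have "z \<in> cis ` R" if z: "z \<in> S" for z
    proof -
      obtain s where "0 \<le> s" "s < 0 + 2 * pi" "z = cis s"
        using unit_circle_cis_obtain[of z 0] z assms(1) by blast
      then show ?thesis
        using z by (auto simp: R_def)
    qed
    then show ?thesis
      by (auto simp: R_def)
  qed
  have fin: "finite R" and crd: "card R = card S"
    using inj img assms(2) finite_imageD card_image by metis+
  define n where "n = card S"
  have n: "n > 0"
    using assms by (simp add: n_def card_gt_0_iff)
  define xs where "xs = sorted_list_of_set R"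
  have xs: "length xs = n" "set xs = R" "sorted_wrt (<) xs"
    using fin crd by (auto simp: xs_def n_def)
  define t where "t j = xs ! (j mod n) + real (j div n) * (2 * pi)" for j
  have tR: "t j = xs ! j" "xs ! j \<in> R" if "j < n" for j
    using that xs by (auto simp: t_def)
  have per: "t (j + n) = t j + 2 * pi" for j
    using n by (simp add: t_def algebra_simps)
  have "t j < t (Suc j)" for j
  proof (cases "Suc (j mod n) = n")
    case True
    then have "Suc j mod n = 0" "Suc j div n = Suc (j div n)"
      by (auto simp: mod_Suc div_Suc)
    moreover have "xs ! (j mod n) < 2 * pi" "0 \<le> xs ! 0"
      using tR(2)[of "j mod n"] tR(2)[of 0] n by (auto simp: R_def)
    ultimately show ?thesis
      by (simp add: t_def algebra_simps)
  next
    case False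
    then have "Suc j mod n = Suc (j mod n)" "Suc j div n = j div n"
      by (auto simp: mod_Suc div_Suc)
    moreover have "Suc (j mod n) < n"
      using False n by (metis Suc_lessI mod_less_divisor)
    ultimately show ?thesis
      using xs by (simp add: t_def sorted_wrt_nth_less)
  qed
  then have "strict_mono t"
    by (simp add: strict_mono_Suc_iff)
  moreover have "t ` {..<n} = R"
  proof -
    have "t ` {..<n} = (\<lambda>j. xs ! j) ` {..<n}"
      using tR by (intro image_cong) auto
    also have "\<dots> = set xs"
      using xs by (auto simp: set_conv_nth)
    finally show ?thesis
      using xs by simp
  qed
  ultimately have "ccw_numbering S n t"
    using ccw_numbering_iff[OF assms(1), of n t] per img by simp
  then show ?thesis
    unfolding n_def by blast
qed

text \<open>
  Here \<open>(\<alpha>, \<beta>)\<close> are the angles of the initial and the terminal endpoint. Solutions are recorded by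
  their angle, so that accumulation at the two ends is told apart even if both endpoints are the
  same point of the circle.
\<close>
definition one_angles :: "(complex \<Rightarrow> complex) \<Rightarrow> real \<Rightarrow> real \<Rightarrow> real set" where
  "one_angles B \<alpha> \<beta> = {\<theta> \<in> {\<alpha><..<\<beta>}. bdry B (cis \<theta>) = 1}"

definition type0 :: "(complex \<Rightarrow> complex) \<Rightarrow> real \<Rightarrow> real \<Rightarrow> bool" where
  "type0 B \<alpha> \<beta> \<longleftrightarrow> finite (one_angles B \<alpha> \<beta>)"

definition type1a :: "(complex \<Rightarrow> complex) \<Rightarrow> real \<Rightarrow> real \<Rightarrow> bool" where
  "type1a B \<alpha> \<beta> \<longleftrightarrow>
     infinite (one_angles B \<alpha> \<beta>) \<and> {\<theta>. \<theta> islimpt one_angles B \<alpha> \<beta>} = {\<alpha>}"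

definition type1b :: "(complex \<Rightarrow> complex) \<Rightarrow> real \<Rightarrow> real \<Rightarrow> bool" where
  "type1b B \<alpha> \<beta> \<longleftrightarrow>
     infinite (one_angles B \<alpha> \<beta>) \<and> {\<theta>. \<theta> islimpt one_angles B \<alpha> \<beta>} = {\<beta>}"

definition type2 :: "(complex \<Rightarrow> complex) \<Rightarrow> real \<Rightarrow> real \<Rightarrow> bool" where
  "type2 B \<alpha> \<beta> \<longleftrightarrow> {\<theta>. \<theta> islimpt one_angles B \<alpha> \<beta>} = {\<alpha>, \<beta>}"

text \<open>
  On an interval of type 0 every value is attained only finitely often, because between two
  consecutive preimages of a value there is a preimage of 1; hence comparing cardinalities is
  meaningful.
\<close>
definition same_type :: "(complex \<Rightarrow> complex) \<Rightarrow> real \<times> real \<Rightarrow> real \<times> real \<Rightarrow> bool" where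
  "same_type B = (\<lambda>(\<alpha>, \<beta>) (\<alpha>', \<beta>').
     (type2 B \<alpha> \<beta> \<and> type2 B \<alpha>' \<beta>') \<or>
     (type1a B \<alpha> \<beta> \<and> type1a B \<alpha>' \<beta>' \<and>
        (\<exists>L. ((\<lambda>\<theta>. bdry B (cis \<theta>)) \<longlongrightarrow> L) (at_left \<beta>) \<and>
             ((\<lambda>\<theta>. bdry B (cis \<theta>)) \<longlongrightarrow> L) (at_left \<beta>'))) \<or>
     (type1b B \<alpha> \<beta> \<and> type1b B \<alpha>' \<beta>' \<and>
        (\<exists>L. ((\<lambda>\<theta>. bdry B (cis \<theta>)) \<longlongrightarrow> L) (at_right \<alpha>) \<and>
             ((\<lambda>\<theta>. bdry B (cis \<theta>)) \<longlongrightarrow> L) (at_right \<alpha>'))) \<or>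
     (type0 B \<alpha> \<beta> \<and> type0 B \<alpha>' \<beta>' \<and>
        (\<forall>w\<in>unit_circle. card {\<xi> \<in> arc_between \<alpha> \<beta>. bdry B \<xi> = w} =
                          card {\<xi> \<in> arc_between \<alpha>' \<beta>'. bdry B \<xi> = w})))"

end

theory Submission
  imports Defs
begin

text \<open>
  Write the singular angles as \<open>T j\<close>, \<open>j \<in> \<int>\<close>, increasing and with \<open>T (j + n) = T j + 2\<pi>\<close>. On each arc between
  consecutive singularities the boundary values of \<open>B\<close> have modulus 1 and turn counterclockwise with
  positive speed (\<open>bdry_angular_derivative\<close>), so \<open>B (cis \<theta>) = cis (\<Phi> \<theta>)\<close> with a continuous, strictly increasing
  phase \<open>\<Phi>\<close> that maps the \<open>j\<close>-th arc homeomorphically onto an open interval \<open>phases j\<close> of the real line.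
  Everything is decided by these intervals.

  An invariant \<open>x\<close> lifts to a continuous \<open>X :: real \<Rightarrow> real\<close> that preserves singular angles and satisfies
  \<open>\<Phi> (X \<theta>) = \<Phi> \<theta> + 2\<pi> m j\<close> on the \<open>j\<close>-th arc with an integer \<open>m j\<close>, since a continuous function with values in
  \<open>2\<pi>\<int>\<close> is constant on an arc. Hence \<open>X\<close> increases, carries each arc onto an arc, and being continuous at
  the singularities it carries adjacent arcs to adjacent arcs: arc \<open>j\<close> goes to arc \<open>j + r\<close> for a fixed \<open>r\<close>,
  and \<open>phases (j + r) = phases j + 2\<pi> m j\<close>. Conversely every such pair \<open>(r, m)\<close> comes from an invariant, because an
  increasing surjection of the line is continuous (\<open>represents_exists\<close>, \<open>represents_carrier\<close>,
  \<open>carrier_represents\<close>). Composition becomes \<open>(r, m) (r', m') = (r + r', m' + m (\<cdot> + r'))\<close>.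

  Two arcs are of the same type exactly when their intervals \<open>phases\<close> differ by a translation in \<open>2\<pi>\<int>\<close>, and an
  arc is of type 2 exactly when \<open>phases\<close> is the whole line (\<open>same_type_iff\<close>, \<open>type2_iff_UNIV\<close>). So the admissible
  \<open>r\<close> form a subgroup \<open>g\<int>\<close> of \<open>\<int>\<close> containing \<open>n\<close>, with \<open>n = g d\<close>. For an admissible \<open>r\<close> the integer \<open>m j\<close> is
  arbitrary on the arcs of type 2, which gives \<open>\<int>\<^sup>k\<close>, and is determined on all others. Choosing \<open>m j = 0\<close> on the arcs of
  type 2 splits the projection to \<open>\<int>\<^sub>d\<close>, and \<open>\<int>\<^sub>d\<close> acts on \<open>\<int>\<^sup>k\<close> by rotating the arcs (\<open>invariant_group_iso\<close>).
\<close>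

section \<open>Boundary values of a Blaschke product\<close>

text \<open>
  This identity controls everything about the boundary: its right-hand side is small when \<open>z\<close> is near the
  circle but far from \<open>a\<close>, and for fixed \<open>a\<close> it is at least a constant multiple of \<open>1 - norm z\<close>.
\<close>
lemma one_minus_blaschke_factor_sq:
  assumes "norm a < 1" "a \<noteq> 0" "norm z < 1"
  shows "1 - (norm (blaschke_factor a z))\<^sup>2 =
           (1 - (norm a)\<^sup>2) * (1 - (norm z)\<^sup>2) / (norm (1 - cnj a * z))\<^sup>2"
proof -
  have "norm (cnj a * z) < 1"
    using mult_strict_mono[of "norm a" 1 "norm z" 1] assms by (simp add: norm_mult)
  then have nz: "1 - cnj a * z \<noteq> 0"
    by (metis eq_iff_diff_eq_0 less_irrefl norm_one)
  have "(norm (1 - cnj a * z))\<^sup>2 - (norm (a - z))\<^sup>2 = (1 - (norm a)\<^sup>2) * (1 - (norm z)\<^sup>2)"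
    unfolding cmod_power2 by (simp add: power2_eq_square algebra_simps)
  moreover have "norm (blaschke_factor a z) = norm (a - z) / norm (1 - cnj a * z)"
    using assms(2) by (simp add: blaschke_factor_def norm_mult norm_divide)
  ultimately show ?thesis
    using nz by (metis diff_divide_distrib divide_self norm_eq_zero power_divide zero_eq_power2)
qed

text \<open>
  The Weierstrass product inequality. It bounds the infinite product below by the sum of the defects
  of its factors, without any passage to logarithms.
\<close>
lemma prod_ge_one_minus_sum:
  fixes x :: "'a \<Rightarrow> real"
  assumes "finite A" "\<And>i. i \<in> A \<Longrightarrow> 0 \<le> x i \<and> x i \<le> 1"
  shows "1 - (\<Sum>i\<in>A. 1 - x i) \<le> (\<Prod>i\<in>A. x i)"
  using assms
proof (induction A rule: finite_induct)
  case (insert j A)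
  have P: "0 \<le> (\<Prod>i\<in>A. x i)" "(\<Prod>i\<in>A. x i) \<le> 1"
    using insert.prems by (auto intro!: prod_nonneg prod_le_1)
  have "(1 - x j) * (1 - (\<Prod>i\<in>A. x i)) \<ge> 0"
    using insert.prems P by (intro mult_nonneg_nonneg) auto
  then have "x j + (\<Prod>i\<in>A. x i) - 1 \<le> x j * (\<Prod>i\<in>A. x i)"
    by (simp add: algebra_simps)
  then show ?case
    using insert by simp
qed simp

locale blaschke =
  fixes B :: "complex \<Rightarrow> complex" and c :: complex and p :: nat and J :: "nat set"
    and a :: "nat \<Rightarrow> complex"
  assumes c: "norm c = 1"
    and zeros_in_disc: "\<And>j. j \<in> J \<Longrightarrow> norm (a j) < 1 \<and> a j \<noteq> 0"
    and zeros_summable: "(\<lambda>j. 1 - norm (a j)) summable_on J"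
    and B_eq: "\<And>z. norm z < 1 \<Longrightarrow>
      B z = c * z ^ p * prodinf (\<lambda>j. if j \<in> J then blaschke_factor (a j) z else 1)"
begin

definition factor :: "nat \<Rightarrow> complex \<Rightarrow> complex" where
  "factor j z = (if j \<in> J then blaschke_factor (a j) z else 1)"

definition defect :: "nat \<Rightarrow> real" where
  "defect j = (if j \<in> J then 1 - norm (a j) else 0)"

lemma defect_nonneg: "defect j \<ge> 0"
  using zeros_in_disc[of j] by (auto simp: defect_def)

lemma summable_defect: "summable defect"
proof -
  have "defect summable_on UNIV"
    using zeros_summable
    by (rule summable_on_cong_neutral[THEN iffD1, rotated -1]) (auto simp: defect_def)
  then show ?thesis
    using summable_on_UNIV_nonneg_real_iff[of defect] defect_nonneg by simp
qed

lemma norm_factor_le_1: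
  assumes "norm z < 1"
  shows "norm (factor j z) \<le> 1"
proof (cases "j \<in> J")
  case True
  have "(norm (a j))\<^sup>2 \<le> 1" "(norm z)\<^sup>2 \<le> 1"
    using zeros_in_disc[OF True] assms by (auto simp: power_le_one)
  then have "0 \<le> 1 - (norm (blaschke_factor (a j) z))\<^sup>2"
    using one_minus_blaschke_factor_sq[of "a j" z] zeros_in_disc[OF True] assms by simp
  then show ?thesis
    using True by (metis abs_norm_cancel abs_square_le_1 diff_ge_0_iff_ge factor_def)
qed (simp add: factor_def)

text \<open>
  The factor is normalised so that it tends to 1 as its zero tends to the circle. This makes the product
  converge absolutely.
\<close>
lemma norm_factor_minus_1_le:
  assumes "norm z < 1"
  shows "norm (factor j z - 1) \<le> 2 / (1 - norm z) * defect j"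
proof (cases "j \<in> J")
  case True
  let ?a = "a j"
  have a: "norm ?a < 1" "?a \<noteq> 0"
    using zeros_in_disc[OF True] by auto
  have le: "norm (cnj ?a * z) \<le> norm z"
    using a assms by (simp add: norm_mult mult_left_le_one_le)
  then have d: "norm (1 - cnj ?a * z) \<ge> 1 - norm z"
    using norm_triangle_ineq2[of 1 "cnj ?a * z"] by simp
  then have nz: "1 - cnj ?a * z \<noteq> 0"
    using assms by auto
  define s :: complex where "s = of_real (norm ?a)"
  have aa: "?a * cnj ?a = s * s"
    unfolding s_def by (metis complex_norm_square of_real_power power2_eq_square)
  have "s * (?a - z) - ?a * (1 - cnj ?a * z) = s * ?a - s * z - ?a + (?a * cnj ?a) * z"
    by (simp add: algebra_simps)
  also have "\<dots> = (s - 1) * (?a + s * z)"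
    unfolding aa by (simp add: algebra_simps)
  finally have num: "s * (?a - z) - ?a * (1 - cnj ?a * z) = (s - 1) * (?a + s * z)" .
  have "factor j z = s * (?a - z) / (?a * (1 - cnj ?a * z))"
    using True by (simp add: factor_def blaschke_factor_def s_def)
  then have "factor j z - 1 = (s * (?a - z) - ?a * (1 - cnj ?a * z)) / (?a * (1 - cnj ?a * z))"
    using nz a by (simp add: diff_divide_distrib)
  then have eq: "factor j z - 1 =
      (of_real (norm ?a) - 1) * (?a + of_real (norm ?a) * z) / (?a * (1 - cnj ?a * z))"
    by (simp only: num[unfolded s_def] s_def)
  have 1: "norm (of_real (norm ?a) - 1 :: complex) = defect j"
    using True a unfolding defect_def
    by (metis abs_of_neg diff_less_0_iff_less minus_diff_eq norm_of_real of_real_1 of_real_diff)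
  have 2: "norm (?a + of_real (norm ?a) * z) \<le> norm ?a * 2"
  proof -
    have "norm (?a + of_real (norm ?a) * z) \<le> norm ?a + norm ?a * norm z"
      using norm_triangle_ineq[of ?a "of_real (norm ?a) * z"] by (simp add: norm_mult)
    also have "\<dots> \<le> norm ?a * 2"
      using assms by (simp add: mult_left_le)
    finally show ?thesis .
  qed
  have "norm (factor j z - 1) =
      defect j * norm (?a + of_real (norm ?a) * z) / (norm ?a * norm (1 - cnj ?a * z))"
    unfolding eq by (simp only: norm_mult norm_divide 1)
  also have "\<dots> \<le> defect j * (norm ?a * 2) / (norm ?a * (1 - norm z))"
    using 2 d a assms defect_nonneg by (intro frac_le mult_left_mono mult_nonneg_nonneg) auto
  also have "\<dots> = (norm ?a * (2 * defect j)) / (norm ?a * (1 - norm z))"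
    by (simp add: mult.commute mult.left_commute)
  also have "\<dots> = 2 * defect j / (1 - norm z)"
    using a by (intro mult_divide_mult_cancel_left) auto
  finally show ?thesis by simp
qed (simp add: factor_def defect_def)

lemma convergent_prod_factor:
  assumes "norm z < 1"
  shows "convergent_prod (\<lambda>j. factor j z)"
proof -
  have "summable (\<lambda>j. 2 / (1 - norm z) * defect j)"
    by (intro summable_mult summable_defect)
  then have "summable (\<lambda>j. norm (factor j z - 1))"
    by (rule summable_comparison_test[rotated]) (use norm_factor_minus_1_le[OF assms] in auto)
  then show ?thesis
    by (intro abs_convergent_prod_imp_convergent_prod summable_imp_abs_convergent_prod)
qed

lemma tendsto_norm_B:
  assumes "norm z < 1"
  shows "(\<lambda>N. norm z ^ p * (\<Prod>j\<le>N. norm (factor j z))) \<longlonglongrightarrow> norm (B z)"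
proof -
  have "(\<lambda>N. norm (c * z ^ p * (\<Prod>j\<le>N. factor j z))) \<longlonglongrightarrow>
        norm (c * z ^ p * prodinf (\<lambda>j. factor j z))"
    by (intro tendsto_intros convergent_prod_LIMSEQ convergent_prod_factor assms)
  then show ?thesis
    using B_eq[OF assms] c by (simp add: factor_def norm_mult norm_power prod_norm)
qed

lemma norm_B_le_power:
  assumes "norm z < 1"
  shows "norm (B z) \<le> norm z ^ p"
  by (rule LIMSEQ_le_const2[OF tendsto_norm_B[OF assms]])
    (auto intro!: exI mult_left_le prod_le_1 simp: norm_factor_le_1[OF assms])

lemma norm_B_le_1: "norm z < 1 \<Longrightarrow> norm (B z) \<le> 1"
  using norm_B_le_power[of z] power_le_one[of "norm z" p] by simp

lemma norm_B_le_factor: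
  assumes "norm z < 1"
  shows "norm (B z) \<le> norm (factor i z)"
proof (rule LIMSEQ_le_const2[OF tendsto_norm_B[OF assms]], intro exI allI impI)
  fix N assume "i \<le> N"
  have "(\<Prod>j\<le>N. norm (factor j z)) = norm (factor i z) * (\<Prod>j\<in>{..N} - {i}. norm (factor j z))"
    using \<open>i \<le> N\<close> by (intro prod.remove) auto
  also have "\<dots> \<le> norm (factor i z)"
    by (intro mult_left_le prod_le_1) (auto simp: norm_factor_le_1[OF assms])
  finally have "(\<Prod>j\<le>N. norm (factor j z)) \<le> norm (factor i z)" .
  moreover have "norm z ^ p * (\<Prod>j\<le>N. norm (factor j z)) \<le> (\<Prod>j\<le>N. norm (factor j z))"
    using assms by (intro mult_left_le_one_le prod_nonneg) (auto simp: power_le_one)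
  ultimately show "norm z ^ p * (\<Prod>j\<le>N. norm (factor j z)) \<le> norm (factor i z)"
    by linarith
qed

text \<open>
  Far from the zeros every factor misses modulus 1 by at most a constant times \<open>1 - norm z\<close> times its own
  defect. The defects are summable, so the product inequality makes \<open>norm (B z)\<close> tend to 1 at the boundary.
\<close>
lemma norm_B_ge:
  assumes z: "norm z < 1" and "\<delta> > 0" and far: "\<And>j. j \<in> J \<Longrightarrow> norm (1 - cnj (a j) * z) \<ge> \<delta>"
  shows "norm z ^ p * (1 - 4 / \<delta>\<^sup>2 * suminf defect * (1 - norm z)) \<le> norm (B z)"
proof (rule LIMSEQ_le_const[OF tendsto_norm_B[OF z]], intro exI allI impI)
  fix N :: nat
  have one: "1 - norm (factor j z) \<le> 4 / \<delta>\<^sup>2 * (1 - norm z) * defect j" for j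
  proof (cases "j \<in> J")
    case True
    let ?a = "a j" and ?b = "norm (factor j z)"
    have a: "norm ?a < 1" "?a \<noteq> 0"
      using zeros_in_disc[OF True] by auto
    have sq: "1 - x\<^sup>2 \<le> 2 * (1 - x)" "1 - x\<^sup>2 \<ge> 0" "1 - x \<le> 1 - x\<^sup>2" if "0 \<le> x" "x \<le> 1" for x :: real
    proof -
      have "(1 - x)\<^sup>2 \<ge> 0" "x * (1 - x) \<ge> 0" "(1 - x) * (1 + x) \<ge> 0"
        using that by auto
      then show "1 - x\<^sup>2 \<le> 2 * (1 - x)" "1 - x\<^sup>2 \<ge> 0" "1 - x \<le> 1 - x\<^sup>2"
        by (simp_all add: power2_eq_square algebra_simps)
    qed
    have "1 - ?b \<le> 1 - ?b\<^sup>2"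
      using sq(3)[of ?b] norm_factor_le_1[OF z] by simp
    also have "\<dots> = (1 - (norm ?a)\<^sup>2) * (1 - (norm z)\<^sup>2) / (norm (1 - cnj ?a * z))\<^sup>2"
      using one_minus_blaschke_factor_sq[of ?a z] a z True by (simp add: factor_def)
    also have "\<dots> \<le> (2 * (1 - norm ?a)) * (2 * (1 - norm z)) / \<delta>\<^sup>2"
      using far[OF True] \<open>\<delta> > 0\<close> sq[of "norm ?a"] sq[of "norm z"] a z
      by (intro frac_le mult_mono power_mono) auto
    also have "\<dots> = 4 / \<delta>\<^sup>2 * (1 - norm z) * defect j"
      using True by (simp add: defect_def algebra_simps)
    finally show ?thesis .
  qed (simp add: factor_def defect_def)
  have "(\<Sum>j\<le>N. 1 - norm (factor j z)) \<le> (\<Sum>j\<le>N. 4 / \<delta>\<^sup>2 * (1 - norm z) * defect j)"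
    by (intro sum_mono one)
  also have "\<dots> = 4 / \<delta>\<^sup>2 * (1 - norm z) * (\<Sum>j\<le>N. defect j)"
    by (simp add: sum_distrib_left)
  also have "\<dots> \<le> 4 / \<delta>\<^sup>2 * (1 - norm z) * suminf defect"
    using z defect_nonneg by (intro mult_left_mono sum_le_suminf summable_defect) auto
  finally have "1 - 4 / \<delta>\<^sup>2 * suminf defect * (1 - norm z) \<le> 1 - (\<Sum>j\<le>N. 1 - norm (factor j z))"
    by (simp add: algebra_simps)
  also have "\<dots> \<le> (\<Prod>j\<le>N. norm (factor j z))"
    using norm_factor_le_1[OF z] by (intro prod_ge_one_minus_sum) auto
  finally show "norm z ^ p * (1 - 4 / \<delta>\<^sup>2 * suminf defect * (1 - norm z))
      \<le> norm z ^ p * (\<Prod>j\<le>N. norm (factor j z))"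
    by (intro mult_left_mono) auto
qed

text \<open>
  A convergent product without vanishing factors is not zero.
\<close>
lemma B_zero_imp:
  assumes "norm z < 1" "B z = 0"
  shows "z \<in> insert 0 (a ` J)"
proof (rule ccontr)
  assume z: "z \<notin> insert 0 (a ` J)"
  have "factor j z \<noteq> 0" for j
  proof (cases "j \<in> J")
    case True
    have "norm (cnj (a j) * z) < 1"
      using mult_strict_mono[of "norm (a j)" 1 "norm z" 1] assms zeros_in_disc[OF True]
      by (simp add: norm_mult)
    then have "1 - cnj (a j) * z \<noteq> 0"
      by (metis eq_iff_diff_eq_0 less_irrefl norm_one)
    then show ?thesis
      using z True zeros_in_disc[OF True] by (auto simp: factor_def blaschke_factor_def)
  qed (simp add: factor_def)
  then have "prodinf (\<lambda>j. factor j z) \<noteq> 0"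
    by (intro prodinf_nonzero convergent_prod_factor assms)
  then show False
    using assms B_eq[of z] c z by (auto simp: factor_def)
qed

lemma B_zero: "j \<in> J \<Longrightarrow> B (a j) = 0"
  using norm_B_le_factor[of "a j" j] zeros_in_disc[of j] by (auto simp: factor_def blaschke_factor_def)

text \<open>
  Where the extension does not vanish, the zeros of \<open>B\<close> stay away from \<open>\<zeta>\<close>, so \<open>norm_B_ge\<close> applies along the
  radius to \<open>\<zeta>\<close>.
\<close>
lemma norm_extension_eq_1_if_nonzero:
  assumes ext: "analytic_extension B \<zeta> U g" and \<zeta>: "norm \<zeta> = 1" and nz: "g \<zeta> \<noteq> 0"
  shows "norm (g \<zeta>) = 1"
proof -
  have U: "open U" "\<zeta> \<in> U" "g holomorphic_on U" "\<And>z. z \<in> U \<Longrightarrow> norm z < 1 \<Longrightarrow> g z = B z"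
    using ext by (auto simp: analytic_extension_def)
  have cont: "isCont g \<zeta>"
    using holomorphic_on_imp_continuous_on[OF U(3)] U(1,2) by (simp add: continuous_on_eq_continuous_at)
  have "\<forall>\<^sub>F z in nhds \<zeta>. g z \<noteq> 0 \<and> z \<in> U"
    using tendsto_imp_eventually_ne[OF cont[unfolded isCont_def] nz] nz U(1,2)
    by (auto simp: eventually_nhds_conv_at eventually_conj_iff eventually_nhds_in_open eventually_at_in_open')
  then obtain \<delta> where \<delta>: "\<delta> > 0" "\<And>z. dist z \<zeta> < \<delta> \<Longrightarrow> g z \<noteq> 0 \<and> z \<in> U"
    by (auto simp: eventually_nhds_metric)
  \<comment> \<open>A zero of \<open>B\<close> closer than \<open>\<delta>\<close> would be a zero of the extension, which has none there.\<close>
  have far: "dist (a j) \<zeta> \<ge> \<delta>" if "j \<in> J" for j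
    using \<delta>(2)[of "a j"] U(4)[of "a j"] B_zero[OF that] zeros_in_disc[OF that] by force
  define K where "K = 4 / (\<delta> / 2)\<^sup>2 * suminf defect"
  have zr: "((\<lambda>r. of_real r * \<zeta>) \<longlongrightarrow> \<zeta>) (at_left (1::real))"
    by (auto intro!: tendsto_eq_intros)
  then have lim: "((\<lambda>r. norm (g (of_real r * \<zeta>))) \<longlongrightarrow> norm (g \<zeta>)) (at_left 1)"
    using cont by (intro tendsto_norm isCont_tendsto_compose[of \<zeta> g])
  have ev: "\<forall>\<^sub>F r in at_left (1::real). 0 < r \<and> 1 - \<delta> / 2 < r \<and> r < 1 \<and> of_real r * \<zeta> \<in> U"
  proof (intro eventually_conj)
    show "\<forall>\<^sub>F r in at_left (1::real). of_real r * \<zeta> \<in> U"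
      using zr U(1,2) by (rule topological_tendstoD)
    show "\<forall>\<^sub>F r in at_left (1::real). 0 < r" "\<forall>\<^sub>F r in at_left (1::real). r < 1"
      by (auto intro: eventually_at_leftI[of 0])
    show "\<forall>\<^sub>F r in at_left (1::real). 1 - \<delta> / 2 < r"
      using \<delta>(1) by (auto intro: eventually_at_leftI[of "1 - \<delta> / 2"])
  qed
  have bounds: "r ^ p * (1 - K * (1 - r)) \<le> norm (g (of_real r * \<zeta>)) \<and> norm (g (of_real r * \<zeta>)) \<le> 1"
    if r: "0 < r \<and> 1 - \<delta> / 2 < r \<and> r < 1 \<and> of_real r * \<zeta> \<in> U" for r
  proof -
    let ?z = "of_real r * \<zeta>"
    have nz: "norm ?z = r"
      using r \<zeta> by (simp add: norm_mult)
    have "norm (1 - cnj (a j) * ?z) \<ge> \<delta> / 2" if j: "j \<in> J" for j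
    proof -
      \<comment> \<open>On the circle \<open>\<zeta> * cnj \<zeta> = 1\<close>, so the denominator is the distance from \<open>\<zeta>\<close> to \<open>r * a j\<close>.\<close>
      have "1 - cnj (a j) * ?z = \<zeta> * cnj (\<zeta> - of_real r * a j)"
        using \<zeta> complex_norm_square[of \<zeta>] by (simp add: algebra_simps)
      then have "norm (1 - cnj (a j) * ?z) = norm (\<zeta> - of_real r * a j)"
        using \<zeta> by (metis complex_mod_cnj mult_1 norm_mult)
      also have "\<dots> = norm ((\<zeta> - a j) + of_real (1 - r) * a j)"
        by (simp add: algebra_simps)
      also have "\<dots> \<ge> norm (\<zeta> - a j) - norm (of_real (1 - r) * a j)"
        by (metis add.commute add_diff_cancel_left' diff_le_eq norm_minus_commute norm_triangle_sub)
      finally have "norm (1 - cnj (a j) * ?z) \<ge> norm (\<zeta> - a j) - (1 - r) * norm (a j)"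
        using r by (simp add: norm_mult del: of_real_diff)
      moreover have "norm (\<zeta> - a j) \<ge> \<delta>"
        using far[OF j] by (simp add: dist_norm norm_minus_commute)
      moreover have "(1 - r) * norm (a j) \<le> \<delta> / 2"
        using zeros_in_disc[OF j] r mult_mono[of "1 - r" "\<delta> / 2" "norm (a j)" 1] by simp
      ultimately show ?thesis by simp
    qed
    then have "r ^ p * (1 - K * (1 - r)) \<le> norm (B ?z)"
      using norm_B_ge[of ?z "\<delta> / 2"] \<delta>(1) r nz by (simp add: K_def)
    moreover have "norm (B ?z) \<le> 1"
      using r nz by (intro norm_B_le_1) simp
    ultimately show ?thesis
      using U(4)[of ?z] r nz by simp
  qed
  have "((\<lambda>r. r ^ p * (1 - K * (1 - r))) \<longlongrightarrow> 1 ^ p * (1 - K * (1 - 1))) (at_left 1)"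
    by (intro tendsto_intros)
  then have "1 \<le> norm (g \<zeta>)"
    using lim bounds ev
    by (intro tendsto_le[OF _ lim, of "\<lambda>r. r ^ p * (1 - K * (1 - r))"])
      (auto elim: eventually_mono)
  moreover have "norm (g \<zeta>) \<le> 1"
    using bounds by (intro tendsto_upperbound[OF lim eventually_mono[OF ev]]) auto
  ultimately show ?thesis by simp
qed

text \<open>
  The extension cannot vanish at \<open>\<zeta>\<close>: \<open>B\<close> has only countably many zeros in the disc, so the extension is not
  identically zero, hence nonzero at all nearby points of the circle. There its modulus is 1, and by
  continuity it is 1 at \<open>\<zeta>\<close> too.
\<close>
lemma norm_extension_eq_1:
  assumes ext: "analytic_extension B \<zeta> U g" and \<zeta>: "norm \<zeta> = 1"
  shows "norm (g \<zeta>) = 1"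
proof (cases "g \<zeta> = 0")
  case True
  have U: "open U" "\<zeta> \<in> U" "g holomorphic_on U" "\<And>z. z \<in> U \<Longrightarrow> norm z < 1 \<Longrightarrow> g z = B z"
    using ext by (auto simp: analytic_extension_def)
  obtain e where e: "e > 0" "ball \<zeta> e \<subseteq> U"
    using U(1,2) openE by blast
  have "\<zeta> islimpt ball 0 1"
    using \<zeta> by (simp add: islimpt_ball)
  then obtain w where w: "w \<in> ball 0 1" "w \<in> ball \<zeta> e"
    using e(1) by (metis centre_in_ball islimptE open_ball)
  obtain e' where e': "e' > 0" "ball w e' \<subseteq> ball 0 1 \<inter> ball \<zeta> e"
    using openE[of "ball 0 1 \<inter> ball \<zeta> e" w] w by blast
  have "uncountable (ball w e')"
    using e'(1) by (rule uncountable_ball)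
  then have "\<not> ball w e' \<subseteq> insert 0 (a ` J)"
    by (meson countable_insert countable_image countableI_type countable_subset)
  then obtain b where b: "b \<in> ball w e'" "b \<notin> insert 0 (a ` J)"
    by blast
  then have "norm b < 1" "b \<in> ball \<zeta> e"
    using e'(2) by auto
  then have "g b \<noteq> 0"
    using B_zero_imp[of b] b(2) U(4)[of b] e(2) by auto
  moreover have "g holomorphic_on ball \<zeta> e"
    using U(3) e(2) holomorphic_on_subset by blast
  ultimately obtain r where r: "r > 0" "ball \<zeta> r \<subseteq> ball \<zeta> e"
      "\<And>z. z \<in> ball \<zeta> r - {\<zeta>} \<Longrightarrow> g z \<noteq> 0"
    using isolated_zeros[of g "ball \<zeta> e" \<zeta> b] True e(1) \<open>b \<in> ball \<zeta> e\<close>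
    by (metis centre_in_ball connected_ball open_ball)
  have one: "norm (g z) = 1" if "z \<in> ball \<zeta> r - {\<zeta>}" "norm z = 1" for z
  proof (rule norm_extension_eq_1_if_nonzero[of z U g])
    have "z \<in> U"
      using that r(2) e(2) by blast
    then show "analytic_extension B z U g"
      using ext by (simp add: analytic_extension_def)
  qed (use that r(3) in auto)
  have "isCont g \<zeta>"
    using holomorphic_on_imp_continuous_on[OF U(3)] U(1,2) by (simp add: continuous_on_eq_continuous_at)
  then have lim: "((\<lambda>z. norm (g z)) \<longlongrightarrow> norm (g \<zeta>)) (at \<zeta> within sphere 0 1)"
    by (intro tendsto_norm) (metis continuous_at_imp_continuous_within continuous_within)
  have "connected (sphere (0::complex) 1)"
    by (intro connected_sphere) simp
  moreover have "sphere (0::complex) 1 \<noteq> {w}" for w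
  proof
    assume "sphere 0 1 = {w}"
    moreover have "\<zeta> \<in> sphere 0 1" "- \<zeta> \<in> sphere 0 1"
      using \<zeta> by simp_all
    ultimately have "- \<zeta> = \<zeta>" by (metis singletonD)
    then show False using \<zeta> by auto
  qed
  ultimately have "\<zeta> islimpt sphere 0 1"
    using \<zeta> connected_imp_perfect[of "sphere 0 1" \<zeta>] by simp
  then have nt: "at \<zeta> within sphere 0 1 \<noteq> bot"
    by (simp add: trivial_limit_within)
  have "\<forall>\<^sub>F z in at \<zeta> within sphere 0 1. norm (g z) = 1"
    unfolding eventually_at using r(1) one
    by (intro exI[of _ r]) (auto simp: dist_commute)
  then have "((\<lambda>z. norm (g z)) \<longlongrightarrow> 1) (at \<zeta> within sphere 0 1)"
    by (simp add: tendsto_eventually)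
  then show ?thesis
    using tendsto_unique[OF nt lim] by simp
qed (use norm_extension_eq_1_if_nonzero[OF assms] in blast)

text \<open>
  All factors have modulus at most 1 and a single one already falls short of 1 linearly in the distance to the
  circle. The bound is the quantitative form of the boundary point lemma of Hopf for \<open>B\<close>.
\<close>
lemma norm_B_sq_le:
  assumes "p > 0 \<or> J \<noteq> {}"
  shows "\<exists>\<kappa>>0. \<forall>z. norm z < 1 \<longrightarrow> (norm (B z))\<^sup>2 \<le> 1 - \<kappa> * (1 - norm z)"
proof (cases "p > 0")
  case True
  have "(norm (B z))\<^sup>2 \<le> norm z" if "norm z < 1" for z
  proof -
    have "norm z ^ p \<le> norm z"
      using that power_decreasing[of 1 p "norm z"] True by simp
    then have "norm (B z) \<le> norm z"
      using norm_B_le_power[OF that] by linarith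
    moreover have "(norm (B z))\<^sup>2 \<le> norm (B z)"
      using norm_B_le_1[OF that] by (simp add: power2_eq_square mult_left_le)
    ultimately show ?thesis by linarith
  qed
  then show ?thesis
    by (intro exI[of _ 1]) auto
next
  case False
  then obtain i where i: "i \<in> J"
    using assms by auto
  let ?a = "a i"
  have a: "norm ?a < 1" "?a \<noteq> 0"
    using zeros_in_disc[OF i] by auto
  define \<kappa> where "\<kappa> = (1 - (norm ?a)\<^sup>2) / 4"
  have \<kappa>: "\<kappa> > 0"
    using a by (simp add: \<kappa>_def abs_square_less_1)
  have "(norm (B z))\<^sup>2 \<le> 1 - \<kappa> * (1 - norm z)" if z: "norm z < 1" for z
  proof -
    have caz: "norm (cnj ?a * z) < 1"
      using mult_strict_mono[of "norm ?a" 1 "norm z" 1] a z by (simp add: norm_mult)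
    then have nz: "1 - cnj ?a * z \<noteq> 0"
      by (metis eq_iff_diff_eq_0 less_irrefl norm_one)
    have "norm (1 - cnj ?a * z) \<le> 2"
      using caz norm_triangle_ineq4[of 1 "cnj ?a * z"] by simp
    then have "(norm (1 - cnj ?a * z))\<^sup>2 \<le> 2\<^sup>2"
      by (intro power_mono) auto
    moreover have "(norm z)\<^sup>2 \<le> norm z"
      using z by (simp add: power2_eq_square mult_left_le)
    ultimately have "(1 - (norm ?a)\<^sup>2) * (1 - norm z) / 4
        \<le> (1 - (norm ?a)\<^sup>2) * (1 - (norm z)\<^sup>2) / (norm (1 - cnj ?a * z))\<^sup>2"
      using \<kappa> z nz by (intro frac_le mult_left_mono mult_nonneg_nonneg) (auto simp: \<kappa>_def)
    also have "\<dots> = 1 - (norm (factor i z))\<^sup>2"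
      using one_minus_blaschke_factor_sq[of ?a z] a z i by (simp add: factor_def)
    also have "\<dots> \<le> 1 - (norm (B z))\<^sup>2"
      using norm_B_le_factor[OF z, of i] by (simp add: power_mono)
    finally show ?thesis
      by (simp add: \<kappa>_def)
  qed
  then show ?thesis
    using \<kappa> by blast
qed

lemma spectrum_empty_if_no_zeros:
  assumes "p = 0" "J = {}"
  shows "spectrum B = {}"
proof -
  have "analytic_extension B \<zeta> UNIV (\<lambda>z. c)" for \<zeta>
    using assms B_eq by (auto simp: analytic_extension_def)
  then show ?thesis
    by (auto simp: spectrum_def)
qed

text \<open>
  The quantity \<open>Q = \<zeta> * deriv g \<zeta> * cnj (g \<zeta>)\<close> contains both directional derivatives of \<open>(norm g)\<^sup>2\<close> at \<open>\<zeta>\<close>. The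
  tangential one is zero because the modulus is 1 along the circle, so \<open>Q\<close> is real. The radial one is positive by
  \<open>norm_B_sq_le\<close>, so \<open>Q > 0\<close>. Since \<open>norm (g \<zeta>) = 1\<close>, \<open>Q\<close> is the factor sought.
\<close>
lemma extension_angular_derivative:
  assumes ext: "analytic_extension B \<zeta> U g" and \<zeta>: "norm \<zeta> = 1" and zeros: "p > 0 \<or> J \<noteq> {}"
  shows "\<exists>l::real. l > 0 \<and> \<zeta> * deriv g \<zeta> = of_real l * g \<zeta>"
proof -
  have U: "open U" "\<zeta> \<in> U" "g holomorphic_on U" "\<And>z. z \<in> U \<Longrightarrow> norm z < 1 \<Longrightarrow> g z = B z"
    using ext by (auto simp: analytic_extension_def)
  obtain \<kappa> where \<kappa>: "\<kappa> > 0" "\<And>z. norm z < 1 \<Longrightarrow> (norm (B z))\<^sup>2 \<le> 1 - \<kappa> * (1 - norm z)"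
    using norm_B_sq_le[OF zeros] by blast
  define Q where "Q = \<zeta> * deriv g \<zeta> * cnj (g \<zeta>)"
  have g: "(g has_field_derivative deriv g \<zeta>) (at \<zeta>)"
    using U holomorphic_derivI by blast
  have gc: "norm (g z) = 1" if "z \<in> U" "norm z = 1" for z
    using norm_extension_eq_1[of z U g] that ext by (auto simp: analytic_extension_def)
  have deriv_along: "((\<lambda>s. (norm (g (\<gamma> s)))\<^sup>2) has_real_derivative 2 * Re (v * Q)) (at s0)"
    if \<gamma>: "(\<gamma> has_vector_derivative v * \<zeta>) (at s0)" "\<gamma> s0 = \<zeta>" for \<gamma> :: "real \<Rightarrow> complex" and v s0
  proof -
    have d: "((\<lambda>s. g (\<gamma> s)) has_vector_derivative v * \<zeta> * deriv g \<zeta>) (at s0)"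
      using field_vector_diff_chain_at[OF \<gamma>(1), of g "deriv g \<zeta>"] g \<gamma>(2) by (simp add: o_def)
    have "((\<lambda>s. g (\<gamma> s) \<bullet> g (\<gamma> s)) has_derivative
        (\<lambda>h. g (\<gamma> s0) \<bullet> (h *\<^sub>R (v * \<zeta> * deriv g \<zeta>)) + (h *\<^sub>R (v * \<zeta> * deriv g \<zeta>)) \<bullet> g (\<gamma> s0))) (at s0)"
      using d unfolding has_vector_derivative_def by (intro has_derivative_inner)
    note inner_deriv = this
    have eq: "(v * \<zeta> * deriv g \<zeta>) \<bullet> g \<zeta> = Re (v * Q)"
      by (simp add: Q_def inner_complex_def algebra_simps)
    show ?thesis
      unfolding has_field_derivative_def power2_norm_eq_inner
      by (rule has_derivative_eq_rhs[OF inner_deriv])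
        (simp add: \<gamma>(2) inner_commute[of "g \<zeta>"] eq fun_eq_iff)
  qed
  have tan: "((\<lambda>s. cis s * \<zeta>) has_vector_derivative \<i> * \<zeta>) (at 0)"
    unfolding has_vector_derivative_def by (auto intro!: derivative_eq_intros)
  have "\<forall>\<^sub>F s in nhds 0. cis s * \<zeta> \<in> U"
  proof -
    have "isCont (\<lambda>s. cis s * \<zeta>) 0"
      using tan by (rule has_vector_derivative_continuous)
    then have "((\<lambda>s. cis s * \<zeta>) \<longlongrightarrow> cis 0 * \<zeta>) (nhds 0)"
      using tendsto_at_iff_tendsto_nhds[of "\<lambda>s. cis s * \<zeta>" 0] by (simp only: isCont_def)
    then show ?thesis
      using U(1,2) by (intro topological_tendstoD[where l = "cis 0 * \<zeta>"]) auto
  qed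
  then have ev: "\<forall>\<^sub>F s in nhds 0. (norm (g (cis s * \<zeta>)))\<^sup>2 = 1"
    by eventually_elim (simp add: gc norm_mult \<zeta>)
  have "((\<lambda>s. 1) has_real_derivative 2 * Re (\<i> * Q)) (at (0::real))"
    using deriv_along[OF tan] DERIV_cong_ev[OF refl ev refl] by simp
  then have "2 * Re (\<i> * Q) = 0"
    using DERIV_unique DERIV_const by blast
  then have Im_Q: "Im Q = 0"
    by simp
  have rad: "((\<lambda>s. of_real s * \<zeta>) has_vector_derivative 1 * \<zeta>) (at 1)"
    unfolding has_vector_derivative_def
    by (auto intro!: derivative_eq_intros simp: scaleR_conv_of_real)
  define u where "u s = (norm (g (of_real s * \<zeta>)))\<^sup>2" for s
  have u1: "u 1 = 1"
    using gc[of \<zeta>] U(2) \<zeta> by (simp add: u_def)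
  have "(u has_real_derivative 2 * Re Q) (at 1)"
    using deriv_along[OF rad] by (simp add: u_def[abs_def])
  then have "((\<lambda>s. (u s - u 1) / (s - 1)) \<longlongrightarrow> 2 * Re Q) (at_left 1)"
    unfolding has_field_derivative_iff by (rule tendsto_mono[rotated]) (simp add: at_le)
  moreover have "\<forall>\<^sub>F s in at_left 1. \<kappa> \<le> (u s - u 1) / (s - 1)"
  proof -
    have "((\<lambda>s. of_real s * \<zeta>) \<longlongrightarrow> \<zeta>) (at_left (1::real))"
      by (auto intro!: tendsto_eq_intros)
    then have "\<forall>\<^sub>F s in at_left (1::real). of_real s * \<zeta> \<in> U"
      using U(1,2) by (rule topological_tendstoD)
    moreover have "\<forall>\<^sub>F s in at_left (1::real). 0 < s" "\<forall>\<^sub>F s in at_left (1::real). s < 1"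
      by (auto intro: eventually_at_leftI[of 0])
    ultimately show ?thesis
    proof eventually_elim
      case (elim s)
      have "norm (of_real s * \<zeta>) = s"
        using elim \<zeta> by (simp add: norm_mult)
      then have "u s \<le> 1 - \<kappa> * (1 - s)"
        using \<kappa>(2)[of "of_real s * \<zeta>"] U(4) elim by (simp add: u_def)
      then show ?case
        using elim u1 by (simp add: field_simps)
    qed
  qed
  ultimately have "\<kappa> \<le> 2 * Re Q"
    by (intro tendsto_lowerbound) auto
  then have Re_Q: "Re Q > 0"
    using \<kappa>(1) by simp
  have "g \<zeta> * cnj (g \<zeta>) = 1"
    using gc[of \<zeta>] U(2) \<zeta> complex_norm_square[of "g \<zeta>"] by simp
  then have "\<zeta> * deriv g \<zeta> = Q * g \<zeta>"
    by (simp add: Q_def mult.assoc mult.commute[of "cnj (g \<zeta>)"])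
  moreover have "Q = of_real (Re Q)"
    using Im_Q by (simp add: complex_eq_iff)
  ultimately show ?thesis
    using Re_Q by metis
qed

end

lemma blaschke_product_imp_blaschke:
  assumes "blaschke_product B"
  obtains c p J a where "blaschke B c p J a"
proof -
  obtain c and p :: nat and J :: "nat set" and a :: "nat \<Rightarrow> complex" where
    "norm c = 1" "\<forall>j\<in>J. a j \<in> unit_disc - {0}" "(\<lambda>j. 1 - norm (a j)) summable_on J"
    "\<forall>z\<in>unit_disc. B z = c * z ^ p * prodinf (\<lambda>j. if j \<in> J then blaschke_factor (a j) z else 1)"
    using assms unfolding blaschke_product_def by blast
  then have "blaschke B c p J a"
    by unfold_locales auto
  then show ?thesis ..
qed

lemma bdry_angular_derivative:
  assumes "blaschke_product B" "spectrum B \<noteq> {}" "cis \<theta> \<notin> spectrum B"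
  shows "norm (bdry B (cis \<theta>)) = 1"
    and "\<exists>l>0. ((\<lambda>s. bdry B (cis s)) has_vector_derivative \<i> * of_real l * bdry B (cis \<theta>)) (at \<theta>)"
proof -
  obtain c p J a where "blaschke B c p J a"
    using assms(1) blaschke_product_imp_blaschke by blast
  then interpret blaschke B c p J a .
  have zeros: "p > 0 \<or> J \<noteq> {}"
    using spectrum_empty_if_no_zeros assms(2) by blast
  obtain U g where ext: "analytic_extension B (cis \<theta>) U g"
    using assms(3) by (auto simp: spectrum_def)
  then have U: "open U" "cis \<theta> \<in> U" "g holomorphic_on U"
    by (auto simp: analytic_extension_def)
  have eq: "bdry B (cis s) = g (cis s)" if "cis s \<in> U" for s
    using bdry_eq[of "cis s" B U g] ext that by (simp add: analytic_extension_def)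
  show "norm (bdry B (cis \<theta>)) = 1"
    using norm_extension_eq_1[OF ext] eq[OF U(2)] by simp
  obtain l where l: "l > 0" "cis \<theta> * deriv g (cis \<theta>) = of_real l * g (cis \<theta>)"
    using extension_angular_derivative[OF ext _ zeros] by auto
  have "(g has_field_derivative deriv g (cis \<theta>)) (at (cis \<theta>))"
    using U holomorphic_derivI by blast
  moreover have "(cis has_vector_derivative \<i> * cis \<theta>) (at \<theta>)"
    unfolding has_vector_derivative_def by (auto intro!: derivative_eq_intros)
  ultimately have "((\<lambda>s. g (cis s)) has_vector_derivative \<i> * cis \<theta> * deriv g (cis \<theta>)) (at \<theta>)"
    using field_vector_diff_chain_at[of cis "\<i> * cis \<theta>" \<theta> g] by (simp add: o_def)
  also have "\<i> * cis \<theta> * deriv g (cis \<theta>) = \<i> * of_real l * bdry B (cis \<theta>)"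
    using l(2) eq[OF U(2)] by (simp add: mult.assoc)
  finally have d: "((\<lambda>s. g (cis s)) has_vector_derivative \<i> * of_real l * bdry B (cis \<theta>)) (at \<theta>)" .
  have "open (cis -` U)"
    by (intro open_vimage U continuous_intros)
  then have "((\<lambda>s. bdry B (cis s)) has_vector_derivative \<i> * of_real l * bdry B (cis \<theta>)) (at \<theta>)"
    by (rule has_vector_derivative_transform_within_open[OF d]) (use U(2) eq in auto)
  then show "\<exists>l>0. ((\<lambda>s. bdry B (cis s)) has_vector_derivative \<i> * of_real l * bdry B (cis \<theta>)) (at \<theta>)"
    using l(1) by blast
qed

section \<open>The phase on the regular arcs\<close>

text \<open>
  The argument is a continuous logarithm of \<open>h\<close>, which exists because an interval is contractible. Near each
  point it is an \<open>arcsin\<close> of the imaginary part of \<open>h\<close> divided by a constant, so it has derivative \<open>l > 0\<close>.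
\<close>
lemma increasing_argument:
  fixes h :: "real \<Rightarrow> complex"
  assumes "\<And>\<theta>. \<alpha> < \<theta> \<Longrightarrow> \<theta> < \<beta> \<Longrightarrow> norm (h \<theta>) = 1"
    and "\<And>\<theta>. \<alpha> < \<theta> \<Longrightarrow> \<theta> < \<beta> \<Longrightarrow>
      \<exists>l>0. (h has_vector_derivative \<i> * of_real l * h \<theta>) (at \<theta>)"
  shows "\<exists>\<Phi>. continuous_on {\<alpha><..<\<beta>} \<Phi> \<and> strict_mono_on {\<alpha><..<\<beta>} \<Phi> \<and>
    (\<forall>\<theta>\<in>{\<alpha><..<\<beta>}. h \<theta> = cis (\<Phi> \<theta>))"
proof -
  let ?I = "{\<alpha><..<\<beta>}"
  have h: "continuous_on ?I h"
  proof (intro continuous_at_imp_continuous_on ballI)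
    fix \<theta> assume "\<theta> \<in> ?I"
    then show "isCont h \<theta>"
      using assms(2)[of \<theta>] has_vector_derivative_continuous by auto
  qed
  have nz: "h \<theta> \<noteq> 0" if "\<theta> \<in> ?I" for \<theta>
    using assms(1)[of \<theta>] that by auto
  have "contractible ?I"
    by (intro convex_imp_contractible) auto
  then obtain L where L: "continuous_on ?I L" "\<And>\<theta>. \<theta> \<in> ?I \<Longrightarrow> h \<theta> = exp (L \<theta>)"
    using continuous_logarithm_on_contractible[OF h _ nz] by blast
  define \<Phi> where "\<Phi> \<theta> = Im (L \<theta>)" for \<theta>
  have \<Phi>: "h \<theta> = cis (\<Phi> \<theta>)" if "\<theta> \<in> ?I" for \<theta>
  proof -
    have "exp (Re (L \<theta>)) = 1"
      using assms(1)[of \<theta>] L(2)[OF that] that by simp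
    then show ?thesis
      using L(2)[OF that] by (simp add: exp_eq_polar \<Phi>_def)
  qed
  have cont: "continuous_on ?I \<Phi>"
    unfolding \<Phi>_def by (intro continuous_intros L)
  have deriv: "\<exists>l>0. (\<Phi> has_real_derivative l) (at \<theta>)" if \<theta>: "\<theta> \<in> ?I" for \<theta>
  proof -
    have "\<exists>l>0. (h has_vector_derivative \<i> * of_real l * h \<theta>) (at \<theta>)"
      using assms(2)[of \<theta>] \<theta> by simp
    then obtain l where l: "l > 0" "(h has_vector_derivative \<i> * of_real l * h \<theta>) (at \<theta>)"
      by blast
    have bl: "bounded_linear (\<lambda>z. Im (cnj (h \<theta>) * z))"
      by (rule bounded_linear_compose[OF bounded_linear_Im bounded_linear_mult_right])
    have "((\<lambda>s. Im (cnj (h \<theta>) * h s)) has_vector_derivative Im (cnj (h \<theta>) * (\<i> * of_real l * h \<theta>))) (at \<theta>)"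
      by (rule bounded_linear.has_vector_derivative[OF bl l(2)])
    moreover have "cnj (h \<theta>) * (\<i> * of_real l * h \<theta>) = \<i> * of_real l"
      using complex_norm_square[of "h \<theta>"] assms(1)[of \<theta>] that by (simp add: algebra_simps)
    ultimately have *: "((\<lambda>s. Im (cnj (h \<theta>) * h s)) has_real_derivative l) (at \<theta>)"
      by (simp add: has_real_derivative_iff_has_vector_derivative)
    have "isCont \<Phi> \<theta>"
      using cont that by (simp add: continuous_on_eq_continuous_at)
    then have "(\<Phi> \<longlongrightarrow> \<Phi> \<theta>) (nhds \<theta>)"
      by (simp add: isCont_def tendsto_at_iff_tendsto_nhds)
    then have "\<forall>\<^sub>F s in nhds \<theta>. dist (\<Phi> s) (\<Phi> \<theta>) < pi / 2"
      using tendstoD[of \<Phi> _ _ "pi / 2"] by simp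
    moreover have "\<forall>\<^sub>F s in nhds \<theta>. s \<in> ?I"
      using that by (intro eventually_nhds_in_open) auto
    ultimately have ev: "\<forall>\<^sub>F s in nhds \<theta>. arcsin (Im (cnj (h \<theta>) * h s)) + \<Phi> \<theta> = \<Phi> s"
    proof eventually_elim
      case (elim s)
      have "cnj (h \<theta>) * h s = cis (\<Phi> s - \<Phi> \<theta>)"
        using \<Phi>[OF that] \<Phi>[of s] elim by (simp add: cis_cnj cis_mult)
      moreover have "arcsin (sin (\<Phi> s - \<Phi> \<theta>)) = \<Phi> s - \<Phi> \<theta>"
        using elim unfolding dist_real_def by (intro arcsin_sin) linarith+
      ultimately show ?case
        by simp
    qed
    have "Im (cnj (h \<theta>) * h \<theta>) = 0"
      by simp
    then have d: "((\<lambda>s. arcsin (Im (cnj (h \<theta>) * h s)) + \<Phi> \<theta>) has_real_derivative l) (at \<theta>)"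
    proof -
      have "((\<lambda>s. arcsin (f s) + \<Phi> \<theta>) has_real_derivative l) (at \<theta>)"
        if "(f has_real_derivative l) (at \<theta>)" "f \<theta> = 0" for f
        using that by (auto intro!: derivative_eq_intros)
      from this[OF *] show ?thesis
        by simp
    qed
    then have "(\<Phi> has_real_derivative l) (at \<theta>)"
      using DERIV_cong_ev[OF refl ev refl] by simp
    then show ?thesis
      using l(1) by blast
  qed
  have "strict_mono_on ?I \<Phi>"
  proof (rule strict_mono_onI)
    fix r s assume rs: "r \<in> ?I" "s \<in> ?I" "r < s"
    show "\<Phi> r < \<Phi> s"
      using rs(3) by (rule DERIV_pos_imp_increasing) (use rs deriv in \<open>metis greaterThanLessThan_iff le_less_trans less_le_trans\<close>)
  qed
  then show ?thesis
    using cont \<Phi> by blast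
qed

lemma cis_eq_cis_iff: "cis s = cis s' \<longleftrightarrow> (\<exists>q::int. s = s' + 2 * pi * of_int q)"
proof -
  have "cis s = cis s' \<longleftrightarrow> sin s = sin s' \<and> cos s = cos s'"
    by (auto simp: complex_eq_iff)
  then show ?thesis
    by (simp add: sin_cos_eq_iff)
qed

text \<open>
  The set \<open>2\<pi>\<int>\<close> is discrete.
\<close>
lemma connected_cis_eq_1_imp_const:
  fixes D :: "real \<Rightarrow> real"
  assumes "connected S" "continuous_on S D" "\<And>\<theta>. \<theta> \<in> S \<Longrightarrow> cis (D \<theta>) = 1"
  shows "\<exists>m::int. \<forall>\<theta>\<in>S. D \<theta> = 2 * pi * of_int m"
proof -
  have int: "\<exists>m::int. D \<theta> = 2 * pi * of_int m" if "\<theta> \<in> S" for \<theta>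
    using assms(3)[OF that] cis_eq_cis_iff[of "D \<theta>" 0] by simp
  have "is_interval (D ` S)"
    using assms(1,2) connected_continuous_image is_interval_connected_1 by blast
  moreover have "\<not> D \<theta> < D \<theta>'" if "\<theta> \<in> S" "\<theta>' \<in> S" "is_interval (D ` S)" for \<theta> \<theta>'
  proof
    assume less: "D \<theta> < D \<theta>'"
    obtain m m' :: int where m: "D \<theta> = 2 * pi * of_int m" "D \<theta>' = 2 * pi * of_int m'"
      using int \<open>\<theta> \<in> S\<close> \<open>\<theta>' \<in> S\<close> by meson
    then have "m < m'"
      using less by simp
    then have "of_int m + 1 \<le> (of_int m' :: real)"
      by linarith
    then have "2 * pi * (of_int m + 1) \<le> 2 * pi * of_int m'"
      by (intro mult_left_mono) auto
    then have "D \<theta> + 2 * pi \<le> D \<theta>'"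
      by (simp add: m algebra_simps)
    then have "D \<theta> \<le> D \<theta> + pi" "D \<theta> + pi \<le> D \<theta>'"
      using pi_gt_zero by linarith+
    then have "D \<theta> + pi \<in> D ` S"
      using mem_is_interval_1_I[OF \<open>is_interval (D ` S)\<close>] \<open>\<theta> \<in> S\<close> \<open>\<theta>' \<in> S\<close> by blast
    then obtain \<theta>'' where \<theta>'': "\<theta>'' \<in> S" "D \<theta>'' = D \<theta> + pi"
      by (metis imageE)
    then obtain m'' :: int where "D \<theta>'' = 2 * pi * of_int m''"
      using int by blast
    then have "2 * pi * of_int m + pi = 2 * pi * of_int m''"
      using \<theta>''(2) m(1) by linarith
    then have "pi * (2 * of_int m + 1) = pi * (2 * of_int m'')"
      by (simp add: algebra_simps)
    then have "real_of_int (2 * m + 1) = of_int (2 * m'')"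
      by simp
    then have "2 * m + 1 = 2 * m''"
      using of_int_eq_iff by blast
    then show False by presburger
  qed
  ultimately have "D \<theta> = D \<theta>'" if "\<theta> \<in> S" "\<theta>' \<in> S" for \<theta> \<theta>'
    using that by (meson linorder_neqE_linordered_idom)
  then show ?thesis
    using int by (metis all_not_in_conv)
qed

locale circle_partition =
  fixes n :: nat and T :: "int \<Rightarrow> real"
  assumes n_pos: "n > 0"
    and T_strict: "strict_mono T"
    and T_period: "\<And>j. T (j + int n) = T j + 2 * pi"
begin

abbreviation arc :: "int \<Rightarrow> real set" where
  "arc j \<equiv> {T j<..<T (j + 1)}"

lemma T_less [simp]: "T i < T j \<longleftrightarrow> i < j" and T_le [simp]: "T i \<le> T j \<longleftrightarrow> i \<le> j"
  and T_eq [simp]: "T i = T j \<longleftrightarrow> i = j"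
  using T_strict by (simp_all add: strict_mono_less strict_mono_less_eq strict_mono_eq)

lemma T_shift: "T (j + q * int n) = T j + 2 * pi * of_int q"
proof (induction q rule: int_induct[where k = 0])
  case (step1 i)
  then show ?case
    using T_period[of "j + i * int n"] by (simp add: algebra_simps)
next
  case (step2 i)
  then show ?case
    using T_period[of "j + (i - 1) * int n"] by (simp add: algebra_simps)
qed simp

lemma index_exists: "\<exists>j. T j \<le> \<theta> \<and> \<theta> < T (j + 1)"
proof -
  define q where "q = \<lfloor>(\<theta> - T 0) / (2 * pi)\<rfloor>"
  have "of_int q \<le> (\<theta> - T 0) / (2 * pi)" "(\<theta> - T 0) / (2 * pi) < of_int q + 1"
    unfolding q_def by linarith+
  then have q: "T (q * int n) \<le> \<theta>" "\<theta> < T ((q + 1) * int n)"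
    using T_shift[of 0 q] T_shift[of 0 "q + 1"] by (simp_all add: field_simps)
  define A where "A = {j \<in> {q * int n..(q + 1) * int n}. T j \<le> \<theta>}"
  have "A \<subseteq> {q * int n..(q + 1) * int n}"
    by (auto simp: A_def)
  then have A: "finite A" "q * int n \<in> A"
    using q n_pos finite_subset by (auto simp: A_def distrib_right)
  have "Max A \<in> A"
    using A by (intro Max_in) auto
  moreover have "\<theta> < T (Max A + 1)"
  proof (rule ccontr)
    assume *: "\<not> \<theta> < T (Max A + 1)"
    have M: "q * int n \<le> Max A" "T (Max A) \<le> \<theta>"
      using \<open>Max A \<in> A\<close> by (simp_all add: A_def)
    then have "T (Max A) < T ((q + 1) * int n)"
      using q by linarith
    then have "Max A + 1 \<in> A"
      using M * by (simp add: A_def)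
    then show False
      using Max_ge[OF A(1), of "Max A + 1"] by simp
  qed
  ultimately show ?thesis
    by (auto simp: A_def)
qed

lemma index_unique:
  assumes "T j \<le> \<theta>" "\<theta> < T (j + 1)" "T j' \<le> \<theta>" "\<theta> < T (j' + 1)"
  shows "j = j'"
proof -
  have "T j < T (j' + 1)" "T j' < T (j + 1)"
    using assms by linarith+
  then show ?thesis by simp
qed

definition index :: "real \<Rightarrow> int" where
  "index \<theta> = (THE j. T j \<le> \<theta> \<and> \<theta> < T (j + 1))"

lemma index_eq: "T j \<le> \<theta> \<Longrightarrow> \<theta> < T (j + 1) \<Longrightarrow> index \<theta> = j"
  unfolding index_def using index_unique by blast

lemma index_bounds: "T (index \<theta>) \<le> \<theta>" "\<theta> < T (index \<theta> + 1)"
  using index_exists[of \<theta>] index_eq by metis+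

lemma index_shift: "index (\<theta> + 2 * pi * of_int q) = index \<theta> + q * int n"
  using index_bounds[of \<theta>] T_shift[of "index \<theta>" q] T_shift[of "index \<theta> + 1" q]
  by (intro index_eq) (simp_all add: algebra_simps)

lemma angle_cases:
  obtains (vertex) j where "\<theta> = T j" | (inner) j where "\<theta> \<in> arc j"
  using index_bounds[of \<theta>] by (metis greaterThanLessThan_iff le_less)

lemma arc_disjoint_range: "\<theta> \<in> arc j \<Longrightarrow> \<theta> \<notin> range T"
  by auto

lemma arc_midpoint: "(T j + T (j + 1)) / 2 \<in> arc j"
proof -
  have "(x + y) / 2 \<in> {x<..<y}" if "x < y" for x y :: real
    using that by simp
  then show ?thesis
    by simp
qed

lemma not_range_arc: "\<theta> \<notin> range T \<Longrightarrow> \<theta> \<in> arc (index \<theta>)"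
  using index_bounds[of \<theta>] by (metis greaterThanLessThan_iff le_less rangeI)

lemma cis_T_eq_iff: "cis \<theta> \<in> cis ` range T \<longleftrightarrow> \<theta> \<in> range T"
proof
  assume "cis \<theta> \<in> cis ` range T"
  then obtain j q where "\<theta> = T j + 2 * pi * of_int q"
    using cis_eq_cis_iff by auto
  then show "\<theta> \<in> range T"
    using T_shift[of j q] by (metis rangeI)
qed auto

lemma index_mod_div: "j = j mod int n + (j div int n) * int n"
  by simp

text \<open>
  The arguments on the \<open>n\<close> arcs of one turn are chosen first and then repeated with period \<open>2\<pi>\<close>. Only the
  values off the singular angles matter, so a single global function can serve all arcs.
\<close>
lemma phase_exists:
  fixes h :: "real \<Rightarrow> complex"
  assumes h: "\<And>\<theta>. h (\<theta> + 2 * pi) = h \<theta>"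
    and ex: "\<And>j. \<exists>P. continuous_on (arc j) P \<and> strict_mono_on (arc j) P \<and> (\<forall>\<theta>\<in>arc j. h \<theta> = cis (P \<theta>))"
  shows "\<exists>\<Phi>. (\<forall>j. continuous_on (arc j) \<Phi> \<and> strict_mono_on (arc j) \<Phi>) \<and>
    (\<forall>\<theta>. \<Phi> (\<theta> + 2 * pi) = \<Phi> \<theta>) \<and> (\<forall>\<theta>. \<theta> \<notin> range T \<longrightarrow> h \<theta> = cis (\<Phi> \<theta>))"
proof -
  obtain P where P: "\<And>j. continuous_on (arc j) (P j)" "\<And>j. strict_mono_on (arc j) (P j)"
      "\<And>j \<theta>. \<theta> \<in> arc j \<Longrightarrow> h \<theta> = cis (P j \<theta>)"
    using ex by metis
  define \<Phi> where "\<Phi> \<theta> = P (index \<theta> mod int n) (\<theta> - 2 * pi * of_int (index \<theta> div int n))" for \<theta>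
  have hq: "h (\<theta> + 2 * pi * of_int q) = h \<theta>" for \<theta> q
  proof (induction q rule: int_induct[where k = 0])
    case (step1 i)
    then show ?case
      using h[of "\<theta> + 2 * pi * of_int i"] by (simp add: algebra_simps)
  next
    case (step2 i)
    then show ?case
      using h[of "\<theta> + 2 * pi * of_int (i - 1)"] by (simp add: algebra_simps)
  qed simp
  have shift: "\<theta> - 2 * pi * of_int (j div int n) \<in> arc (j mod int n)" if "\<theta> \<in> arc j" for \<theta> j
    using that T_shift[of "j mod int n" "j div int n"] T_shift[of "j mod int n + 1" "j div int n"]
      index_mod_div[of j] by (auto simp: algebra_simps)
  have \<Phi>: "\<Phi> \<theta> = P (j mod int n) (\<theta> - 2 * pi * of_int (j div int n))" if "\<theta> \<in> arc j" for \<theta> j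
    using that index_eq[of j \<theta>] by (simp add: \<Phi>_def)
  have "continuous_on (arc j) \<Phi>" for j
  proof -
    have "continuous_on (arc j) (\<lambda>\<theta>. P (j mod int n) (\<theta> - 2 * pi * of_int (j div int n)))"
      using shift by (intro continuous_on_compose2[OF P(1)[of "j mod int n"]] continuous_intros) auto
    then show ?thesis
      by (subst continuous_on_cong[OF refl \<Phi>]) auto
  qed
  moreover have "strict_mono_on (arc j) \<Phi>" for j
    using P(2)[of "j mod int n"] shift \<Phi> unfolding strict_mono_on_def
    by (metis diff_strict_right_mono)
  moreover have "\<Phi> (\<theta> + 2 * pi) = \<Phi> \<theta>" for \<theta>
    using index_shift[of \<theta> 1] n_pos by (simp add: \<Phi>_def algebra_simps)
  moreover have "h \<theta> = cis (\<Phi> \<theta>)" if "\<theta> \<notin> range T" for \<theta>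
  proof -
    define j where "j = index \<theta>"
    have j: "\<theta> \<in> arc j"
      using not_range_arc[OF that] by (simp add: j_def)
    have "h \<theta> = h (\<theta> - 2 * pi * of_int (j div int n))"
      using hq[of "\<theta> - 2 * pi * of_int (j div int n)" "j div int n"] by simp
    then show ?thesis
      using P(3)[OF shift[OF j]] \<Phi>[OF j] by simp
  qed
  ultimately show ?thesis by blast
qed

end

section \<open>Lifts of the invariants to the line\<close>

text \<open>
  The phase is only meaningful off the singular angles; its values there are arbitrary, subject to
  periodicity.
\<close>
locale circle_phase = circle_partition +
  fixes \<Phi> :: "real \<Rightarrow> real" and B :: "complex \<Rightarrow> complex"
  assumes \<Phi>_cont: "\<And>j. continuous_on (arc j) \<Phi>"
    and \<Phi>_strict: "\<And>j. strict_mono_on (arc j) \<Phi>"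
    and \<Phi>_period: "\<And>\<theta>. \<Phi> (\<theta> + 2 * pi) = \<Phi> \<theta>"
    and spectrum_eq: "spectrum B = cis ` range T"
    and bdry_phase: "\<And>\<theta>. \<theta> \<notin> range T \<Longrightarrow> bdry B (cis \<theta>) = cis (\<Phi> \<theta>)"
begin

definition phases :: "int \<Rightarrow> real set" where
  "phases j = \<Phi> ` arc j"

lemma \<Phi>_shift: "\<Phi> (\<theta> + 2 * pi * of_int q) = \<Phi> \<theta>"
proof (induction q rule: int_induct[where k = 0])
  case (step1 i)
  then show ?case
    using \<Phi>_period[of "\<theta> + 2 * pi * of_int i"] by (simp add: algebra_simps)
next
  case (step2 i)
  then show ?case
    using \<Phi>_period[of "\<theta> + 2 * pi * of_int (i - 1)"] by (simp add: algebra_simps)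
qed simp

lemma \<Phi>_less: "\<theta> \<in> arc j \<Longrightarrow> \<theta>' \<in> arc j \<Longrightarrow> \<Phi> \<theta> < \<Phi> \<theta>' \<longleftrightarrow> \<theta> < \<theta>'"
  using \<Phi>_strict[of j] by (rule strict_mono_on_less)

lemma \<Phi>_eq: "\<theta> \<in> arc j \<Longrightarrow> \<theta>' \<in> arc j \<Longrightarrow> \<Phi> \<theta> = \<Phi> \<theta>' \<longleftrightarrow> \<theta> = \<theta>'"
  using \<Phi>_less[of \<theta> j \<theta>'] \<Phi>_less[of \<theta>' j \<theta>] by (metis less_irrefl linorder_neqE_linordered_idom)

lemma arc_shift: "\<theta> + 2 * pi * of_int q \<in> arc (j + q * int n) \<longleftrightarrow> \<theta> \<in> arc j"
  using T_shift[of j q] T_shift[of "j + 1" q] by (auto simp: algebra_simps)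

lemma phases_shift: "phases (j + q * int n) = phases j"
proof -
  have "y \<in> phases (j + q * int n)" if y: "y \<in> phases j" for y q j
  proof -
    obtain \<theta> where "\<theta> \<in> arc j" "y = \<Phi> \<theta>"
      using y unfolding phases_def by blast
    then have "\<theta> + 2 * pi * of_int q \<in> arc (j + q * int n)" "\<Phi> (\<theta> + 2 * pi * of_int q) = y"
      by (simp_all only: arc_shift \<Phi>_shift)
    then show ?thesis
      unfolding phases_def by blast
  qed
  from this[of _ j q] this[of _ "j + q * int n" "- q"] show ?thesis
    by auto
qed

text \<open>
  The combinatorial data of an invariant: arc \<open>j\<close> is moved onto arc \<open>j + r\<close>, and the phase grows by \<open>2\<pi> m j\<close> along it.
\<close>
definition valid :: "int \<Rightarrow> (int \<Rightarrow> int) \<Rightarrow> bool" where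
  "valid r m \<longleftrightarrow> (\<forall>j. m (j + int n) = m j) \<and>
     (\<forall>j. phases (j + r) = (\<lambda>y. y + 2 * pi * of_int (m j)) ` phases j)"

definition lift :: "int \<Rightarrow> (int \<Rightarrow> int) \<Rightarrow> (real \<Rightarrow> real) \<Rightarrow> bool" where
  "lift r m X \<longleftrightarrow> (\<forall>j. X (T j) = T (j + r) \<and>
     (\<forall>\<theta>\<in>arc j. X \<theta> \<in> arc (j + r) \<and> \<Phi> (X \<theta>) = \<Phi> \<theta> + 2 * pi * of_int (m j)))"

lemma liftD:
  assumes "lift r m X"
  shows "X (T j) = T (j + r)" "\<theta> \<in> arc j \<Longrightarrow> X \<theta> \<in> arc (j + r)"
    "\<theta> \<in> arc j \<Longrightarrow> \<Phi> (X \<theta>) = \<Phi> \<theta> + 2 * pi * of_int (m j)"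
  using assms unfolding lift_def by blast+

lemma valid_shift:
  assumes "valid r m"
  shows "m (j + q * int n) = m j"
proof (induction q rule: int_induct[where k = 0])
  case (step1 i)
  then show ?case
    using assms unfolding valid_def by (metis add.assoc distrib_right mult_1)
next
  case (step2 i)
  have "m (j + (i - 1) * int n + int n) = m (j + (i - 1) * int n)"
    using assms unfolding valid_def by blast
  then show ?case
    using step2 by (simp add: algebra_simps)
qed simp

lemma valid_comp:
  assumes "valid r m" "valid r' m'"
  shows "valid (r + r') (\<lambda>j. m' j + m (j + r'))"
proof -
  have "phases (j + (r + r')) = (\<lambda>y. y + 2 * pi * of_int (m' j + m (j + r'))) ` phases j" for j
  proof -
    have "phases (j + (r + r')) = phases ((j + r') + r)"
      by (simp add: algebra_simps)
    also have "\<dots> = (\<lambda>y. y + 2 * pi * of_int (m (j + r'))) ` (\<lambda>y. y + 2 * pi * of_int (m' j)) ` phases j"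
      using assms unfolding valid_def by metis
    finally show ?thesis
      by (simp add: image_image algebra_simps)
  qed
  moreover have "m' (j + int n) + m (j + int n + r') = m' j + m (j + r')" for j
  proof -
    have "m (j + r' + int n) = m (j + r')" "m' (j + int n) = m' j"
      using assms unfolding valid_def by blast+
    then show ?thesis
      by (simp add: algebra_simps)
  qed
  ultimately show ?thesis
    unfolding valid_def by blast
qed

lemma valid_inverse:
  assumes "valid r m"
  shows "valid (- r) (\<lambda>j. - m (j - r))"
proof -
  have "phases (j + - r) = (\<lambda>y. y + 2 * pi * of_int (- m (j - r))) ` phases j" for j
  proof -
    have "phases ((j - r) + r) = (\<lambda>y. y + 2 * pi * of_int (m (j - r))) ` phases (j - r)"
      using assms unfolding valid_def by blast
    then show ?thesis
      by (simp add: image_image)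
  qed
  moreover have "m (j + int n - r) = m (j - r)" for j
  proof -
    have "m (j - r + int n) = m (j - r)"
      using assms unfolding valid_def by blast
    then show ?thesis
      by (simp add: algebra_simps)
  qed
  ultimately show ?thesis
    unfolding valid_def by simp
qed

lemma valid_id: "valid 0 (\<lambda>_. 0)"
  by (simp add: valid_def)

lemma lift_id: "lift 0 (\<lambda>_. 0) id"
  by (simp add: lift_def)

lemma lift_comp:
  assumes "lift r m X" "lift r' m' Y"
  shows "lift (r + r') (\<lambda>j. m' j + m (j + r')) (X \<circ> Y)"
  unfolding lift_def
proof (intro allI conjI ballI)
  fix j
  have r: "j + (r + r') = (j + r') + r"
    by simp
  show "(X \<circ> Y) (T j) = T (j + (r + r'))"
    unfolding r by (simp add: liftD(1)[OF assms(1)] liftD(1)[OF assms(2)])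
  fix \<theta> assume \<theta>: "\<theta> \<in> arc j"
  note Y = liftD(2,3)[OF assms(2) \<theta>]
  show "(X \<circ> Y) \<theta> \<in> arc (j + (r + r'))"
    unfolding r o_def by (rule liftD(2)[OF assms(1) Y(1)])
  show "\<Phi> ((X \<circ> Y) \<theta>) = \<Phi> \<theta> + 2 * pi * of_int (m' j + m (j + r'))"
    using liftD(3)[OF assms(1) Y(1)] Y(2) by (simp add: algebra_simps)
qed

lemma lift_unique:
  assumes "lift r m X" "lift r m Y"
  shows "X = Y"
proof
  fix \<theta>
  show "X \<theta> = Y \<theta>"
  proof (cases \<theta> rule: angle_cases)
    case (vertex j)
    then show ?thesis
      using liftD(1)[OF assms(1)] liftD(1)[OF assms(2)] by simp
  next
    case (inner j)
    then show ?thesis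
      using \<Phi>_eq[of "X \<theta>" "j + r" "Y \<theta>"] liftD(2,3)[OF assms(1) inner] liftD(2,3)[OF assms(2) inner]
      by simp
  qed
qed

lemma lift_exists:
  assumes "valid r m"
  shows "\<exists>X. lift r m X"
proof -
  have "\<exists>x. x \<in> arc (j + r) \<and> \<Phi> x = \<Phi> \<theta> + 2 * pi * of_int (m j)" if "\<theta> \<in> arc j" for \<theta> j
  proof -
    have "\<Phi> \<theta> + 2 * pi * of_int (m j) \<in> phases (j + r)"
      using assms that unfolding valid_def by (auto simp: phases_def)
    then show ?thesis
      unfolding phases_def by (metis imageE)
  qed
  then obtain f where f: "\<And>\<theta> j. \<theta> \<in> arc j \<Longrightarrow> f \<theta> j \<in> arc (j + r) \<and> \<Phi> (f \<theta> j) = \<Phi> \<theta> + 2 * pi * of_int (m j)"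
    by metis
  \<comment> \<open>Inside the arcs the phase dictates the value; at the singular angles the index does.\<close>
  define X where "X \<theta> = (if \<theta> \<in> range T then T (index \<theta> + r) else f \<theta> (index \<theta>))" for \<theta>
  have "X \<theta> = f \<theta> j" if "\<theta> \<in> arc j" for \<theta> j
    using that arc_disjoint_range[OF that] index_eq[of j \<theta>] by (simp add: X_def)
  moreover have "X (T j) = T (j + r)" for j
    using index_eq[of j "T j"] by (simp add: X_def)
  ultimately have "lift r m X"
    using f by (simp add: lift_def)
  then show ?thesis
    by blast
qed

text \<open>
  Shifting the line by a full turn before and after \<open>X\<close> gives another lift of the same data, and a lift is
  determined by its data.
\<close>
lemma lift_shift:
  assumes "valid r m" "lift r m X"
  shows "X (\<theta> + 2 * pi * of_int q) = X \<theta> + 2 * pi * of_int q"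
proof -
  define Y where "Y \<theta> = X (\<theta> + 2 * pi * of_int q) - 2 * pi * of_int q" for \<theta>
  have "lift r m Y"
    unfolding lift_def
  proof (intro allI conjI ballI)
    fix j
    have r: "j + q * int n + r = (j + r) + q * int n"
      by simp
    show "Y (T j) = T (j + r)"
      using liftD(1)[OF assms(2), of "j + q * int n"] T_shift[of "j + r" q]
      unfolding Y_def r T_shift[of j q, symmetric] by simp
    fix \<theta> assume "\<theta> \<in> arc j"
    then have \<theta>: "\<theta> + 2 * pi * of_int q \<in> arc (j + q * int n)"
      using arc_shift by blast
    show "Y \<theta> \<in> arc (j + r)"
      using liftD(2)[OF assms(2) \<theta>] arc_shift[of "Y \<theta>" q "j + r"] unfolding r by (simp add: Y_def)
    show "\<Phi> (Y \<theta>) = \<Phi> \<theta> + 2 * pi * of_int (m j)"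
      using liftD(3)[OF assms(2) \<theta>] \<Phi>_shift[of "Y \<theta>" q] \<Phi>_shift[of \<theta> q] valid_shift[OF assms(1), of j q]
      by (simp add: Y_def)
  qed
  then have "Y = X"
    using lift_unique assms(2) by blast
  then show ?thesis
    by (metis Y_def diff_add_cancel)
qed

lemma lift_strict_mono:
  assumes "lift r m X"
  shows "strict_mono X"
proof (rule strict_monoI)
  fix \<theta> \<theta>' :: real assume less: "\<theta> < \<theta>'"
  have bounds: "T (j + r) \<le> X x \<and> X x < T (j + 1 + r)" if "T j \<le> x" "x < T (j + 1)" for j x
  proof (cases "x = T j")
    case True
    then show ?thesis
      using liftD(1)[OF assms] by simp
  next
    case False
    then have "X x \<in> arc (j + r)"
      using that by (intro liftD(2)[OF assms]) auto
    then show ?thesis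
      by (simp add: algebra_simps)
  qed
  define i j where "i = index \<theta>" and "j = index \<theta>'"
  have ij: "T i \<le> \<theta>" "\<theta> < T (i + 1)" "T j \<le> \<theta>'" "\<theta>' < T (j + 1)"
    unfolding i_def j_def by (rule index_bounds)+
  then have "T i < T (j + 1)"
    using less by linarith
  then have "i < j \<or> i = j"
    by simp linarith
  then show "X \<theta> < X \<theta>'"
  proof
    assume "i < j"
    then have "T (i + 1 + r) \<le> T (j + r)"
      by simp
    then show ?thesis
      using bounds[OF ij(1,2)] bounds[OF ij(3,4)] by linarith
  next
    assume "i = j"
    then have \<theta>': "\<theta>' \<in> arc j"
      using ij less by simp
    show ?thesis
    proof (cases "\<theta> = T j")
      case True
      then show ?thesis
        using liftD(1)[OF assms, of j] liftD(2)[OF assms \<theta>'] by simp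
    next
      case False
      then have \<theta>: "\<theta> \<in> arc j"
        using ij \<open>i = j\<close> by simp
      show ?thesis
        using \<Phi>_less[OF liftD(2)[OF assms \<theta>] liftD(2)[OF assms \<theta>']]
          \<Phi>_less[OF \<theta> \<theta>'] liftD(3)[OF assms \<theta>] liftD(3)[OF assms \<theta>'] less by simp
    qed
  qed
qed

text \<open>
  A lift of the inverse data is a right inverse, again because lifts are determined by their data.
\<close>
lemma lift_surj:
  assumes "valid r m" "lift r m X"
  shows "surj X"
proof -
  obtain Y where "lift (- r) (\<lambda>j. - m (j - r)) Y"
    using lift_exists valid_inverse[OF assms(1)] by blast
  then have "lift 0 (\<lambda>_. 0) (X \<circ> Y)"
    using lift_comp[OF assms(2)] by fastforce
  then have "X \<circ> Y = id"
    using lift_unique lift_id by blast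
  then show ?thesis
    by (metis comp_eq_dest_lhs id_apply surjI)
qed

text \<open>
  A monotone map of the line onto itself cannot jump. This gives continuity at the singular angles,
  where the phase may be unbounded.
\<close>
lemma lift_cont:
  assumes "valid r m" "lift r m X"
  shows "continuous_on UNIV X"
  using lift_surj[OF assms] lift_strict_mono[OF assms(2)]
  by (intro continuous_onI_mono) (auto simp: strict_mono_less_eq)

definition represents :: "int \<Rightarrow> (int \<Rightarrow> int) \<Rightarrow> (complex \<Rightarrow> complex) \<Rightarrow> bool" where
  "represents r m x \<longleftrightarrow> valid r m \<and> x \<in> extensional unit_circle \<and>
     (\<exists>X. lift r m X \<and> (\<forall>\<theta>. x (cis \<theta>) = cis (X \<theta>)))"

lemma unit_circle_eq_cis: "z \<in> unit_circle \<longleftrightarrow> (\<exists>\<theta>. z = cis \<theta>)"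
proof
  assume "z \<in> unit_circle"
  then show "\<exists>\<theta>. z = cis \<theta>"
    using unit_circle_cis_obtain[of z 0] by blast
qed auto

lemma represents_unique:
  assumes "represents r m x" "represents r m y"
  shows "x = y"
proof (rule extensionalityI[of _ unit_circle])
  fix z assume "z \<in> unit_circle"
  then obtain \<theta> where "z = cis \<theta>"
    using unit_circle_eq_cis by blast
  then show "x z = y z"
    using assms lift_unique unfolding represents_def by metis
qed (use assms in \<open>auto simp: represents_def\<close>)

lemma represents_exists:
  assumes "valid r m"
  shows "\<exists>x. represents r m x"
proof -
  obtain X where X: "lift r m X"
    using lift_exists[OF assms] by blast
  define x where "x = (\<lambda>z\<in>unit_circle. cis (X (Arg z)))"
  have "x (cis \<theta>) = cis (X \<theta>)" for \<theta>
  proof -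
    have "cis (Arg (cis \<theta>)) = cis \<theta>"
      using cis_Arg[of "cis \<theta>"] by (simp add: sgn_eq)
    then obtain q :: int where "Arg (cis \<theta>) = \<theta> + 2 * pi * of_int q"
      using cis_eq_cis_iff by blast
    then have "X (Arg (cis \<theta>)) = X \<theta> + 2 * pi * of_int q"
      using lift_shift[OF assms X] by simp
    then have "cis (X (Arg (cis \<theta>))) = cis (X \<theta>)"
      using cis_eq_cis_iff by blast
    then show ?thesis
      by (simp add: x_def)
  qed
  then show ?thesis
    using assms X unfolding represents_def x_def by (metis restrict_extensional)
qed

lemma represents_comp:
  assumes "represents r m x" "represents r' m' y"
  shows "represents (r + r') (\<lambda>j. m' j + m (j + r')) (compose unit_circle x y)"
proof -
  obtain X Y where XY: "lift r m X" "\<And>\<theta>. x (cis \<theta>) = cis (X \<theta>)" "lift r' m' Y" "\<And>\<theta>. y (cis \<theta>) = cis (Y \<theta>)"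
    using assms unfolding represents_def by blast
  have "compose unit_circle x y (cis \<theta>) = cis ((X \<circ> Y) \<theta>)" for \<theta>
    by (simp add: compose_def XY)
  then show ?thesis
    using valid_comp lift_comp[OF XY(1,3)] assms compose_extensional
    unfolding represents_def by blast
qed

lemma represents_id: "represents 0 (\<lambda>_. 0) (\<lambda>z\<in>unit_circle. z)"
  unfolding represents_def using valid_id lift_id by (auto intro!: exI[of _ id])

lemma represents_shift:
  assumes "represents r m x"
  shows "represents (r + q * int n) m x"
proof -
  obtain X where X: "lift r m X" "\<And>\<theta>. x (cis \<theta>) = cis (X \<theta>)" and v: "valid r m"
    using assms unfolding represents_def by blast
  have phases: "phases (j + (r + q * int n)) = phases (j + r)" for j
    using phases_shift[of "j + r" q] by (simp add: add.assoc)
  then have "valid (r + q * int n) m"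
    using v unfolding valid_def by simp
  moreover have "lift (r + q * int n) m (\<lambda>\<theta>. X \<theta> + 2 * pi * of_int q)"
    unfolding lift_def
  proof (intro allI conjI ballI)
    fix j
    have r: "j + (r + q * int n) = (j + r) + q * int n"
      by simp
    show "X (T j) + 2 * pi * of_int q = T (j + (r + q * int n))"
      unfolding r T_shift by (simp add: liftD(1)[OF X(1)])
    fix \<theta> assume \<theta>: "\<theta> \<in> arc j"
    show "X \<theta> + 2 * pi * of_int q \<in> arc (j + (r + q * int n))"
      unfolding r arc_shift by (rule liftD(2)[OF X(1) \<theta>])
    show "\<Phi> (X \<theta> + 2 * pi * of_int q) = \<Phi> \<theta> + 2 * pi * of_int (m j)"
      unfolding \<Phi>_shift by (rule liftD(3)[OF X(1) \<theta>])
  qed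
  moreover have "cis (X \<theta> + 2 * pi * of_int q) = cis (X \<theta>)" for \<theta>
    using cis_eq_cis_iff by blast
  ultimately show ?thesis
    using assms X unfolding represents_def by metis
qed

text \<open>
  Two lifts of one map differ by full turns, which leave the phase unchanged and move the index by a
  multiple of \<open>n\<close>.
\<close>
lemma represents_eq_iff:
  assumes "represents r m x" "represents r' m' x"
  shows "(\<exists>q. r' = r + q * int n) \<and> m' = m"
proof -
  obtain X Y where XY: "lift r m X" "\<And>\<theta>. x (cis \<theta>) = cis (X \<theta>)" "lift r' m' Y" "\<And>\<theta>. x (cis \<theta>) = cis (Y \<theta>)"
    using assms unfolding represents_def by blast
  have shift: "\<exists>q. Y \<theta> = X \<theta> + 2 * pi * of_int q" for \<theta>
    using XY(2,4) cis_eq_cis_iff by metis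
  obtain q where "Y (T 0) = X (T 0) + 2 * pi * of_int q"
    using shift by blast
  then have "T r' = T (r + q * int n)"
    using liftD(1)[OF XY(1), of 0] liftD(1)[OF XY(3), of 0] T_shift[of r q] by simp
  moreover have "m' j = m j" for j
  proof -
    define \<theta> where "\<theta> = (T j + T (j + 1)) / 2"
    have \<theta>: "\<theta> \<in> arc j"
      unfolding \<theta>_def by (rule arc_midpoint)
    obtain q where "Y \<theta> = X \<theta> + 2 * pi * of_int q"
      using shift by blast
    then have "\<Phi> (Y \<theta>) = \<Phi> (X \<theta>)"
      by (simp add: \<Phi>_shift)
    then show ?thesis
      using liftD(3)[OF XY(1) \<theta>] liftD(3)[OF XY(3) \<theta>] by simp
  qed
  ultimately show ?thesis
    by auto
qed

text \<open>
  Near \<open>cis \<theta>\<close> the invariant is \<open>w \<mapsto> cis (X (\<theta> + Arg (w / cis \<theta>)))\<close>, and \<open>Arg\<close> is continuous at 1; so \<open>x\<close>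
  inherits continuity from the lift. The other conditions are read off from the behaviour of the lift
  on vertices and arcs.
\<close>
lemma represents_carrier:
  assumes "represents r m x"
  shows "x \<in> carrier (invariant_group B)"
proof -
  obtain X where X: "lift r m X" "\<And>\<theta>. x (cis \<theta>) = cis (X \<theta>)" and v: "valid r m"
    using assms unfolding represents_def by blast
  have inner: "X \<theta> \<notin> range T \<and> (\<exists>k::int. \<Phi> (X \<theta>) = \<Phi> \<theta> + 2 * pi * of_int k)"
    if "\<theta> \<notin> range T" for \<theta>
    using liftD(2,3)[OF X(1) not_range_arc[OF that]] arc_disjoint_range by blast
  have "continuous_on unit_circle x"
    unfolding continuous_on_eq_continuous_within
  proof
    fix z assume "z \<in> unit_circle"
    then obtain \<theta> where z: "z = cis \<theta>"
      using unit_circle_eq_cis by blast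
    have "isCont X \<theta>"
      using lift_cont[OF v X(1)] by (simp add: continuous_on_eq_continuous_at)
    have "(Arg \<longlongrightarrow> Arg 1) (at 1)"
      using continuous_at_Arg[of 1] by (simp add: isCont_def)
    then have "isCont Arg 1"
      by (simp add: isCont_def)
    have "((\<lambda>w. w / cis \<theta>) \<longlongrightarrow> 1) (at z)"
      unfolding z by (rule tendsto_eq_intros refl | simp)+
    then have "((\<lambda>w. Arg (w / cis \<theta>)) \<longlongrightarrow> Arg 1) (at z)"
      by (rule isCont_tendsto_compose[OF \<open>isCont Arg 1\<close>])
    then have "((\<lambda>w. \<theta> + Arg (w / cis \<theta>)) \<longlongrightarrow> \<theta> + Arg 1) (at z)"
      by (rule tendsto_add[OF tendsto_const])
    then have "((\<lambda>w. \<theta> + Arg (w / cis \<theta>)) \<longlongrightarrow> \<theta>) (at z)"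
      by simp
    then have "((\<lambda>w. X (\<theta> + Arg (w / cis \<theta>))) \<longlongrightarrow> X \<theta>) (at z)"
      by (rule isCont_tendsto_compose[OF \<open>isCont X \<theta>\<close>])
    then have "((\<lambda>w. cis (X (\<theta> + Arg (w / cis \<theta>)))) \<longlongrightarrow> cis (X \<theta>)) (at z)"
      by (rule tendsto_cis)
    then have lim: "((\<lambda>w. cis (X (\<theta> + Arg (w / cis \<theta>)))) \<longlongrightarrow> x z) (at z within unit_circle)"
      using X(2)[of \<theta>] z tendsto_within_subset by force
    have "cis (X (\<theta> + Arg (w / cis \<theta>))) = x w" if "w \<in> unit_circle" for w
    proof -
      have "cis (Arg (w / cis \<theta>)) = w / cis \<theta>"
        using that cis_Arg[of "w / cis \<theta>"] by (cases "w = 0") (auto simp: sgn_eq norm_divide)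
      then have "cis (\<theta> + Arg (w / cis \<theta>)) = w"
        by (simp add: cis_mult[symmetric])
      then show ?thesis
        using X(2) by metis
    qed
    then have "\<forall>\<^sub>F w in at z within unit_circle. cis (X (\<theta> + Arg (w / cis \<theta>))) = x w"
      by (auto simp: eventually_at_filter)
    then show "continuous (at z within unit_circle) x"
      unfolding continuous_within using lim Lim_transform_eventually by blast
  qed
  moreover have "x \<in> unit_circle \<rightarrow>\<^sub>E unit_circle"
  proof (rule PiE_I)
    fix z assume "z \<in> unit_circle"
    then obtain \<theta> where "z = cis \<theta>"
      using unit_circle_eq_cis by blast
    then show "x z \<in> unit_circle"
      using X(2) by simp
  next
    fix z assume "z \<notin> unit_circle"
    then show "x z = undefined"
      using assms unfolding represents_def extensional_def by blast
  qed
  moreover have "x z \<in> spectrum B" if z: "z \<in> spectrum B" for z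
  proof -
    obtain j where "z = cis (T j)"
      using z unfolding spectrum_eq by blast
    then have "x z = cis (T (j + r))"
      using X(2) liftD(1)[OF X(1)] by simp
    then show ?thesis
      unfolding spectrum_eq by blast
  qed
  moreover have "x z \<in> unit_circle - spectrum B \<and> bdry B (x z) = bdry B z"
    if z: "z \<in> unit_circle - spectrum B" for z
  proof -
    obtain \<theta> where \<theta>: "z = cis \<theta>"
      using unit_circle_eq_cis z by blast
    then have nr: "\<theta> \<notin> range T"
      using z cis_T_eq_iff unfolding spectrum_eq by blast
    obtain k :: int where k: "X \<theta> \<notin> range T" "\<Phi> (X \<theta>) = \<Phi> \<theta> + 2 * pi * of_int k"
      using inner[OF nr] by blast
    then have "cis (\<Phi> (X \<theta>)) = cis (\<Phi> \<theta>)"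
      using cis_eq_cis_iff by blast
    then have "bdry B (x z) = bdry B z"
      using bdry_phase[OF nr] bdry_phase[OF k(1)] X(2) \<theta> by simp
    moreover have "x z \<notin> spectrum B"
      using k(1) X(2) \<theta> cis_T_eq_iff unfolding spectrum_eq by metis
    ultimately show ?thesis
      using X(2) \<theta> by simp
  qed
  ultimately show ?thesis
    unfolding invariant_group_def by simp
qed

text \<open>
  Lift \<open>x \<circ> cis\<close> through a continuous logarithm. The lift \<open>X\<close> maps singular angles to singular angles and
  others to others, so by the intermediate value theorem it keeps each arc inside one arc, on which the phase
  is increased by a constant in \<open>2\<pi>\<int>\<close>. So \<open>X\<close> increases there, and its values at the two ends, being singular
  angles between which the whole image lies, are the ends of the target arc. Adjacent arcs share an end,
  so their images are adjacent, which makes the displacement \<open>r\<close> of indices constant.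
\<close>
lemma carrier_represents:
  assumes "x \<in> carrier (invariant_group B)"
  shows "\<exists>r m. represents r m x"
proof -
  have x: "x \<in> unit_circle \<rightarrow>\<^sub>E unit_circle" "continuous_on unit_circle x"
    "\<And>z. z \<in> spectrum B \<Longrightarrow> x z \<in> spectrum B"
    "\<And>z. z \<in> unit_circle - spectrum B \<Longrightarrow> x z \<in> unit_circle - spectrum B"
    "\<And>z. z \<in> unit_circle - spectrum B \<Longrightarrow> bdry B (x z) = bdry B z"
    using assms unfolding invariant_group_def by simp_all
  have norm_x: "norm (x (cis \<theta>)) = 1" for \<theta>
    using x(1) by (auto simp: PiE_iff Pi_iff)
  have x_cont: "continuous_on UNIV (\<lambda>\<theta>. x (cis \<theta>))"
    by (intro continuous_on_compose2[OF x(2)] continuous_intros) auto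
  have contr: "contractible (UNIV :: real set)"
    by (intro convex_imp_contractible) auto
  have "x (cis \<theta>) \<noteq> 0" for \<theta>
    using norm_x[of \<theta>] by auto
  then obtain L where L: "continuous_on UNIV L" "\<And>\<theta>. x (cis \<theta>) = exp (L \<theta>)"
    using continuous_logarithm_on_contractible[OF x_cont contr] by (metis UNIV_I)
  define X where "X \<theta> = Im (L \<theta>)" for \<theta>
  have X: "x (cis \<theta>) = cis (X \<theta>)" for \<theta>
  proof -
    have "exp (Re (L \<theta>)) = 1"
      using norm_x[of \<theta>] L(2)[of \<theta>] by simp
    then show ?thesis
      using L(2)[of \<theta>] by (simp add: exp_eq_polar X_def)
  qed
  have cont: "continuous_on A X" for A
    unfolding X_def by (intro continuous_intros continuous_on_subset[OF L(1)]) auto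
  have vertex: "X (T j) \<in> range T" for j
    using x(3)[of "cis (T j)"] X[of "T j"] cis_T_eq_iff[of "X (T j)"] unfolding spectrum_eq by auto
  have inner: "X \<theta> \<notin> range T \<and> cis (\<Phi> (X \<theta>)) = cis (\<Phi> \<theta>)" if "\<theta> \<notin> range T" for \<theta>
  proof -
    have z: "cis \<theta> \<in> unit_circle - spectrum B"
      using that cis_T_eq_iff[of \<theta>] unfolding spectrum_eq by auto
    have nr: "X \<theta> \<notin> range T"
      using x(4)[OF z] X[of \<theta>] cis_T_eq_iff[of "X \<theta>"] unfolding spectrum_eq by auto
    then show ?thesis
      using x(5)[OF z] X[of \<theta>] bdry_phase[OF nr] bdry_phase[OF that] by simp
  qed
  have arcwise: "\<exists>i (m::int). (\<forall>\<theta>\<in>arc j. X \<theta> \<in> arc i \<and> \<Phi> (X \<theta>) = \<Phi> \<theta> + 2 * pi * of_int m) \<and>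
      X (T j) = T i \<and> X (T (j + 1)) = T (i + 1)" for j
  proof -
    define \<theta>0 where "\<theta>0 = (T j + T (j + 1)) / 2"
    have \<theta>0: "\<theta>0 \<in> arc j"
      unfolding \<theta>0_def by (rule arc_midpoint)
    define i where "i = index (X \<theta>0)"
    have i: "X \<theta>0 \<in> arc i"
      using inner[of \<theta>0] not_range_arc arc_disjoint_range[OF \<theta>0] by (simp add: i_def)
    have "connected (X ` arc j)"
      by (rule connected_continuous_image[OF cont connected_Ioo])
    then have intv: "is_interval (X ` arc j)"
      by (simp only: is_interval_connected_1)
    have im: "X \<theta> \<in> arc i" if \<theta>: "\<theta> \<in> arc j" for \<theta>
    proof (rule ccontr)
      assume "X \<theta> \<notin> arc i"
      then have "X \<theta> \<le> T i \<or> T (i + 1) \<le> X \<theta>"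
        by auto
      then have "T i \<in> X ` arc j \<or> T (i + 1) \<in> X ` arc j"
      proof
        assume "X \<theta> \<le> T i"
        moreover have "T i \<le> X \<theta>0"
          using i by simp
        ultimately show ?thesis
          using mem_is_interval_1_I[OF intv] \<theta> \<theta>0 by blast
      next
        assume "T (i + 1) \<le> X \<theta>"
        moreover have "X \<theta>0 \<le> T (i + 1)"
          using i by simp
        ultimately show ?thesis
          using mem_is_interval_1_I[OF intv] \<theta> \<theta>0 by blast
      qed
      moreover have "T k \<notin> X ` arc j" for k
      proof
        assume "T k \<in> X ` arc j"
        then obtain \<theta>' where "\<theta>' \<in> arc j" "T k = X \<theta>'"
          by (rule imageE)
        then show False
          using inner[OF arc_disjoint_range[of \<theta>' j]] by (metis rangeI)
      qed
      ultimately show False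
        by (metis (no_types))
    qed
    have D: "continuous_on (arc j) (\<lambda>\<theta>. \<Phi> (X \<theta>) - \<Phi> \<theta>)"
    proof (rule continuous_on_diff[OF continuous_on_compose2[OF \<Phi>_cont[of i] cont] \<Phi>_cont])
      show "X ` arc j \<subseteq> arc i"
        using im by (rule image_subsetI)
    qed
    have "cis (\<Phi> (X \<theta>) - \<Phi> \<theta>) = 1" if "\<theta> \<in> arc j" for \<theta>
      using inner[OF arc_disjoint_range[OF that]] by (simp add: cis_divide[symmetric])
    from connected_cis_eq_1_imp_const[OF connected_Ioo D this] obtain m :: int
      where m: "\<And>\<theta>. \<theta> \<in> arc j \<Longrightarrow> \<Phi> (X \<theta>) - \<Phi> \<theta> = 2 * pi * of_int m"
      by blast
    have mono: "X \<theta> < X \<theta>'" if "\<theta> \<in> arc j" "\<theta>' \<in> arc j" "\<theta> < \<theta>'" for \<theta> \<theta>'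
      using \<Phi>_less[OF im im, of \<theta> \<theta>'] \<Phi>_less[of \<theta> j \<theta>'] m[of \<theta>] m[of \<theta>'] that by simp
    have cl: "T j \<in> closure {T j<..<\<theta>0}" "T (j + 1) \<in> closure {\<theta>0<..<T (j + 1)}"
      using \<theta>0 by auto
    have left_half: "T i \<le> X \<theta>" "X \<theta> \<le> X \<theta>0" if "\<theta> \<in> {T j<..<\<theta>0}" for \<theta>
    proof -
      have \<theta>: "\<theta> \<in> arc j" "\<theta> < \<theta>0"
        using that \<theta>0 by auto
      show "T i \<le> X \<theta>" "X \<theta> \<le> X \<theta>0"
        using im[OF \<theta>(1)] mono[OF \<theta>(1) \<theta>0 \<theta>(2)] by simp_all
    qed
    have right_half: "X \<theta> \<le> T (i + 1)" "X \<theta>0 \<le> X \<theta>" if "\<theta> \<in> {\<theta>0<..<T (j + 1)}" for \<theta>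
    proof -
      have \<theta>: "\<theta> \<in> arc j" "\<theta>0 < \<theta>"
        using that \<theta>0 by auto
      show "X \<theta> \<le> T (i + 1)" "X \<theta>0 \<le> X \<theta>"
        using im[OF \<theta>(1)] mono[OF \<theta>0 \<theta>(1) \<theta>(2)] by simp_all
    qed
    have "T i \<le> X (T j)"
      using left_half(1) by (rule continuous_ge_on_closure[OF cont cl(1)])
    moreover have "X (T j) \<le> X \<theta>0"
      using left_half(2) by (rule continuous_le_on_closure[OF cont cl(1)])
    moreover obtain i' where "X (T j) = T i'"
      using vertex by blast
    ultimately have i': "T i \<le> T i'" "T i' \<le> X \<theta>0" "X (T j) = T i'"
      by simp_all
    have "X \<theta>0 < T (i + 1)"
      using i by simp
    with i'(2) have "T i' < T (i + 1)"
      by (rule le_less_trans)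
    then have left: "X (T j) = T i"
      using i' by simp
    have "X (T (j + 1)) \<le> T (i + 1)"
      using right_half(1) by (rule continuous_le_on_closure[OF cont cl(2)])
    moreover have "X \<theta>0 \<le> X (T (j + 1))"
      using right_half(2) by (rule continuous_ge_on_closure[OF cont cl(2)])
    moreover obtain i'' where "X (T (j + 1)) = T i''"
      using vertex by blast
    ultimately have i'': "T i'' \<le> T (i + 1)" "X \<theta>0 \<le> T i''" "X (T (j + 1)) = T i''"
      by simp_all
    have "T i < X \<theta>0"
      using i by simp
    then have "T i < T i''"
      using i''(2) by (rule less_le_trans)
    then have "i'' = i + 1"
      using i''(1) by simp
    then have right: "X (T (j + 1)) = T (i + 1)"
      using \<open>X (T (j + 1)) = T i''\<close> by simp
    have "\<forall>\<theta>\<in>arc j. X \<theta> \<in> arc i \<and> \<Phi> (X \<theta>) = \<Phi> \<theta> + 2 * pi * of_int m"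
      using im m by (auto simp: algebra_simps)
    then show ?thesis
      using left right by blast
  qed
  define P where "P j i m \<longleftrightarrow> (\<forall>\<theta>\<in>arc j. X \<theta> \<in> arc i \<and> \<Phi> (X \<theta>) = \<Phi> \<theta> + 2 * pi * of_int m) \<and>
      X (T j) = T i \<and> X (T (j + 1)) = T (i + 1)" for j i and m :: int
  have "\<exists>\<iota> m. \<forall>j. P j (\<iota> j) (m j)"
    using arcwise unfolding P_def[symmetric] by metis
  then obtain \<iota> m where \<iota>: "\<And>j \<theta>. \<theta> \<in> arc j \<Longrightarrow> X \<theta> \<in> arc (\<iota> j)"
      "\<And>j \<theta>. \<theta> \<in> arc j \<Longrightarrow> \<Phi> (X \<theta>) = \<Phi> \<theta> + 2 * pi * real_of_int (m j)"
      "\<And>j. X (T j) = T (\<iota> j)" "\<And>j. X (T (j + 1)) = T (\<iota> j + 1)"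
    unfolding P_def by blast
  have step: "\<iota> (j + 1) = \<iota> j + 1" for j
    using \<iota>(3)[of "j + 1"] \<iota>(4)[of j] by simp
  define r where "r = \<iota> 0"
  have r: "\<iota> j = j + r" for j
  proof (induction j rule: int_induct[where k = 0])
    case (step2 i)
    then show ?case
      using step[of "i - 1"] by simp
  qed (simp_all add: r_def step)
  have lift: "lift r m X"
    unfolding lift_def using \<iota> by (simp add: r)
  have "valid r m"
    unfolding valid_def
  proof (intro conjI allI)
    fix j
    define \<theta> where "\<theta> = (T j + T (j + 1)) / 2"
    have \<theta>: "\<theta> \<in> arc j"
      unfolding \<theta>_def by (rule arc_midpoint)
    then have \<theta>': "\<theta> + 2 * pi * of_int 1 \<in> arc (j + 1 * int n)"
      using arc_shift by blast
    have "cis (X (\<theta> + 2 * pi * of_int 1)) = cis (X \<theta>)"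
      using X cis_eq_cis_iff by metis
    then obtain q :: int where "X (\<theta> + 2 * pi * of_int 1) = X \<theta> + 2 * pi * of_int q"
      using cis_eq_cis_iff by blast
    then have "\<Phi> (X (\<theta> + 2 * pi * of_int 1)) = \<Phi> (X \<theta>)"
      by (simp only: \<Phi>_shift)
    then show "m (j + int n) = m j"
      using liftD(3)[OF lift \<theta>] liftD(3)[OF lift \<theta>'] \<Phi>_shift[of \<theta> 1] by simp
  next
    fix j
    have "arc (j + r) \<subseteq> X ` arc j"
    proof
      fix y assume y: "y \<in> arc (j + r)"
      have "\<exists>\<theta>\<ge>T j. \<theta> \<le> T (j + 1) \<and> X \<theta> = y"
      proof (rule IVT')
        show "X (T j) \<le> y" "y \<le> X (T (j + 1))"
          using y liftD(1)[OF lift] by (auto simp: algebra_simps)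
      qed (use cont in auto)
      then obtain \<theta> where \<theta>: "T j \<le> \<theta>" "\<theta> \<le> T (j + 1)" "X \<theta> = y"
        by blast
      moreover have "\<theta> \<noteq> T j" "\<theta> \<noteq> T (j + 1)"
        using vertex \<theta>(3) arc_disjoint_range[OF y] by metis+
      ultimately show "y \<in> X ` arc j"
        by force
    qed
    then have "X ` arc j = arc (j + r)"
      using liftD(2)[OF lift] by blast
    then have "phases (j + r) = \<Phi> ` X ` arc j"
      by (simp add: phases_def)
    also have "\<dots> = (\<lambda>y. y + 2 * pi * of_int (m j)) ` phases j"
      unfolding phases_def image_image using liftD(3)[OF lift] by (intro image_cong) auto
    finally show "phases (j + r) = (\<lambda>y. y + 2 * pi * of_int (m j)) ` phases j" .
  qed
  then show ?thesis
    using lift X x(1) unfolding represents_def PiE_def by blast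
qed

end

section \<open>Types of arcs and translations of phase intervals\<close>

text \<open>
  Both ends of such an interval are open, so it is determined by which of the two bounds exist
  and by their values.
\<close>
lemma interval_without_extrema:
  fixes S :: "real set"
  assumes "is_interval S" "S \<noteq> {}" "\<And>y. y \<in> S \<Longrightarrow> \<exists>y'\<in>S. y' < y" "\<And>y. y \<in> S \<Longrightarrow> \<exists>y'\<in>S. y < y'"
  shows "y \<in> S \<longleftrightarrow> (bdd_below S \<longrightarrow> Inf S < y) \<and> (bdd_above S \<longrightarrow> y < Sup S)"
proof
  assume y: "y \<in> S"
  then obtain y1 y2 where "y1 \<in> S" "y1 < y" "y2 \<in> S" "y < y2"
    using assms(3,4) by blast
  then show "(bdd_below S \<longrightarrow> Inf S < y) \<and> (bdd_above S \<longrightarrow> y < Sup S)"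
    by (meson cInf_lower cSup_upper le_less_trans less_le_trans)
next
  assume *: "(bdd_below S \<longrightarrow> Inf S < y) \<and> (bdd_above S \<longrightarrow> y < Sup S)"
  have "\<exists>y1\<in>S. y1 \<le> y"
    using * cInf_lessD[OF assms(2), of y] unfolding bdd_below_def by (metis le_cases less_imp_le)
  moreover have "\<exists>y2\<in>S. y \<le> y2"
    using * less_cSupD[OF assms(2), of y] unfolding bdd_above_def by (metis le_cases less_imp_le)
  ultimately show "y \<in> S"
    using mem_is_interval_1_I[OF assms(1)] by blast
qed

lemma translate_bounds:
  fixes S :: "real set" and c :: real
  shows "bdd_above ((\<lambda>y. y + c) ` S) \<longleftrightarrow> bdd_above S"
    and "bdd_below ((\<lambda>y. y + c) ` S) \<longleftrightarrow> bdd_below S"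
proof -
  have *: "bdd_above ((\<lambda>y. y + c) ` S)" if "bdd_above S" for S :: "real set" and c
    using that unfolding bdd_above_def by (metis add_right_mono imageE)
  have **: "bdd_below ((\<lambda>y. y + c) ` S)" if "bdd_below S" for S :: "real set" and c
    using that unfolding bdd_below_def by (metis add_right_mono imageE)
  have inv: "(\<lambda>y. y + - c) ` (\<lambda>y. y + c) ` S = S"
    by (simp add: image_image)
  show "bdd_above ((\<lambda>y. y + c) ` S) \<longleftrightarrow> bdd_above S"
    using *[of S c] *[of "(\<lambda>y. y + c) ` S" "- c"] inv by auto
  show "bdd_below ((\<lambda>y. y + c) ` S) \<longleftrightarrow> bdd_below S"
    using **[of S c] **[of "(\<lambda>y. y + c) ` S" "- c"] inv by auto
qed

lemma translate_Sup:
  fixes S :: "real set" and c :: real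
  assumes "bdd_above S" "S \<noteq> {}"
  shows "Sup ((\<lambda>y. y + c) ` S) = Sup S + c"
  using Sup_add_eq[of "\<lambda>y. y" S c] assms by (simp add: add.commute)

lemma translate_Inf:
  fixes S :: "real set" and c :: real
  assumes "bdd_below S" "S \<noteq> {}"
  shows "Inf ((\<lambda>y. y + c) ` S) = Inf S + c"
  using Inf_add_eq[of "\<lambda>y. y" S c] assms by (simp add: add.commute)

text \<open>
  As functions of \<open>s\<close>, ceilings are continuous from the left and floors are not. So the difference drops, on
  arrival at \<open>s\<close> from the left, exactly where \<open>a + s\<close> is an integer. So \<open>a' - a\<close>
  is an integer, and evaluation at \<open>- b\<close> and \<open>- b'\<close> gives \<open>b' - b\<close> the same value.
\<close>
lemma ceiling_minus_floor_determines_interval: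
  fixes a b a' b' :: real
  assumes eq: "\<And>s. \<lceil>b + s\<rceil> - \<lfloor>a + s\<rfloor> = \<lceil>b' + s\<rceil> - \<lfloor>a' + s\<rfloor>"
  shows "\<exists>m::int. a' = a + of_int m \<and> b' = b + of_int m"
proof -
  define p where "p = \<lfloor>a' - a\<rfloor>"
  have "a' - a = of_int p"
  proof (rule ccontr)
    assume ne: "a' - a \<noteq> of_int p"
    \<comment> \<open>The step \<open>e\<close> is so small that only \<open>\<lfloor>a + s\<rfloor>\<close> changes when \<open>s\<close> moves from \<open>- a\<close> to \<open>- a - e\<close>.\<close>
    define e where "e = Min {b - a - of_int (\<lceil>b - a\<rceil> - 1), b' - a - of_int (\<lceil>b' - a\<rceil> - 1),
      a' - a - of_int p, 1} / 2"
    have "of_int p < a' - a"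
      using ne unfolding p_def by linarith
    then have "e > 0"
      unfolding e_def by (simp add: ceiling_correct)
    have "e \<le> (b - a - of_int (\<lceil>b - a\<rceil> - 1)) / 2" "e \<le> (b' - a - of_int (\<lceil>b' - a\<rceil> - 1)) / 2"
      "e \<le> (a' - a - of_int p) / 2" "e \<le> 1 / 2"
      unfolding e_def by simp_all
    moreover have half: "e < x" if "e \<le> x / 2" for x
      using that \<open>e > 0\<close> by simp
    ultimately have e: "e < b - a - of_int (\<lceil>b - a\<rceil> - 1)" "e < b' - a - of_int (\<lceil>b' - a\<rceil> - 1)"
      "e < a' - a - of_int p" "e < 1"
      by (simp_all only: half)
    have "\<lceil>b + (- a - e)\<rceil> = \<lceil>b - a\<rceil>" "\<lceil>b' + (- a - e)\<rceil> = \<lceil>b' - a\<rceil>" "\<lfloor>a + (- a - e)\<rfloor> = - 1"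
      "\<lfloor>a' + (- a - e)\<rfloor> = p"
      using e \<open>e > 0\<close> unfolding p_def by linarith+
    then show False
      using eq[of "- a"] eq[of "- a - e"] by (simp add: p_def)
  qed
  then have a': "a' = a + of_int p"
    by simp
  have "\<lfloor>a' + s\<rfloor> = \<lfloor>a + s\<rfloor> + p" for s
    unfolding a' by linarith
  then have "\<lceil>b' + s\<rceil> = \<lceil>b + s\<rceil> + p" for s
    using eq[of s] by simp
  from this[of "- b"] this[of "- b'"] have "b' = b + of_int p"
    by simp linarith
  then show ?thesis
    using a' by blast
qed

text \<open>
  After scaling by \<open>2\<pi>\<close>, the number of lattice points in the interval is a ceiling minus a floor minus 1.
\<close>
lemma lattice_count_determines_interval:
  fixes a b a' b' :: real
  assumes "a < b" "a' < b'"
    and eq: "\<And>l. card {k::int. a < l + 2 * pi * of_int k \<and> l + 2 * pi * of_int k < b} =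
                  card {k::int. a' < l + 2 * pi * of_int k \<and> l + 2 * pi * of_int k < b'}"
  shows "\<exists>m::int. a' = a + 2 * pi * of_int m \<and> b' = b + 2 * pi * of_int m"
proof -
  have count: "int (card {k::int. a < - 2 * pi * s + 2 * pi * of_int k \<and> - 2 * pi * s + 2 * pi * of_int k < b}) =
      \<lceil>b / (2 * pi) + s\<rceil> - \<lfloor>a / (2 * pi) + s\<rfloor> - 1" if "a < b" for a b s :: real
  proof -
    have "{k::int. a < - 2 * pi * s + 2 * pi * of_int k \<and> - 2 * pi * s + 2 * pi * of_int k < b} =
        {k. a / (2 * pi) + s < of_int k \<and> of_int k < b / (2 * pi) + s}"
      by (simp add: field_simps)
    also have "\<dots> = {\<lfloor>a / (2 * pi) + s\<rfloor> + 1..\<lceil>b / (2 * pi) + s\<rceil> - 1}"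
      by auto linarith+
    finally have "card {k::int. a < - 2 * pi * s + 2 * pi * of_int k \<and> - 2 * pi * s + 2 * pi * of_int k < b} =
        nat (\<lceil>b / (2 * pi) + s\<rceil> - \<lfloor>a / (2 * pi) + s\<rfloor> - 1)"
      by simp
    moreover have "a / (2 * pi) + s < b / (2 * pi) + s"
      using that by (simp add: divide_strict_right_mono)
    then have "\<lfloor>a / (2 * pi) + s\<rfloor> + 1 \<le> \<lceil>b / (2 * pi) + s\<rceil>"
      by linarith
    ultimately show ?thesis
      by simp
  qed
  have "\<lceil>b / (2 * pi) + s\<rceil> - \<lfloor>a / (2 * pi) + s\<rfloor> = \<lceil>b' / (2 * pi) + s\<rceil> - \<lfloor>a' / (2 * pi) + s\<rfloor>" for s
    using count[OF assms(1), of s] count[OF assms(2), of s] eq[of "- 2 * pi * s"] by linarith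
  then obtain m :: int where "a' / (2 * pi) = a / (2 * pi) + of_int m" "b' / (2 * pi) = b / (2 * pi) + of_int m"
    using ceiling_minus_floor_determines_interval by blast
  then have "a' = a + 2 * pi * of_int m \<and> b' = b + 2 * pi * of_int m"
    by (simp add: field_simps)
  then show ?thesis ..
qed

context circle_phase begin

lemma phases_nonempty: "phases j \<noteq> {}"
  using arc_midpoint unfolding phases_def by blast

lemma phases_interval: "is_interval (phases j)"
proof -
  have "connected (phases j)"
    unfolding phases_def by (rule connected_continuous_image[OF \<Phi>_cont connected_Ioo])
  then show ?thesis
    by (simp only: is_interval_connected_1)
qed

lemma phases_mem_iff: "y \<in> phases j \<longleftrightarrow> (bdd_below (phases j) \<longrightarrow> Inf (phases j) < y) \<and> (bdd_above (phases j) \<longrightarrow> y < Sup (phases j))"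
proof (rule interval_without_extrema[OF phases_interval phases_nonempty])
  fix y assume "y \<in> phases j"
  then obtain \<theta> where \<theta>: "\<theta> \<in> arc j" "y = \<Phi> \<theta>"
    unfolding phases_def by blast
  have *: "(T j + \<theta>) / 2 \<in> arc j" "(T j + \<theta>) / 2 < \<theta>" "(T (j + 1) + \<theta>) / 2 \<in> arc j" "\<theta> < (T (j + 1) + \<theta>) / 2"
    using \<theta>(1) by auto
  have "\<Phi> ((T j + \<theta>) / 2) < y" and "y < \<Phi> ((T (j + 1) + \<theta>) / 2)"
    using \<Phi>_less[OF *(1) \<theta>(1)] \<Phi>_less[OF \<theta>(1) *(3)] * \<theta>(2) by simp_all
  then show "\<exists>y'\<in>phases j. y' < y" "\<exists>y'\<in>phases j. y < y'"
    unfolding phases_def using imageI[OF *(1)] imageI[OF *(3)] by (metis (no_types))+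
qed

lemma phases_less_Sup: "bdd_above (phases j) \<Longrightarrow> y \<in> phases j \<Longrightarrow> y < Sup (phases j)"
  and phases_greater_Inf: "bdd_below (phases j) \<Longrightarrow> y \<in> phases j \<Longrightarrow> Inf (phases j) < y"
  using phases_mem_iff[of y j] by simp_all

lemma bdry_arc: "\<theta> \<in> arc j \<Longrightarrow> bdry B (cis \<theta>) = cis (\<Phi> \<theta>)"
  using bdry_phase arc_disjoint_range by blast

lemma one_angles_eq: "one_angles B (T j) (T (j + 1)) = {\<theta> \<in> arc j. \<exists>k::int. \<Phi> \<theta> = 2 * pi * of_int k}"
  using bdry_arc[of _ j] cis_eq_cis_iff[of _ 0] unfolding one_angles_def by auto

text \<open>
  The solutions of \<open>B = 1\<close> are the points where the phase lies in \<open>2\<pi>\<int>\<close>. On a piece of the arc with bounded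
  phase there are finitely many of them, so they accumulate at an end only if the phase is unbounded there;
  and an unbounded phase passes through infinitely many points of \<open>2\<pi>\<int>\<close>, by the intermediate value theorem.
\<close>
lemma one_angles_limit_point_iff:
  defines "A j \<equiv> one_angles B (T j) (T (j + 1))"
  shows "\<theta> islimpt A j \<longleftrightarrow>
    \<theta> = T j \<and> \<not> bdd_below (phases j) \<or> \<theta> = T (j + 1) \<and> \<not> bdd_above (phases j)"
proof
  assume lim: "\<theta> islimpt A j"
  have bounded_phase: "\<not> (\<forall>\<theta>'\<in>arc j \<inter> U. lo \<le> \<Phi> \<theta>' \<and> \<Phi> \<theta>' \<le> hi)"
    if U: "open U" "\<theta> \<in> U" for U lo hi
  proof
    assume b: "\<forall>\<theta>'\<in>arc j \<inter> U. lo \<le> \<Phi> \<theta>' \<and> \<Phi> \<theta>' \<le> hi"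
    have "\<Phi> ` (A j \<inter> U) \<subseteq> (\<lambda>k. 2 * pi * of_int k) ` {\<lfloor>lo / (2 * pi)\<rfloor>..\<lceil>hi / (2 * pi)\<rceil>}"
    proof (rule image_subsetI)
      fix \<theta>' assume "\<theta>' \<in> A j \<inter> U"
      then have "\<theta>' \<in> arc j \<inter> U" and "\<exists>k::int. \<Phi> \<theta>' = 2 * pi * of_int k"
        unfolding A_def one_angles_eq by auto
      then obtain k :: int where k: "\<Phi> \<theta>' = 2 * pi * of_int k" "lo \<le> \<Phi> \<theta>'" "\<Phi> \<theta>' \<le> hi"
        using b by blast
      then have "lo / (2 * pi) \<le> of_int k" "of_int k \<le> hi / (2 * pi)"
        by (simp_all add: field_simps)
      then have "k \<in> {\<lfloor>lo / (2 * pi)\<rfloor>..\<lceil>hi / (2 * pi)\<rceil>}"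
        by simp linarith
      then show "\<Phi> \<theta>' \<in> (\<lambda>k. 2 * pi * of_int k) ` {\<lfloor>lo / (2 * pi)\<rfloor>..\<lceil>hi / (2 * pi)\<rceil>}"
        using k(1) by blast
    qed
    then have "finite (\<Phi> ` (A j \<inter> U))"
      by (rule finite_subset) simp
    moreover have "inj_on \<Phi> (A j \<inter> U)"
      using \<Phi>_eq[of _ j] unfolding A_def one_angles_eq by (auto intro!: inj_onI)
    ultimately have "finite (A j \<inter> U)"
      by (rule finite_imageD)
    moreover have "\<theta> islimpt A j \<inter> U"
      using lim U by (simp add: islimpt_Int_eventually eventually_at_in_open')
    ultimately show False
      using islimpt_finite by blast
  qed
  have not_left: "\<not> \<theta> < T j"
    using bounded_phase[of "{..<T j}" 0 0] by auto
  have not_right: "\<not> T (j + 1) < \<theta>"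
    using bounded_phase[of "{T (j + 1)<..}" 0 0] by auto
  have not_inner: "\<not> (T j < \<theta> \<and> \<theta> < T (j + 1))"
  proof
    assume \<theta>: "T j < \<theta> \<and> \<theta> < T (j + 1)"
    define \<theta>1 \<theta>2 where "\<theta>1 = (T j + \<theta>) / 2" and "\<theta>2 = (T (j + 1) + \<theta>) / 2"
    have 12: "\<theta>1 \<in> arc j" "\<theta>2 \<in> arc j" "\<theta> \<in> {\<theta>1<..<\<theta>2}"
      using \<theta> by (auto simp: \<theta>1_def \<theta>2_def)
    have "\<forall>\<theta>'\<in>arc j \<inter> {\<theta>1<..<\<theta>2}. \<Phi> \<theta>1 \<le> \<Phi> \<theta>' \<and> \<Phi> \<theta>' \<le> \<Phi> \<theta>2"
      using \<Phi>_less[OF 12(1)] \<Phi>_less[OF _ 12(2)] by (metis Int_iff greaterThanLessThan_iff less_imp_le)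
    then show False
      using bounded_phase[OF open_greaterThanLessThan 12(3)] by metis
  qed
  have "\<not> bdd_below (phases j)" if "\<theta> = T j"
  proof
    assume "bdd_below (phases j)"
    define \<theta>0 where "\<theta>0 = (T j + T (j + 1)) / 2"
    have \<theta>0: "\<theta>0 \<in> arc j"
      unfolding \<theta>0_def by (rule arc_midpoint)
    have "\<forall>\<theta>'\<in>arc j \<inter> {..<\<theta>0}. Inf (phases j) \<le> \<Phi> \<theta>' \<and> \<Phi> \<theta>' \<le> \<Phi> \<theta>0"
      using \<Phi>_less[OF _ \<theta>0] phases_greater_Inf[OF \<open>bdd_below (phases j)\<close>] unfolding phases_def
      by (metis Int_iff imageI lessThan_iff less_imp_le)
    then show False
      using bounded_phase[of "{..<\<theta>0}"] \<theta>0 that by auto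
  qed
  moreover have "\<not> bdd_above (phases j)" if "\<theta> = T (j + 1)"
  proof
    assume "bdd_above (phases j)"
    define \<theta>0 where "\<theta>0 = (T j + T (j + 1)) / 2"
    have \<theta>0: "\<theta>0 \<in> arc j"
      unfolding \<theta>0_def by (rule arc_midpoint)
    have "\<forall>\<theta>'\<in>arc j \<inter> {\<theta>0<..}. \<Phi> \<theta>0 \<le> \<Phi> \<theta>' \<and> \<Phi> \<theta>' \<le> Sup (phases j)"
      using \<Phi>_less[OF \<theta>0] phases_less_Sup[OF \<open>bdd_above (phases j)\<close>] unfolding phases_def
      by (metis Int_iff imageI greaterThan_iff less_imp_le)
    then show False
      using bounded_phase[of "{\<theta>0<..}"] \<theta>0 that by auto
  qed
  moreover have "\<theta> = T j \<or> \<theta> = T (j + 1)"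
    using not_left not_right not_inner by linarith
  ultimately show "\<theta> = T j \<and> \<not> bdd_below (phases j) \<or> \<theta> = T (j + 1) \<and> \<not> bdd_above (phases j)"
    by metis
next
  have in_A: "\<exists>\<theta>'. \<theta>' \<in> A j \<and> \<Phi> \<theta>' = 2 * pi * of_int k"
    if "y \<in> phases j" "y' \<in> phases j" "y \<le> 2 * pi * of_int k" "2 * pi * of_int k \<le> y'" for y y' and k :: int
  proof -
    have "2 * pi * of_int k \<in> phases j"
      by (rule mem_is_interval_1_I[OF phases_interval that])
    then obtain \<theta>' where "\<theta>' \<in> arc j" "2 * pi * of_int k = \<Phi> \<theta>'"
      unfolding phases_def by (rule imageE)
    then show ?thesis
      unfolding A_def one_angles_eq by (intro exI[of _ \<theta>']) (simp, metis)
  qed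
  have A_arc: "A j \<subseteq> arc j"
    unfolding A_def one_angles_eq by blast
  assume "\<theta> = T j \<and> \<not> bdd_below (phases j) \<or> \<theta> = T (j + 1) \<and> \<not> bdd_above (phases j)"
  then show "\<theta> islimpt A j"
  proof (elim disjE conjE)
    assume \<theta>: "\<theta> = T j" and unb: "\<not> bdd_below (phases j)"
    show ?thesis
      unfolding islimpt_approachable
    proof (intro allI impI)
      fix e :: real assume "e > 0"
      obtain \<theta>1 where \<theta>1: "\<theta>1 \<in> arc j" "\<theta>1 < T j + e"
        using dense[of "T j" "min (T (j + 1)) (T j + e)"] \<open>e > 0\<close> by auto
      define k where "k = \<lfloor>\<Phi> \<theta>1 / (2 * pi)\<rfloor> - 1"
      have "of_int k < \<Phi> \<theta>1 / (2 * pi)"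
        unfolding k_def by linarith
      then have k: "2 * pi * of_int k < \<Phi> \<theta>1"
        by (simp add: field_simps)
      obtain y where "y \<in> phases j" "y < 2 * pi * of_int k"
        using unb unfolding bdd_below_def by (meson not_le)
      then obtain \<theta>' where \<theta>': "\<theta>' \<in> A j" "\<Phi> \<theta>' = 2 * pi * of_int k"
        using in_A[of y "\<Phi> \<theta>1" k] k \<theta>1(1) unfolding phases_def by (metis imageI less_imp_le)
      then have "\<theta>' < \<theta>1"
        using \<Phi>_less[of \<theta>' j \<theta>1] \<theta>1(1) k A_arc by auto
      then show "\<exists>x'\<in>A j. x' \<noteq> \<theta> \<and> dist x' \<theta> < e"
        using \<theta>' \<theta>1 A_arc \<theta> by (intro bexI[of _ \<theta>']) (auto simp: dist_real_def)
    qed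
  next
    assume \<theta>: "\<theta> = T (j + 1)" and unb: "\<not> bdd_above (phases j)"
    show ?thesis
      unfolding islimpt_approachable
    proof (intro allI impI)
      fix e :: real assume "e > 0"
      obtain \<theta>1 where \<theta>1: "\<theta>1 \<in> arc j" "T (j + 1) - e < \<theta>1"
        using dense[of "max (T j) (T (j + 1) - e)" "T (j + 1)"] \<open>e > 0\<close> by auto
      define k where "k = \<lceil>\<Phi> \<theta>1 / (2 * pi)\<rceil> + 1"
      have "\<Phi> \<theta>1 / (2 * pi) < of_int k"
        unfolding k_def by linarith
      then have k: "\<Phi> \<theta>1 < 2 * pi * of_int k"
        by (simp add: field_simps)
      obtain y where "y \<in> phases j" "2 * pi * of_int k < y"
        using unb unfolding bdd_above_def by (meson not_le)
      then obtain \<theta>' where \<theta>': "\<theta>' \<in> A j" "\<Phi> \<theta>' = 2 * pi * of_int k"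
        using in_A[of "\<Phi> \<theta>1" y k] k \<theta>1(1) unfolding phases_def by (metis imageI less_imp_le)
      then have "\<theta>1 < \<theta>'"
        using \<Phi>_less[of \<theta>1 j \<theta>'] \<theta>1(1) k A_arc by auto
      then show "\<exists>x'\<in>A j. x' \<noteq> \<theta> \<and> dist x' \<theta> < e"
        using \<theta>' \<theta>1 A_arc \<theta> by (intro bexI[of _ \<theta>']) (auto simp: dist_real_def)
    qed
  qed
qed

lemma finite_one_angles_iff:
  "finite (one_angles B (T j) (T (j + 1))) \<longleftrightarrow> bdd_below (phases j) \<and> bdd_above (phases j)"
proof
  assume "finite (one_angles B (T j) (T (j + 1)))"
  then show "bdd_below (phases j) \<and> bdd_above (phases j)"
    using islimpt_finite[of "one_angles B (T j) (T (j + 1))"] one_angles_limit_point_iff[of _ j]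
    by metis
next
  assume b: "bdd_below (phases j) \<and> bdd_above (phases j)"
  show "finite (one_angles B (T j) (T (j + 1)))"
  proof (rule ccontr)
    assume "infinite (one_angles B (T j) (T (j + 1)))"
    moreover have "bounded (one_angles B (T j) (T (j + 1)))"
      by (rule bounded_subset[of "arc j"]) (auto simp: one_angles_def)
    ultimately obtain \<theta> where "\<theta> islimpt one_angles B (T j) (T (j + 1))"
      using bounded_infinite_imp_islimpt by blast
    then show False
      using b one_angles_limit_point_iff by blast
  qed
qed

text \<open>
  The four types tell which ends of the phase interval are finite.
\<close>
lemma type_iffs:
  shows "type0 B (T j) (T (j + 1)) \<longleftrightarrow> bdd_below (phases j) \<and> bdd_above (phases j)"
    and "type1a B (T j) (T (j + 1)) \<longleftrightarrow> \<not> bdd_below (phases j) \<and> bdd_above (phases j)"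
    and "type1b B (T j) (T (j + 1)) \<longleftrightarrow> bdd_below (phases j) \<and> \<not> bdd_above (phases j)"
    and "type2 B (T j) (T (j + 1)) \<longleftrightarrow> \<not> bdd_below (phases j) \<and> \<not> bdd_above (phases j)"
proof -
  have ne: "T j \<noteq> T (j + 1)"
    by simp
  let ?P = "bdd_below (phases j)" and ?Q = "bdd_above (phases j)"
  have lim: "{\<theta>. \<theta> islimpt one_angles B (T j) (T (j + 1))} =
      {\<theta>. \<theta> = T j \<and> \<not> ?P \<or> \<theta> = T (j + 1) \<and> \<not> ?Q}"
    unfolding one_angles_limit_point_iff by (rule refl)
  have "{\<theta>. \<theta> = x \<and> \<not> p \<or> \<theta> = y \<and> \<not> q} = {x} \<longleftrightarrow> \<not> p \<and> q"
    "{\<theta>. \<theta> = x \<and> \<not> p \<or> \<theta> = y \<and> \<not> q} = {y} \<longleftrightarrow> p \<and> \<not> q"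
    "{\<theta>. \<theta> = x \<and> \<not> p \<or> \<theta> = y \<and> \<not> q} = {x, y} \<longleftrightarrow> \<not> p \<and> \<not> q"
    if "x \<noteq> y" for x y :: real and p q
    using that by auto
  note sets = this[OF ne, of ?P ?Q]
  show "type0 B (T j) (T (j + 1)) \<longleftrightarrow> ?P \<and> ?Q"
    "type1a B (T j) (T (j + 1)) \<longleftrightarrow> \<not> ?P \<and> ?Q"
    "type1b B (T j) (T (j + 1)) \<longleftrightarrow> ?P \<and> \<not> ?Q"
    "type2 B (T j) (T (j + 1)) \<longleftrightarrow> \<not> ?P \<and> \<not> ?Q"
    unfolding type0_def type1a_def type1b_def type2_def lim sets finite_one_angles_iff by auto
qed

lemma type2_iff_UNIV: "type2 B (T j) (T (j + 1)) \<longleftrightarrow> phases j = UNIV"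
proof -
  have "\<not> bdd_below (UNIV :: real set)" "\<not> bdd_above (UNIV :: real set)"
    unfolding bdd_below_def bdd_above_def by (meson UNIV_I lt_ex gt_ex not_le)+
  then show ?thesis
    unfolding type_iffs using phases_mem_iff[of _ j] by (metis UNIV_eq_I)
qed

lemma phase_limit_left:
  assumes "bdd_above (phases j)"
  shows "((\<lambda>\<theta>. bdry B (cis \<theta>)) \<longlongrightarrow> cis (Sup (phases j))) (at_left (T (j + 1)))"
proof -
  have arc: "\<forall>\<^sub>F \<theta> in at_left (T (j + 1)). \<theta> \<in> arc j"
    by (rule eventually_at_leftI[of "T j"]) auto
  have "(\<Phi> \<longlongrightarrow> Sup (phases j)) (at_left (T (j + 1)))"
  proof (rule order_tendstoI)
    fix a assume "a < Sup (phases j)"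
    then obtain \<theta>1 where \<theta>1: "\<theta>1 \<in> arc j" "a < \<Phi> \<theta>1"
      using less_cSupD[OF phases_nonempty] unfolding phases_def by blast
    show "\<forall>\<^sub>F \<theta> in at_left (T (j + 1)). a < \<Phi> \<theta>"
    proof (rule eventually_at_leftI[of \<theta>1])
      fix \<theta> assume "\<theta> \<in> {\<theta>1<..<T (j + 1)}"
      then have "\<theta> \<in> arc j" "\<theta>1 < \<theta>"
        using \<theta>1 by auto
      then show "a < \<Phi> \<theta>"
        using \<Phi>_less[OF \<theta>1(1)] \<theta>1(2) less_trans by blast
    qed (use \<theta>1 in auto)
  next
    fix a assume "Sup (phases j) < a"
    then show "\<forall>\<^sub>F \<theta> in at_left (T (j + 1)). \<Phi> \<theta> < a"
      using arc phases_less_Sup[OF assms] less_trans unfolding phases_def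
      by (intro eventually_mono[OF arc]) blast
  qed
  then have "((\<lambda>\<theta>. cis (\<Phi> \<theta>)) \<longlongrightarrow> cis (Sup (phases j))) (at_left (T (j + 1)))"
    by (rule tendsto_cis)
  moreover have "\<forall>\<^sub>F \<theta> in at_left (T (j + 1)). cis (\<Phi> \<theta>) = bdry B (cis \<theta>)"
    using arc by eventually_elim (simp only: bdry_arc)
  ultimately show ?thesis
    by (rule Lim_transform_eventually)
qed

lemma phase_limit_right:
  assumes "bdd_below (phases j)"
  shows "((\<lambda>\<theta>. bdry B (cis \<theta>)) \<longlongrightarrow> cis (Inf (phases j))) (at_right (T j))"
proof -
  have arc: "\<forall>\<^sub>F \<theta> in at_right (T j). \<theta> \<in> arc j"
    by (rule eventually_at_rightI[of _ "T (j + 1)"]) auto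
  have "(\<Phi> \<longlongrightarrow> Inf (phases j)) (at_right (T j))"
  proof (rule order_tendstoI)
    fix a assume "Inf (phases j) < a"
    then obtain \<theta>1 where \<theta>1: "\<theta>1 \<in> arc j" "\<Phi> \<theta>1 < a"
      using cInf_lessD[OF phases_nonempty] unfolding phases_def by blast
    show "\<forall>\<^sub>F \<theta> in at_right (T j). \<Phi> \<theta> < a"
    proof (rule eventually_at_rightI[of _ \<theta>1])
      fix \<theta> assume "\<theta> \<in> {T j<..<\<theta>1}"
      then have "\<theta> \<in> arc j" "\<theta> < \<theta>1"
        using \<theta>1 by auto
      then show "\<Phi> \<theta> < a"
        using \<Phi>_less[OF _ \<theta>1(1)] \<theta>1(2) less_trans by blast
    qed (use \<theta>1 in auto)
  next
    fix a assume "a < Inf (phases j)"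
    then show "\<forall>\<^sub>F \<theta> in at_right (T j). a < \<Phi> \<theta>"
      using arc phases_greater_Inf[OF assms] less_trans unfolding phases_def
      by (intro eventually_mono[OF arc]) blast
  qed
  then have "((\<lambda>\<theta>. cis (\<Phi> \<theta>)) \<longlongrightarrow> cis (Inf (phases j))) (at_right (T j))"
    by (rule tendsto_cis)
  moreover have "\<forall>\<^sub>F \<theta> in at_right (T j). cis (\<Phi> \<theta>) = bdry B (cis \<theta>)"
    using arc by eventually_elim (simp only: bdry_arc)
  ultimately show ?thesis
    by (rule Lim_transform_eventually)
qed

lemma arc_width: "T (j + 1) - T j \<le> 2 * pi"
proof -
  have "T (j + 1) \<le> T (j + int n)"
    using n_pos by simp
  then show ?thesis
    using T_period[of j] by linarith
qed

text \<open>
  The phase is injective on the arc, and so is \<open>cis\<close> because the arc is at most one turn long.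
\<close>
lemma card_preimages:
  "card {\<xi> \<in> arc_between (T j) (T (j + 1)). bdry B \<xi> = cis l} = card {k::int. l + 2 * pi * of_int k \<in> phases j}"
proof -
  define A where "A = {\<theta> \<in> arc j. cis (\<Phi> \<theta>) = cis l}"
  have "{\<xi> \<in> arc_between (T j) (T (j + 1)). bdry B \<xi> = cis l} = cis ` A"
    using bdry_arc[of _ j] unfolding arc_between_def A_def by auto
  moreover have "inj_on cis A"
  proof (rule inj_onI)
    fix \<theta> \<theta>' assume "\<theta> \<in> A" "\<theta>' \<in> A" "cis \<theta> = cis \<theta>'"
    then show "\<theta> = \<theta>'"
      using arc_width[of j] by (intro cis_eq_imp_eq) (auto simp: A_def)
  qed
  moreover have "\<Phi> ` A = {y \<in> phases j. cis y = cis l}"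
    unfolding A_def phases_def by auto
  then have "\<Phi> ` A = (\<lambda>k. l + 2 * pi * of_int k) ` {k::int. l + 2 * pi * of_int k \<in> phases j}"
    unfolding cis_eq_cis_iff by auto
  moreover have "inj_on \<Phi> A"
    using \<Phi>_eq[of _ j] unfolding A_def by (auto intro!: inj_onI)
  moreover have "inj_on (\<lambda>k. l + 2 * pi * of_int k) {k::int. l + 2 * pi * of_int k \<in> phases j}"
    by (auto intro!: inj_onI)
  ultimately show ?thesis
    by (metis (no_types, lifting) card_image)
qed

text \<open>
  A phase interval is determined by which of its ends are finite and by their values. The type says which ends
  are finite, the one-sided limit of \<open>B\<close> gives a single finite end modulo \<open>2\<pi>\<close>, and for two finite ends the counts
  of preimages determine the interval modulo a common translation.
\<close>
lemma same_type_iff: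
  "same_type B (T i, T (i + 1)) (T j, T (j + 1)) \<longleftrightarrow>
    (\<exists>m::int. phases j = (\<lambda>y. y + 2 * pi * of_int m) ` phases i)"
proof
  have translate: "phases j = (\<lambda>y. y + 2 * pi * of_int m) ` phases i"
    if "bdd_below (phases i) \<longleftrightarrow> bdd_below (phases j)" "bdd_above (phases i) \<longleftrightarrow> bdd_above (phases j)"
      "bdd_below (phases i) \<Longrightarrow> Inf (phases j) = Inf (phases i) + 2 * pi * of_int m"
      "bdd_above (phases i) \<Longrightarrow> Sup (phases j) = Sup (phases i) + 2 * pi * of_int m" for m :: int
  proof -
    have "y \<in> phases j \<longleftrightarrow> y - 2 * pi * of_int m \<in> phases i" for y
      using that unfolding phases_mem_iff[of _ j] phases_mem_iff[of _ i] by auto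
    moreover have "y \<in> (\<lambda>y. y + 2 * pi * of_int m) ` phases i \<longleftrightarrow> y - 2 * pi * of_int m \<in> phases i" for y
      by (metis (no_types, lifting) add_diff_cancel diff_add_cancel image_iff)
    ultimately show ?thesis
      by blast
  qed
  assume "same_type B (T i, T (i + 1)) (T j, T (j + 1))"
  then consider (t2) "type2 B (T i) (T (i + 1))" "type2 B (T j) (T (j + 1))"
    | (t1a) L where "type1a B (T i) (T (i + 1))" "type1a B (T j) (T (j + 1))"
        "((\<lambda>\<theta>. bdry B (cis \<theta>)) \<longlongrightarrow> L) (at_left (T (i + 1)))"
        "((\<lambda>\<theta>. bdry B (cis \<theta>)) \<longlongrightarrow> L) (at_left (T (j + 1)))"
    | (t1b) L where "type1b B (T i) (T (i + 1))" "type1b B (T j) (T (j + 1))"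
        "((\<lambda>\<theta>. bdry B (cis \<theta>)) \<longlongrightarrow> L) (at_right (T i))"
        "((\<lambda>\<theta>. bdry B (cis \<theta>)) \<longlongrightarrow> L) (at_right (T j))"
    | (t0) "type0 B (T i) (T (i + 1))" "type0 B (T j) (T (j + 1))"
        "\<forall>w\<in>unit_circle. card {\<xi> \<in> arc_between (T i) (T (i + 1)). bdry B \<xi> = w} =
          card {\<xi> \<in> arc_between (T j) (T (j + 1)). bdry B \<xi> = w}"
    unfolding same_type_def by auto
  then show "\<exists>m::int. phases j = (\<lambda>y. y + 2 * pi * of_int m) ` phases i"
  proof cases
    case t2
    then show ?thesis
      unfolding type_iffs by (intro exI[of _ 0] translate) simp_all
  next
    case t1a
    then have b: "\<not> bdd_below (phases i)" "bdd_above (phases i)" "\<not> bdd_below (phases j)" "bdd_above (phases j)"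
      unfolding type_iffs by auto
    have "cis (Sup (phases j)) = cis (Sup (phases i))"
      using tendsto_unique[OF _ t1a(3) phase_limit_left[OF b(2)]]
        tendsto_unique[OF _ t1a(4) phase_limit_left[OF b(4)]] by simp
    then obtain m :: int where "Sup (phases j) = Sup (phases i) + 2 * pi * of_int m"
      using cis_eq_cis_iff by blast
    then show ?thesis
      using b by (intro exI[of _ m] translate) simp_all
  next
    case t1b
    then have b: "bdd_below (phases i)" "\<not> bdd_above (phases i)" "bdd_below (phases j)" "\<not> bdd_above (phases j)"
      unfolding type_iffs by auto
    have "cis (Inf (phases j)) = cis (Inf (phases i))"
      using tendsto_unique[OF _ t1b(3) phase_limit_right[OF b(1)]]
        tendsto_unique[OF _ t1b(4) phase_limit_right[OF b(3)]] by simp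
    then obtain m :: int where "Inf (phases j) = Inf (phases i) + 2 * pi * of_int m"
      using cis_eq_cis_iff by blast
    then show ?thesis
      using b by (intro exI[of _ m] translate) simp_all
  next
    case t0
    then have b: "bdd_below (phases i)" "bdd_above (phases i)" "bdd_below (phases j)" "bdd_above (phases j)"
      unfolding type_iffs by auto
    obtain y y' where y: "y \<in> phases i" "y' \<in> phases j"
      using phases_nonempty[of i] phases_nonempty[of j] by blast
    have less: "Inf (phases i) < Sup (phases i)" "Inf (phases j) < Sup (phases j)"
      using less_trans[OF phases_greater_Inf[OF b(1) y(1)] phases_less_Sup[OF b(2) y(1)]]
        less_trans[OF phases_greater_Inf[OF b(3) y(2)] phases_less_Sup[OF b(4) y(2)]] .
    have "card {k::int. l + 2 * pi * of_int k \<in> phases i} = card {k::int. l + 2 * pi * of_int k \<in> phases j}" for l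
      using t0(3)[rule_format, of "cis l"] unfolding card_preimages by simp
    moreover have "y \<in> phases i \<longleftrightarrow> Inf (phases i) < y \<and> y < Sup (phases i)" "y \<in> phases j \<longleftrightarrow> Inf (phases j) < y \<and> y < Sup (phases j)" for y
      using phases_mem_iff[of y i] phases_mem_iff[of y j] b by simp_all
    ultimately have "\<exists>m::int. Inf (phases j) = Inf (phases i) + 2 * pi * of_int m \<and> Sup (phases j) = Sup (phases i) + 2 * pi * of_int m"
      by (intro lattice_count_determines_interval less) simp
    then obtain m :: int where "Inf (phases j) = Inf (phases i) + 2 * pi * of_int m"
        "Sup (phases j) = Sup (phases i) + 2 * pi * of_int m"
      by blast
    then show ?thesis
      using b by (intro exI[of _ m] translate) simp_all
  qed
next
  assume "\<exists>m::int. phases j = (\<lambda>y. y + 2 * pi * of_int m) ` phases i"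
  then obtain m :: int where m: "phases j = (\<lambda>y. y + 2 * pi * of_int m) ` phases i"
    by blast
  have b: "bdd_below (phases j) \<longleftrightarrow> bdd_below (phases i)" "bdd_above (phases j) \<longleftrightarrow> bdd_above (phases i)"
    unfolding m by (rule translate_bounds)+
  have cis_m: "cis (y + 2 * pi * of_int m) = cis y" for y
    using cis_eq_cis_iff by blast
  have left: "\<exists>L. ((\<lambda>\<theta>. bdry B (cis \<theta>)) \<longlongrightarrow> L) (at_left (T (i + 1))) \<and>
      ((\<lambda>\<theta>. bdry B (cis \<theta>)) \<longlongrightarrow> L) (at_left (T (j + 1)))" if "bdd_above (phases i)"
  proof -
    have "cis (Sup (phases j)) = cis (Sup (phases i))"
      unfolding m translate_Sup[OF that phases_nonempty] by (rule cis_m)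
    then show ?thesis
      using phase_limit_left[of i] phase_limit_left[of j] that b
      by (intro exI[of _ "cis (Sup (phases i))"]) simp
  qed
  have right: "\<exists>L. ((\<lambda>\<theta>. bdry B (cis \<theta>)) \<longlongrightarrow> L) (at_right (T i)) \<and>
      ((\<lambda>\<theta>. bdry B (cis \<theta>)) \<longlongrightarrow> L) (at_right (T j))" if "bdd_below (phases i)"
  proof -
    have "cis (Inf (phases j)) = cis (Inf (phases i))"
      unfolding m translate_Inf[OF that phases_nonempty] by (rule cis_m)
    then show ?thesis
      using phase_limit_right[of i] phase_limit_right[of j] that b
      by (intro exI[of _ "cis (Inf (phases i))"]) simp
  qed
  have count: "card {\<xi> \<in> arc_between (T i) (T (i + 1)). bdry B \<xi> = w} =
      card {\<xi> \<in> arc_between (T j) (T (j + 1)). bdry B \<xi> = w}" if "w \<in> unit_circle" for w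
  proof -
    obtain l where w: "w = cis l"
      using \<open>w \<in> unit_circle\<close> unfolding unit_circle_eq_cis by (rule exE)
    have "{k::int. l + 2 * pi * of_int k \<in> phases j} = (\<lambda>k. k + m) ` {k::int. l + 2 * pi * of_int k \<in> phases i}"
    proof (intro equalityI subsetI)
      fix k assume "k \<in> {k::int. l + 2 * pi * of_int k \<in> phases j}"
      then have "l + 2 * pi * of_int k \<in> (\<lambda>y. y + 2 * pi * of_int m) ` phases i"
        unfolding m by (rule CollectD)
      then obtain y where "y \<in> phases i" "l + 2 * pi * of_int k = y + 2 * pi * of_int m"
        by (rule imageE)
      then have "l + 2 * pi * of_int (k - m) \<in> phases i"
        by (simp add: algebra_simps)
      then have "k - m \<in> {k::int. l + 2 * pi * of_int k \<in> phases i}"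
        by blast
      then show "k \<in> (\<lambda>k. k + m) ` {k::int. l + 2 * pi * of_int k \<in> phases i}"
        by (rule rev_image_eqI) simp
    next
      fix k assume "k \<in> (\<lambda>k. k + m) ` {k::int. l + 2 * pi * of_int k \<in> phases i}"
      then obtain k' where "k' \<in> {k::int. l + 2 * pi * of_int k \<in> phases i}" "k = k' + m"
        by (rule imageE)
      then have "l + 2 * pi * of_int k' \<in> phases i" "k = k' + m"
        by simp_all
      then show "k \<in> {k::int. l + 2 * pi * of_int k \<in> phases j}"
        unfolding m by (intro CollectI rev_image_eqI[of "l + 2 * pi * of_int k'"])
          (simp_all add: algebra_simps)
    qed
    then have "card {k::int. l + 2 * pi * of_int k \<in> phases j} = card {k::int. l + 2 * pi * of_int k \<in> phases i}"
      by (simp add: card_image inj_on_def)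
    then show ?thesis
      unfolding w card_preimages by simp
  qed
  show "same_type B (T i, T (i + 1)) (T j, T (j + 1))"
    unfolding same_type_def prod.case type_iffs b using left right count
    by (cases "bdd_below (phases i)"; cases "bdd_above (phases i)") simp_all
qed

end

section \<open>Admissible rotations\<close>

context circle_phase begin

lemma phases_UNIV_iff: "phases j = UNIV \<longleftrightarrow> \<not> bdd_below (phases j) \<and> \<not> bdd_above (phases j)"
  using type2_iff_UNIV[of j] type_iffs(4)[of j] by simp

definition rotations :: "int set" where
  "rotations = {r. \<forall>j. \<exists>m::int. phases (j + r) = (\<lambda>y. y + 2 * pi * of_int m) ` phases j}"

text \<open>
  On an arc of type 2 every \<open>m\<close> satisfies the equation. The value 0 is a choice that is compatible with
  composition (\<open>winding_add\<close>), and this is what makes the extension split.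
\<close>
definition winding :: "int \<Rightarrow> int \<Rightarrow> int" where
  "winding r j = (if phases j = UNIV then 0 else
     (SOME m. phases (j + r) = (\<lambda>y. y + 2 * pi * of_int m) ` phases j))"

lemma translate_phases_inj:
  assumes "phases j \<noteq> UNIV"
    and eq: "(\<lambda>y. y + 2 * pi * real_of_int m) ` phases j = (\<lambda>y. y + 2 * pi * real_of_int m') ` phases j"
  shows "m = m'"
proof -
  have "bdd_below (phases j) \<or> bdd_above (phases j)"
    using assms(1) phases_UNIV_iff[of j] by simp
  then have "2 * pi * real_of_int m = 2 * pi * real_of_int m'"
    using arg_cong[OF eq, of Sup] arg_cong[OF eq, of Inf] translate_Sup[OF _ phases_nonempty]
      translate_Inf[OF _ phases_nonempty] by auto
  then show ?thesis
    by simp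
qed

lemma rotation_UNIV:
  assumes "r \<in> rotations"
  shows "phases (j + r) = UNIV \<longleftrightarrow> phases j = UNIV"
proof -
  obtain m :: int where m: "phases (j + r) = (\<lambda>y. y + 2 * pi * of_int m) ` phases j"
    using assms unfolding rotations_def by blast
  have "bdd_below (phases (j + r)) \<longleftrightarrow> bdd_below (phases j)" "bdd_above (phases (j + r)) \<longleftrightarrow> bdd_above (phases j)"
    unfolding m by (rule translate_bounds)+
  then show ?thesis
    using phases_UNIV_iff[of j] phases_UNIV_iff[of "j + r"] by simp
qed

lemma winding_translate:
  assumes "r \<in> rotations"
  shows "phases (j + r) = (\<lambda>y. y + 2 * pi * of_int (winding r j)) ` phases j"
proof (cases "phases j = UNIV")
  case True
  then show ?thesis
    using rotation_UNIV[OF assms] by (simp add: winding_def)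
next
  case False
  have "\<exists>m::int. phases (j + r) = (\<lambda>y. y + 2 * pi * of_int m) ` phases j"
    using assms unfolding rotations_def by blast
  from someI_ex[OF this] show ?thesis
    using False by (simp add: winding_def)
qed

lemma winding_eq:
  assumes "phases j \<noteq> UNIV" "phases (j + r) = (\<lambda>y. y + 2 * pi * of_int m) ` phases j"
  shows "winding r j = m"
proof -
  have "\<exists>m::int. phases (j + r) = (\<lambda>y. y + 2 * pi * of_int m) ` phases j"
    using assms(2) by (rule exI)
  from someI_ex[OF this] show ?thesis
    using assms(1) by (intro translate_phases_inj[OF assms(1)]) (simp add: winding_def assms(2)[symmetric])
qed

lemma winding_period: "winding r (j + int n) = winding r j"
  and winding_shift: "winding (r + q * int n) j = winding r j"
proof -
  have e: "phases (j + int n) = phases j" "phases (j + int n + r) = phases (j + r)" "phases (j + (r + q * int n)) = phases (j + r)"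
    using phases_shift[of j 1] phases_shift[of "j + r" 1] phases_shift[of "j + r" q] by (simp_all add: add_ac)
  show "winding r (j + int n) = winding r j"
    unfolding winding_def e by (rule refl)
  show "winding (r + q * int n) j = winding r j"
    unfolding winding_def e by (rule refl)
qed

text \<open>
  The winding numbers of an invariant are free on the arcs of type 2 and forced on the others.
\<close>
lemma valid_iff:
  "valid r m \<longleftrightarrow> r \<in> rotations \<and> (\<forall>j. m (j + int n) = m j) \<and> (\<forall>j. phases j \<noteq> UNIV \<longrightarrow> m j = winding r j)"
proof
  assume v: "valid r m"
  then have "r \<in> rotations"
    unfolding valid_def rotations_def by blast
  moreover have "m j = winding r j" if "phases j \<noteq> UNIV" for j
    using winding_eq[OF that, of r "m j"] v unfolding valid_def by simp
  ultimately show "r \<in> rotations \<and> (\<forall>j. m (j + int n) = m j) \<and> (\<forall>j. phases j \<noteq> UNIV \<longrightarrow> m j = winding r j)"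
    using v unfolding valid_def by simp
next
  assume m: "r \<in> rotations \<and> (\<forall>j. m (j + int n) = m j) \<and> (\<forall>j. phases j \<noteq> UNIV \<longrightarrow> m j = winding r j)"
  have "phases (j + r) = (\<lambda>y. y + 2 * pi * of_int (m j)) ` phases j" for j
  proof (cases "phases j = UNIV")
    case True
    then have "phases (j + r) = UNIV"
      using rotation_UNIV m by blast
    moreover have "(\<lambda>y. y + 2 * pi * real_of_int (m j)) ` UNIV = UNIV"
      by (rule surjI[of _ "\<lambda>y. y - 2 * pi * real_of_int (m j)"]) simp
    ultimately show ?thesis
      using True by simp
  next
    case False
    then show ?thesis
      using winding_translate[of r j] m by simp
  qed
  then show "valid r m"
    using m unfolding valid_def by simp
qed

lemma valid_winding: "r \<in> rotations \<Longrightarrow> valid r (winding r)"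
  unfolding valid_iff using winding_period by blast

lemma rotations_add: "r \<in> rotations \<Longrightarrow> s \<in> rotations \<Longrightarrow> r + s \<in> rotations"
  and rotations_minus: "r \<in> rotations \<Longrightarrow> - r \<in> rotations"
  using valid_comp[OF valid_winding valid_winding] valid_inverse[OF valid_winding] valid_iff by blast+

lemma n_in_rotations: "int n \<in> rotations"
  using phases_shift[of _ 1] unfolding rotations_def by (auto intro!: exI[of _ 0])

lemma winding_add:
  assumes "r \<in> rotations" "s \<in> rotations"
  shows "winding (r + s) j = winding s j + winding r (j + s)"
proof (cases "phases j = UNIV")
  case True
  then show ?thesis
    using rotation_UNIV[OF assms(2), of j] by (simp add: winding_def)
next
  case False
  then show ?thesis
    using valid_comp[OF valid_winding valid_winding, OF assms] unfolding valid_iff by simp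
qed

theorem group_invariant_group: "group (invariant_group B)"
proof (rule groupI)
  let ?G = "invariant_group B"
  have one: "\<one>\<^bsub>?G\<^esub> = (\<lambda>z\<in>unit_circle. z)" and mult: "x \<otimes>\<^bsub>?G\<^esub> y = compose unit_circle x y" for x y
    by (simp_all add: invariant_group_def)
  have maps: "x \<in> unit_circle \<rightarrow> unit_circle" "x \<in> extensional unit_circle" if "x \<in> carrier ?G" for x
    using that by (auto simp: invariant_group_def PiE_def)
  show "\<one>\<^bsub>?G\<^esub> \<in> carrier ?G"
    unfolding one by (rule represents_carrier[OF represents_id])
  fix x assume x: "x \<in> carrier ?G"
  then obtain r m where x_rep: "represents r m x"
    using carrier_represents by blast
  show "\<one>\<^bsub>?G\<^esub> \<otimes>\<^bsub>?G\<^esub> x = x"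
    unfolding one mult using maps[OF x] by (rule Id_compose)
  show "\<exists>y\<in>carrier ?G. y \<otimes>\<^bsub>?G\<^esub> x = \<one>\<^bsub>?G\<^esub>"
  proof -
    have "valid (- r) (\<lambda>j. - m (j - r))"
      using x_rep valid_inverse unfolding represents_def by blast
    then obtain y where y: "represents (- r) (\<lambda>j. - m (j - r)) y"
      using represents_exists by blast
    have "represents 0 (\<lambda>_. 0) (compose unit_circle y x)"
      using represents_comp[OF y x_rep] by simp
    then have "compose unit_circle y x = (\<lambda>z\<in>unit_circle. z)"
      using represents_unique represents_id by blast
    then show ?thesis
      using represents_carrier[OF y] unfolding one mult by blast
  qed
  fix y assume y: "y \<in> carrier ?G"
  then obtain r' m' where "represents r' m' y"
    using carrier_represents by blast
  then show "x \<otimes>\<^bsub>?G\<^esub> y \<in> carrier ?G"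
    unfolding mult using represents_carrier[OF represents_comp[OF x_rep]] by blast
  fix z assume z: "z \<in> carrier ?G"
  show "x \<otimes>\<^bsub>?G\<^esub> y \<otimes>\<^bsub>?G\<^esub> z = x \<otimes>\<^bsub>?G\<^esub> (y \<otimes>\<^bsub>?G\<^esub> z)"
    unfolding mult using maps(1)[OF z] maps(2)[OF x]
    by (intro ext) (auto simp: compose_def extensional_def Pi_iff)
qed

end

section \<open>The semidirect product\<close>

text \<open>
  For an isomorphism that is explicit in the direction from \<open>H\<close> to \<open>G\<close>. Closure of \<open>H\<close> alone makes
  the inverse multiplicative, and that is all a semidirect product has to supply.
\<close>
lemma is_iso_by_inverse:
  assumes bij: "bij_betw f (carrier H) (carrier G)"
    and mult: "\<And>a b. a \<in> carrier H \<Longrightarrow> b \<in> carrier H \<Longrightarrow> f (a \<otimes>\<^bsub>H\<^esub> b) = f a \<otimes>\<^bsub>G\<^esub> f b"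
    and closed: "\<And>a b. a \<in> carrier H \<Longrightarrow> b \<in> carrier H \<Longrightarrow> a \<otimes>\<^bsub>H\<^esub> b \<in> carrier H"
  shows "G \<cong> H"
proof -
  let ?g = "inv_into (carrier H) f"
  have g: "bij_betw ?g (carrier G) (carrier H)"
    using bij by (rule bij_betw_inv_into)
  have "?g (x \<otimes>\<^bsub>G\<^esub> y) = ?g x \<otimes>\<^bsub>H\<^esub> ?g y" if "x \<in> carrier G" "y \<in> carrier G" for x y
  proof -
    have mem: "?g x \<in> carrier H" "?g y \<in> carrier H"
      using that g by (auto simp: bij_betw_def)
    have "f (?g x \<otimes>\<^bsub>H\<^esub> ?g y) = x \<otimes>\<^bsub>G\<^esub> y"
      using mult[OF mem] bij that by (simp add: bij_betw_inv_into_right)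
    then show ?thesis
      using bij_betw_inv_into_left[OF bij closed[OF mem]] by simp
  qed
  then have "?g \<in> iso G H"
    using g by (auto simp: iso_def hom_def bij_betw_def)
  then show ?thesis
    by (auto simp: is_iso_def)
qed

text \<open>
  Division with remainder by the least positive element.
\<close>
lemma int_additive_closed_eq_multiples:
  fixes R :: "int set" and n :: nat
  assumes add: "\<And>r s. r \<in> R \<Longrightarrow> s \<in> R \<Longrightarrow> r + s \<in> R" and neg: "\<And>r. r \<in> R \<Longrightarrow> - r \<in> R"
    and n: "int n \<in> R" "n > 0"
  obtains g :: nat where "g > 0" "\<And>r. r \<in> R \<longleftrightarrow> int g dvd r"
proof -
  define g where "g = (LEAST g. g > 0 \<and> int g \<in> R)"
  have g: "g > 0" "int g \<in> R"
    using LeastI[of "\<lambda>g. g > 0 \<and> int g \<in> R" n] n by (simp_all add: g_def)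
  have least: "g \<le> s" if "s > 0" "int s \<in> R" for s
    using Least_le[of "\<lambda>g. g > 0 \<and> int g \<in> R" s] that by (simp add: g_def)
  have zero: "0 \<in> R"
    using add[OF n(1) neg[OF n(1)]] by simp
  have mult: "q * int g \<in> R" for q
  proof (induction q rule: int_induct[where k = 0])
    case (step1 i)
    then show ?case
      using add[OF step1(2) g(2)] by (simp add: algebra_simps)
  next
    case (step2 i)
    then show ?case
      using add[OF step2(2) neg[OF g(2)]] by (simp add: algebra_simps)
  qed (simp add: zero)
  have "int g dvd r" if "r \<in> R" for r
  proof (rule ccontr)
    assume "\<not> int g dvd r"
    then have "r mod int g \<noteq> 0"
      by auto
    then have pos: "r mod int g > 0"
      using pos_mod_sign[of "int g" r] g(1) by linarith
    have "r + - (r div int g * int g) \<in> R"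
      using that mult neg add by blast
    then have "r mod int g \<in> R"
      by (simp add: minus_div_mult_eq_mod)
    then have "g \<le> nat (r mod int g)"
      using pos by (intro least) auto
    then show False
      using pos_mod_bound[of "int g" r] g(1) pos by linarith
  qed
  moreover have "r \<in> R" if "int g dvd r" for r
    using that mult by (auto simp: dvd_def mult.commute)
  ultimately show ?thesis
    using that g(1) by blast
qed

text \<open>
  The arcs of type 2 are enumerated by \<open>pos\<close>, and the admissible rotations are the multiples of \<open>g\<close>.
\<close>
locale circle_group = circle_phase +
  fixes k :: nat and pos :: "nat \<Rightarrow> nat" and g d :: nat
  assumes pos_bij: "bij_betw pos {..<k} {j. j < n \<and> phases (int j) = UNIV}"
    and rotations_iff: "\<And>r. r \<in> rotations \<longleftrightarrow> int g dvd r"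
    and gd: "g * d = n"
begin

abbreviation N :: "(nat \<Rightarrow> int) monoid" where "N \<equiv> integer_power_group k"
abbreviation H :: "int monoid" where "H \<equiv> integer_mod_group d"

lemma gd_int: "int g * int d = int n"
  using gd by (metis of_nat_mult)

lemma mult_g_mod: "int g * h = int g * (h mod int d) + (h div int d) * int n"
proof -
  have "int g * (h mod int d + (h div int d) * int d) = int g * (h mod int d) + (h div int d) * int n"
    by (simp only: gd_int[symmetric] algebra_simps)
  then show ?thesis
    by simp
qed

lemma d_pos: "d > 0" and g_pos: "g > 0"
  using gd n_pos by (auto intro: gr0I)

lemma carrier_N: "v \<in> carrier N \<longleftrightarrow> v \<in> extensional {..<k}"
  by (auto simp: PiE_def)

lemma mult_N: "v \<otimes>\<^bsub>N\<^esub> v' = (\<lambda>i\<in>{..<k}. v i + v' i)"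
  by simp

lemma carrier_H: "carrier H = {0..<int d}"
  using d_pos by (simp add: carrier_integer_mod_group)

text \<open>
  The normal subgroup in convenient coordinates: instead of vectors indexed by the arcs of type 2 in one turn,
  \<open>n\<close>-periodic functions on all arcs that vanish off type 2. In these coordinates a rotation is a
  shift of the argument.
\<close>
definition windings :: "(int \<Rightarrow> int) set" where
  "windings = {w. (\<forall>j. w (j + int n) = w j) \<and> (\<forall>j. phases j \<noteq> UNIV \<longrightarrow> w j = 0)}"

definition to_winding :: "(nat \<Rightarrow> int) \<Rightarrow> int \<Rightarrow> int" where
  "to_winding v j = (if phases j = UNIV then v (inv_into {..<k} pos (nat (j mod int n))) else 0)"

definition of_winding :: "(int \<Rightarrow> int) \<Rightarrow> nat \<Rightarrow> int" where
  "of_winding w = (\<lambda>i\<in>{..<k}. w (int (pos i)))"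

lemma phases_period: "phases (j + int n) = phases j"
  using phases_shift[of j 1] by simp

lemma phases_mod: "phases (j mod int n) = phases j"
  using phases_shift[of "j mod int n" "j div int n"] by simp

lemma windings_shift:
  assumes "w \<in> windings"
  shows "w (j + q * int n) = w j"
proof (induction q rule: int_induct[where k = 0])
  case (step1 i)
  have "w (j + i * int n + int n) = w (j + i * int n)"
    using assms unfolding windings_def by blast
  then show ?case
    using step1 by (simp add: algebra_simps)
next
  case (step2 i)
  have "w (j + (i - 1) * int n + int n) = w (j + (i - 1) * int n)"
    using assms unfolding windings_def by blast
  then show ?case
    using step2 by (simp add: algebra_simps)
qed simp

lemma to_winding_in: "to_winding v \<in> windings"
  unfolding windings_def to_winding_def by (simp add: phases_period)

lemma of_winding_in: "of_winding w \<in> carrier N"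
  unfolding carrier_N of_winding_def by (rule restrict_extensional)

lemma to_of_winding:
  assumes "w \<in> windings"
  shows "to_winding (of_winding w) = w"
proof
  fix j
  show "to_winding (of_winding w) j = w j"
  proof (cases "phases j = UNIV")
    case True
    define i where "i = inv_into {..<k} pos (nat (j mod int n))"
    have "nat (j mod int n) \<in> {j. j < n \<and> phases (int j) = UNIV}"
      using True phases_mod[of j] n_pos by (simp add: nat_less_iff)
    then have "i \<in> {..<k}" "pos i = nat (j mod int n)"
      using pos_bij unfolding i_def bij_betw_def by (metis inv_into_into, metis f_inv_into_f)
    then have "of_winding w i = w (j mod int n)"
      using n_pos by (simp add: of_winding_def)
    also have "\<dots> = w j"
      using windings_shift[OF assms, of "j mod int n" "j div int n"] by simp
    finally show ?thesis
      using True by (simp add: to_winding_def i_def)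
  next
    case False
    then show ?thesis
      using assms by (simp add: to_winding_def windings_def)
  qed
qed

lemma of_to_winding:
  assumes "v \<in> carrier N"
  shows "of_winding (to_winding v) = v"
proof (rule extensionalityI)
  fix i assume i: "i \<in> {..<k}"
  then have "pos i < n" "phases (int (pos i)) = UNIV"
    using pos_bij unfolding bij_betw_def by blast+
  moreover have "inv_into {..<k} pos (pos i) = i"
    using pos_bij i by (rule bij_betw_inv_into_left)
  ultimately show "of_winding (to_winding v) i = v i"
    using i by (simp add: of_winding_def to_winding_def)
qed (use assms of_winding_in carrier_N in blast)+

lemma to_winding_inj: "v \<in> carrier N \<Longrightarrow> v' \<in> carrier N \<Longrightarrow> to_winding v = to_winding v' \<Longrightarrow> v = v'"
  using of_to_winding by metis

lemma to_winding_mult: "to_winding (v \<otimes>\<^bsub>N\<^esub> v') j = to_winding v j + to_winding v' j"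
proof (cases "phases j = UNIV")
  case True
  have "nat (j mod int n) \<in> pos ` {..<k}"
    using True phases_mod[of j] n_pos pos_bij by (simp add: nat_less_iff bij_betw_def)
  then have "inv_into {..<k} pos (nat (j mod int n)) \<in> {..<k}"
    by (rule inv_into_into)
  then show ?thesis
    using True by (simp add: to_winding_def)
qed (simp add: to_winding_def)

lemma mult_g_in_rotations: "int g * h \<in> rotations"
  unfolding rotations_iff by simp

lemma shift_windings:
  assumes "w \<in> windings" "r \<in> rotations"
  shows "(\<lambda>j. w (j + r)) \<in> windings"
proof -
  have "w (j + int n + r) = w (j + r)" for j
    using windings_shift[OF assms(1), of "j + r" 1] by (simp add: add_ac)
  moreover have "w (j + r) = 0" if "phases j \<noteq> UNIV" for j
    using rotation_UNIV[OF assms(2), of j] assms(1) that unfolding windings_def by simp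
  ultimately show ?thesis
    unfolding windings_def by simp
qed

definition action :: "int \<Rightarrow> (nat \<Rightarrow> int) \<Rightarrow> nat \<Rightarrow> int" where
  "action h = (\<lambda>v\<in>carrier N. of_winding (\<lambda>j. to_winding v (j - int g * h)))"

lemma minus_g_in_rotations: "- (int g * h) \<in> rotations"
  using mult_g_in_rotations[of "- h"] by simp

text \<open>
  The action is a rotation of the arcs: in the coordinates of \<open>windings\<close> it shifts the argument.
\<close>
lemma to_winding_action:
  assumes "v \<in> carrier N"
  shows "to_winding (action h v) = (\<lambda>j. to_winding v (j - int g * h))"
  using to_of_winding[OF shift_windings[OF to_winding_in minus_g_in_rotations]] assms
  by (simp add: action_def del: carrier_product_group)

lemma action_in: "v \<in> carrier N \<Longrightarrow> action h v \<in> carrier N"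
  unfolding action_def by (simp add: of_winding_in del: carrier_product_group)

lemma mult_N_in: "v \<otimes>\<^bsub>N\<^esub> v' \<in> carrier N"
  unfolding mult_N carrier_N by (rule restrict_extensional)

lemma action_add:
  assumes "v \<in> carrier N"
  shows "action (h + h') v = action h (action h' v)"
  using assms by (intro to_winding_inj action_in) (simp_all only: to_winding_action action_in, simp add: algebra_simps)

lemma action_0: "v \<in> carrier N \<Longrightarrow> action 0 v = v"
  by (simp add: action_def of_to_winding del: carrier_product_group)

lemma action_mod: "action (h mod int d) = action h"
proof -
  have "to_winding v (j - int g * (h mod int d)) = to_winding v (j - int g * h)" for v j
  proof -
    have eq: "j - int g * (h mod int d) = (j - int g * h) + (h div int d) * int n"
      using mult_g_mod[of h] by simp
    show ?thesis
      unfolding eq by (rule windings_shift[OF to_winding_in])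
  qed
  then show ?thesis
    by (simp add: action_def)
qed

lemma action_auto: "action h \<in> auto N"
proof -
  have "action h (v \<otimes>\<^bsub>N\<^esub> v') = action h v \<otimes>\<^bsub>N\<^esub> action h v'"
    if "v \<in> carrier N" "v' \<in> carrier N" for v v'
    using that by (intro to_winding_inj action_in mult_N_in)
      (simp add: fun_eq_iff to_winding_action mult_N_in to_winding_mult
        del: carrier_product_group mult_product_group)
  moreover have "bij_betw (action h) (carrier N) (carrier N)"
  proof (rule bij_betwI[of _ _ _ "action (- h)"])
    fix v assume v: "v \<in> carrier N"
    show "action (- h) (action h v) = v" "action h (action (- h) v) = v"
      using action_add[OF v, of "- h" h] action_add[OF v, of h "- h"] action_0[OF v] by simp_all
  qed (use action_in in auto)
  moreover have "action h \<in> extensional (carrier N)"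
    unfolding action_def by (rule restrict_extensional)
  ultimately show ?thesis
    using action_in unfolding auto_def Bij_def hom_def by blast
qed

lemma action_hom: "action \<in> hom H (AutoGroup N)"
proof (rule homI)
  fix h h'
  show "action h \<in> carrier (AutoGroup N)"
    using action_auto by (simp add: AutoGroup_def)
  have "action h \<in> Bij (carrier N)" for h
    using action_auto unfolding auto_def by blast
  then have "action h \<otimes>\<^bsub>AutoGroup N\<^esub> action h' = compose (carrier N) (action h) (action h')"
    by (simp add: AutoGroup_def BijGroup_def del: carrier_product_group)
  also have "\<dots> = action (h + h')"
  proof (rule extensionalityI[of _ "carrier N"])
    show "action (h + h') \<in> extensional (carrier N)"
      unfolding action_def by (rule restrict_extensional)
  qed (simp_all add: compose_eq action_add del: carrier_product_group)
  finally show "action (h \<otimes>\<^bsub>H\<^esub> h') = action h \<otimes>\<^bsub>AutoGroup N\<^esub> action h'"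
    by (simp add: action_mod)
qed

text \<open>
  The free part is indexed by the target arc \<open>j + int g * h\<close>. With this indexing the composition law
  turns into the multiplication \<open>(v, h) (v', h') = (v + h v', h + h')\<close> of a semidirect product, in which the
  left factor acts.
\<close>
definition winding_of :: "(nat \<Rightarrow> int) \<Rightarrow> int \<Rightarrow> int \<Rightarrow> int" where
  "winding_of v h = (\<lambda>j. to_winding v (j + int g * h) + winding (int g * h) j)"

definition invariant_of :: "(nat \<Rightarrow> int) \<times> int \<Rightarrow> complex \<Rightarrow> complex" where
  "invariant_of = (\<lambda>(v, h). SOME x. represents (int g * h) (winding_of v h) x)"

lemma represents_invariant_of: "represents (int g * h) (winding_of v h) (invariant_of (v, h))"
proof -
  have "(\<lambda>j. to_winding v (j + int g * h)) \<in> windings"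
    by (rule shift_windings[OF to_winding_in mult_g_in_rotations])
  then have v: "valid (int g * h) (winding_of v h)"
    unfolding valid_iff winding_of_def windings_def using mult_g_in_rotations winding_period by simp
  from someI_ex[OF represents_exists[OF v]] show ?thesis
    by (simp add: invariant_of_def)
qed

lemma invariant_of_inj: "inj_on invariant_of (carrier N \<times> carrier H)"
proof (rule inj_onI)
  fix a b assume ab: "a \<in> carrier N \<times> carrier H" "b \<in> carrier N \<times> carrier H" "invariant_of a = invariant_of b"
  obtain v h v' h' where [simp]: "a = (v, h)" "b = (v', h')"
    by (cases a; cases b)
  have mem: "v \<in> carrier N" "v' \<in> carrier N" "h \<in> {0..<int d}" "h' \<in> {0..<int d}"
    using ab(1,2) unfolding carrier_H by auto
  have "represents (int g * h') (winding_of v' h') (invariant_of (v, h))"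
    using represents_invariant_of[of h' v'] ab(3) by simp
  from represents_eq_iff[OF represents_invariant_of this]
  obtain q where q: "int g * h' = int g * h + q * int n" and w: "winding_of v' h' = winding_of v h"
    by blast
  have "int g * h' = int g * (h + q * int d)"
    using q gd_int by (simp add: algebra_simps)
  then have "h' = h + q * int d"
    using g_pos by simp
  then have "h' mod int d = h mod int d"
    by simp
  then have h: "h' = h"
    using mem by simp
  have "to_winding v' j = to_winding v j" for j
    using fun_cong[OF w, of "j - int g * h"] by (simp add: winding_of_def h)
  then have "v' = v"
    using to_winding_inj mem by blast
  then show "a = b"
    by (simp add: h)
qed

lemma invariant_of_surj:
  assumes "x \<in> carrier (invariant_group B)"
  shows "x \<in> invariant_of ` (carrier N \<times> carrier H)"
proof -
  obtain r m where x: "represents r m x"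
    using carrier_represents[OF assms] by blast
  then have "valid r m"
    unfolding represents_def by blast
  then have "int g dvd r"
    unfolding valid_iff rotations_iff by blast
  then obtain s where s: "r = int g * s"
    by (rule dvdE)
  define h where "h = s mod int d"
  have "r + - (s div int d) * int n = int g * h"
    unfolding s h_def using mult_g_mod[of s] by simp
  then have x': "represents (int g * h) m x"
    using represents_shift[OF x] by metis
  then have v: "valid (int g * h) m"
    unfolding represents_def by blast
  \<comment> \<open>Subtracting the forced part and reindexing by the target arc inverts \<open>winding_of\<close>.\<close>
  define w where "w j = m (j - int g * h) - winding (int g * h) (j - int g * h)" for j
  have "(\<lambda>j. m j - winding (int g * h) j) \<in> windings"
    using v winding_period unfolding valid_iff windings_def by simp
  from shift_windings[OF this minus_g_in_rotations[of h]] have w: "w \<in> windings"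
    by (simp add: w_def[abs_def])
  have "winding_of (of_winding w) h = m"
    unfolding winding_of_def to_of_winding[OF w] by (simp add: w_def)
  then have "invariant_of (of_winding w, h) = x"
    using represents_unique[OF represents_invariant_of[of h "of_winding w"]] x' by simp
  moreover have "h \<in> carrier H"
    using d_pos by (simp add: carrier_H h_def)
  ultimately show ?thesis
    using of_winding_in[of w] by blast
qed

lemma invariant_of_mult:
  assumes "v \<in> carrier N" "v' \<in> carrier N"
  shows "invariant_of (v \<otimes>\<^bsub>N\<^esub> action h v', (h + h') mod int d) =
    compose unit_circle (invariant_of (v, h)) (invariant_of (v', h'))"
proof -
  define h'' where "h'' = (h + h') mod int d"
  define q where "q = (h + h') div int d"
  have sum: "int g * h + int g * h' = int g * h'' + q * int n"
    using mult_g_mod[of "h + h'"] unfolding h''_def q_def by (simp only: distrib_left)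
  have "winding_of (v \<otimes>\<^bsub>N\<^esub> action h v') h'' j = winding_of v' h' j + winding_of v h (j + int g * h')" for j
  proof -
    have 1: "to_winding v (j + int g * h'') = to_winding v (j + int g * h' + int g * h)"
      using windings_shift[OF to_winding_in, of v "j + int g * h''" q] sum by (simp add: algebra_simps)
    have eq: "j + int g * h'' - int g * h + q * int n = j + int g * h'"
      using sum by simp
    have 2: "to_winding v' (j + int g * h'' - int g * h) = to_winding v' (j + int g * h')"
      using windings_shift[OF to_winding_in, of v' "j + int g * h'' - int g * h" q]
      unfolding eq by (rule sym)
    have "winding (int g * h'') j = winding (int g * h + int g * h') j"
      unfolding sum by (rule winding_shift[symmetric])
    also have "\<dots> = winding (int g * h') j + winding (int g * h) (j + int g * h')"
      by (intro winding_add mult_g_in_rotations)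
    finally have 3: "winding (int g * h'') j = winding (int g * h') j + winding (int g * h) (j + int g * h')" .
    show ?thesis
      unfolding winding_of_def to_winding_mult to_winding_action[OF assms(2)] 1 2 3 by simp
  qed
  then have w: "winding_of (v \<otimes>\<^bsub>N\<^esub> action h v') h'' = (\<lambda>j. winding_of v' h' j + winding_of v h (j + int g * h'))"
    by (rule ext)
  have "represents (int g * h'' + q * int n) (winding_of (v \<otimes>\<^bsub>N\<^esub> action h v') h'')
      (invariant_of (v \<otimes>\<^bsub>N\<^esub> action h v', h''))"
    by (rule represents_shift[OF represents_invariant_of])
  moreover have "represents (int g * h'' + q * int n) (winding_of (v \<otimes>\<^bsub>N\<^esub> action h v') h'')
      (compose unit_circle (invariant_of (v, h)) (invariant_of (v', h')))"
    unfolding w sum[symmetric] by (rule represents_comp[OF represents_invariant_of represents_invariant_of])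
  ultimately show ?thesis
    unfolding h''_def by (rule represents_unique)
qed

theorem invariant_group_iso: "invariant_group B \<cong> semidirect_product N H action"
proof (rule is_iso_by_inverse)
  let ?S = "semidirect_product N H action"
  have S: "carrier ?S = carrier N \<times> carrier H"
    "(v, h) \<otimes>\<^bsub>?S\<^esub> (v', h') = (v \<otimes>\<^bsub>N\<^esub> action h v', (h + h') mod int d)" for v h v' h'
    by (simp_all add: semidirect_product_def)
  show "bij_betw invariant_of (carrier ?S) (carrier (invariant_group B))"
    unfolding bij_betw_def S
  proof (intro conjI equalityI subsetI invariant_of_inj invariant_of_surj)
    fix x assume "x \<in> invariant_of ` (carrier N \<times> carrier H)"
    then obtain v h where "x = invariant_of (v, h)"
      by blast
    then show "x \<in> carrier (invariant_group B)"
      using represents_carrier[OF represents_invariant_of] by simp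
  qed
  fix a b assume ab: "a \<in> carrier ?S" "b \<in> carrier ?S"
  obtain v h v' h' where [simp]: "a = (v, h)" "b = (v', h')"
    by (cases a; cases b)
  have mem: "v \<in> carrier N" "v' \<in> carrier N"
    using ab unfolding S by auto
  show "invariant_of (a \<otimes>\<^bsub>?S\<^esub> b) = invariant_of a \<otimes>\<^bsub>invariant_group B\<^esub> invariant_of b"
    using invariant_of_mult[OF mem, of h h'] S(2)[of v h v' h'] by (simp add: invariant_group_def)
  show "a \<otimes>\<^bsub>?S\<^esub> b \<in> carrier ?S"
    using mult_N_in[of v "action h v'"] d_pos unfolding \<open>a = (v, h)\<close> \<open>b = (v', h')\<close> S carrier_H by simp
qed

end

section \<open>The structure of the group of invariants\<close>

text \<open>
  Indices in \<open>\<int>\<close> let an arc have predecessors as well as successors, and let inverse rotations be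
  treated like all others.
\<close>
definition extend_angles :: "nat \<Rightarrow> (nat \<Rightarrow> real) \<Rightarrow> int \<Rightarrow> real" where
  "extend_angles n t j = t (nat (j mod int n)) + 2 * pi * of_int (j div int n)"

lemma extend_angles_int:
  assumes n: "n > 0" and t: "\<And>j. t (j + n) = t j + 2 * pi"
  shows "extend_angles n t (int j) = t j"
proof -
  have shift: "t (i + q * n) = t i + 2 * pi * real q" for i q
  proof (induction q)
    case (Suc q)
    then show ?case
      using t[of "i + q * n"] by (simp add: algebra_simps)
  qed simp
  show ?thesis
    using shift[of "j mod n" "j div n"] n by (simp add: extend_angles_def flip: zmod_int zdiv_int)
qed

lemma circle_partition_extend_angles:
  assumes n: "n > 0" and mono: "strict_mono t" and t: "\<And>j. t (j + n) = t j + 2 * pi"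
  shows "circle_partition n (extend_angles n t)"
proof
  let ?T = "extend_angles n t"
  have period: "?T (j + q * int n) = ?T j + 2 * pi * of_int q" for j q
    using n by (simp add: extend_angles_def algebra_simps)
  show "?T (j + int n) = ?T j + 2 * pi" for j
    using period[of j 1] by simp
  have step: "?T j < ?T (j + 1)" for j
  proof -
    define i where "i = nat (j mod int n)"
    have j: "j = int i + (j div int n) * int n" "j + 1 = int (Suc i) + (j div int n) * int n"
      using n by (simp_all add: i_def)
    have "?T j = t i + 2 * pi * of_int (j div int n)"
      by (subst j(1)) (simp only: period extend_angles_int[of n t, OF n t])
    moreover have "?T (j + 1) = t (Suc i) + 2 * pi * of_int (j div int n)"
      by (subst j(2)) (simp only: period extend_angles_int[of n t, OF n t])
    ultimately show ?thesis
      using mono by (simp add: strict_mono_Suc_iff)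
  qed
  show "strict_mono ?T"
  proof (rule strict_monoI)
    fix i j :: int assume "i < j"
    then show "?T i < ?T j"
      by (induction j rule: int_gr_induct) (use step less_trans in blast)+
  qed
qed (rule n)

lemma range_extend_angles:
  assumes n: "n > 0" and t: "\<And>j. t (j + n) = t j + 2 * pi"
  shows "cis ` range (extend_angles n t) = cis ` t ` {..<n}"
proof -
  have "cis (extend_angles n t j) \<in> cis ` t ` {..<n}" for j
  proof -
    have "cis (extend_angles n t j) = cis (t (nat (j mod int n)))"
      unfolding cis_eq_cis_iff by (auto simp: extend_angles_def)
    moreover have "nat (j mod int n) < n"
      using n by (simp add: nat_less_iff)
    ultimately show ?thesis
      by blast
  qed
  moreover have "cis (t i) \<in> cis ` range (extend_angles n t)" for i
    using extend_angles_int[of n t, OF n t] by (metis image_eqI rangeI)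
  ultimately show ?thesis
    by auto
qed

lemma circle_phase_exists:
  assumes B: "blaschke_product B" and n: "n > 0" and t: "ccw_numbering (spectrum B) n t"
  shows "\<exists>\<Phi>. circle_phase n (extend_angles n t) \<Phi> B"
proof -
  let ?T = "extend_angles n t"
  have "spectrum B \<subseteq> unit_circle"
    by (auto simp: spectrum_def)
  then have t': "strict_mono t" "\<And>j. t (j + n) = t j + 2 * pi" "spectrum B = cis ` t ` {..<n}"
    using t ccw_numbering_iff by blast+
  interpret circle_partition n ?T
    using n t'(1,2) by (rule circle_partition_extend_angles)
  have spec: "spectrum B = cis ` range ?T"
    using range_extend_angles[of n t, OF n t'(2)] t'(3) by simp
  then have ne: "spectrum B \<noteq> {}"
    by simp
  define h where "h \<theta> = bdry B (cis \<theta>)" for \<theta>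
  have "\<exists>\<Phi>. (\<forall>j. continuous_on (arc j) \<Phi> \<and> strict_mono_on (arc j) \<Phi>) \<and>
    (\<forall>\<theta>. \<Phi> (\<theta> + 2 * pi) = \<Phi> \<theta>) \<and> (\<forall>\<theta>. \<theta> \<notin> range ?T \<longrightarrow> h \<theta> = cis (\<Phi> \<theta>))"
  proof (rule phase_exists)
    fix \<theta>
    have "cis (\<theta> + 2 * pi) = cis \<theta>"
      by (simp add: cis_mult[symmetric])
    then show "h (\<theta> + 2 * pi) = h \<theta>"
      by (simp add: h_def)
  next
    fix j
    have reg: "cis \<theta> \<notin> spectrum B" if "?T j < \<theta>" "\<theta> < ?T (j + 1)" for \<theta>
      using cis_T_eq_iff[of \<theta>] arc_disjoint_range[of \<theta> j] that unfolding spec by simp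
    show "\<exists>P. continuous_on (arc j) P \<and> strict_mono_on (arc j) P \<and> (\<forall>\<theta>\<in>arc j. h \<theta> = cis (P \<theta>))"
    proof (rule increasing_argument)
      fix \<theta> assume "?T j < \<theta>" "\<theta> < ?T (j + 1)"
      note d = bdry_angular_derivative[OF B ne reg[OF this]]
      show "norm (h \<theta>) = 1" "\<exists>l>0. (h has_vector_derivative \<i> * of_real l * h \<theta>) (at \<theta>)"
        using d unfolding h_def[abs_def] by simp_all
    qed
  qed
  then obtain \<Phi> where "\<And>j. continuous_on (arc j) \<Phi>" "\<And>j. strict_mono_on (arc j) \<Phi>"
      "\<And>\<theta>. \<Phi> (\<theta> + 2 * pi) = \<Phi> \<theta>" "\<And>\<theta>. \<theta> \<notin> range ?T \<Longrightarrow> h \<theta> = cis (\<Phi> \<theta>)"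
    by blast
  then have "circle_phase n ?T \<Phi> B"
    using spec by unfold_locales (simp_all add: h_def)
  then show ?thesis
    by blast
qed

text \<open>
  The intervals repeat with period \<open>n\<close>, so one turn decides.
\<close>
lemma (in circle_phase) rotation_iff_below_n:
  "r \<in> rotations \<longleftrightarrow> (\<forall>j<n. \<exists>m::int. phases (int j + r) = (\<lambda>y. y + 2 * pi * of_int m) ` phases (int j))"
proof
  assume r: "\<forall>j<n. \<exists>m::int. phases (int j + r) = (\<lambda>y. y + 2 * pi * of_int m) ` phases (int j)"
  have "\<exists>m::int. phases (j + r) = (\<lambda>y. y + 2 * pi * of_int m) ` phases j" for j
  proof -
    define i where "i = nat (j mod int n)"
    have "i < n"
      using n_pos by (simp add: i_def nat_less_iff)
    have j: "j = int i + (j div int n) * int n" "j + r = int i + r + (j div int n) * int n"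
      using n_pos by (simp_all add: i_def)
    have "phases j = phases (int i)" "phases (j + r) = phases (int i + r)"
      by (subst j(1), rule phases_shift) (subst j(2), rule phases_shift)
    then show ?thesis
      using r \<open>i < n\<close> by simp
  qed
  then show "r \<in> rotations"
    unfolding rotations_def by blast
qed (simp add: rotations_def)

theorem theorem6p2:
  fixes B :: "complex \<Rightarrow> complex" and n k d :: nat and t :: "nat \<Rightarrow> real"
  assumes "blaschke_product B"
    and "n \<ge> 1"
    and "finite (spectrum B)" and "card (spectrum B) = n"
    and "ccw_numbering (spectrum B) n t"
    and "k = card {j \<in> {..<n}. type2 B (t j) (t (Suc j))}"
    and "d = card {r \<in> {..<n}. \<forall>j<n.
                     same_type B (t j, t (Suc j)) (t (j + r), t (Suc (j + r)))}"
  shows "0 \<le> k \<and> k \<le> n \<and> 1 \<le> d \<and> d \<le> n \<and> d dvd n \<and>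
         group (invariant_group B) \<and>
         (\<exists>\<phi> \<in> hom (integer_mod_group d) (AutoGroup (integer_power_group k)).
            invariant_group B \<cong>
              semidirect_product (integer_power_group k) (integer_mod_group d) \<phi>)"
proof -
  have n: "n > 0"
    using assms(2) by simp
  define T where "T = extend_angles n t"
  obtain \<Phi> where "circle_phase n T \<Phi> B"
    using circle_phase_exists[OF assms(1) n assms(5)] unfolding T_def by blast
  then interpret circle_phase n T \<Phi> B .
  have t: "T (int j) = t j" for j
    unfolding T_def using assms(5) n by (intro extend_angles_int) (simp_all add: ccw_numbering_def)
  have tSuc: "t (Suc j) = T (int j + 1)" for j
    using t[of "Suc j"] by (simp add: add.commute)
  obtain g :: nat where g: "g > 0" "\<And>r. r \<in> rotations \<longleftrightarrow> int g dvd r"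
    using int_additive_closed_eq_multiples[OF rotations_add rotations_minus n_in_rotations n] by blast
  then have "g dvd n"
    using n_in_rotations by simp
  then obtain d' where d': "n = g * d'"
    by (rule dvdE)
  have same: "same_type B (t i, t (Suc i)) (t j, t (Suc j)) \<longleftrightarrow>
      (\<exists>m::int. phases (int j) = (\<lambda>y. y + 2 * pi * of_int m) ` phases (int i))" for i j
    using same_type_iff[of "int i" "int j"] by (simp only: t tSuc[symmetric])
  have "(\<forall>j<n. same_type B (t j, t (Suc j)) (t (j + r), t (Suc (j + r)))) \<longleftrightarrow> g dvd r" for r
    unfolding same of_nat_add
    using rotation_iff_below_n[of "int r"] g(2)[of "int r"] by simp
  then have "d = card {r \<in> {..<n}. g dvd r}"
    unfolding assms(7) by simp
  also have "{r \<in> {..<n}. g dvd r} = (\<lambda>i. g * i) ` {..<d'}"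
    using g(1) d' by auto
  also have "card \<dots> = d'"
    using g(1) by (subst card_image) (auto intro!: inj_onI)
  finally have d: "g * d = n"
    using d' by simp
  have type2: "type2 B (t j) (t (Suc j)) \<longleftrightarrow> phases (int j) = UNIV" for j
    using type2_iff_UNIV[of "int j"] by (simp only: t tSuc[symmetric])
  have k: "k = card {j. j < n \<and> phases (int j) = UNIV}"
    unfolding assms(6) type2 by simp
  then obtain pos where "bij_betw pos {..<k} {j. j < n \<and> phases (int j) = UNIV}"
    using ex_bij_betw_nat_finite[of "{j. j < n \<and> phases (int j) = UNIV}"] by (auto simp: atLeast0LessThan)
  then interpret circle_group n T \<Phi> B k pos g d
    using g(2) d by unfold_locales
  have "card {j. j < n \<and> phases (int j) = UNIV} \<le> card {..<n}"
    by (rule card_mono) auto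
  then have "k \<le> n"
    using k by simp
  moreover have "d dvd n" "d \<le> n"
    using d n by (auto intro: dvd_imp_le)
  ultimately show ?thesis
    using d_pos group_invariant_group action_hom invariant_group_iso by auto
qed

end
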